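(* The linear map $\varphi:PR\to NSym$ given on basis elements by $$\varphi(T)=\mathcal S^*_\alpha,\qquad\text{where }\alpha=C\text{-}shape(T),$$ is a surjective anti-morphism of algebras, i.e. $\varphi(T_1*T_2)=\varphi(T_2)\cdot\varphi(T_1)$.
   Context: Reverse tableaux. A standard reverse tableau (SRT) of (skew) partition shape $\nu/\mu$ is a bijective filling of the cells of $\nu/\mu$ by $1,\dots,|\nu|-|\mu|$ with rows decreasing left to right and columns decreasing top to bottom (English convention). A semistandard reverse tableau (SSRT) has rows weakly decreasing and columns strictly decreasing. The column word $w_{col}(T)$ lists the entries of each column in increasing order, columns taken left to right. $P(w)$ is the SSRT obtained by inserting the letters of $w$ from left to right by reverse Schensted row insertion: when inserting $x$ into a row, if no entry is $<x$ append $x$; otherwise $x$ replaces the leftmost entry $<x$, which is inserted into the next row. The rectification of a skew SRT $T$, as a reverse tableau, is $P(w_{col}(T))$. Algebra $PR$ (Poirier–Reutenauer). $PR$ is the $\mathbb Q$-vector space with basis all SRT of straight partition shape (including the empty one), with product as follows: if $T_1$ has shape $\mu$ and $T_2$ has $n$ cells, then $T_1*T_2=\sum_T T$, the sum over all SRT $T$ of straight shape $\nu\supseteq\mu$ (for any such $\nu$ with $|\nu|=|\mu|+n$) such that the restriction $T|_\mu$ equals $T_1+n$ ($n$ added to each entry of $T_1$) and the rectification (as a reverse tableau) of the remaining skew tableau $T|_{\nu/\mu}$ equals $T_2$. $C$-shape. A composition is a finite (possibly empty) sequence of positive integers; its diagram has $\alpha_i$ left-justified cells in row $i$, rows numbered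 from the top, cells indexed (row, column). A semistandard composition tableau (SSCT) of shape $\alpha$ is a filling $T$ of the diagram by positive integers with rows weakly decreasing left to right, first column strictly increasing top to bottom, and such that if $i<j$, $(i,k)$ and $(j,k+1)$ are cells of $\alpha$ and $T(j,k+1)\le T(i,k)$, then $(i,k+1)$ is a cell of $\alpha$ and $T(j,k+1)<T(i,k+1)$. Mason's bijection $\rho$ from SSCT to SSRT sorts each column decreasingly and top-justifies; its inverse $\rho^{-1}$ writes the first column's entries increasingly top to bottom, then, for each further column left to right, places its entries in descending order, each as high as possible subject to rows remaining weakly decreasing. For an SRT $T$ of straight shape, $C\text{-}shape(T)$ is the composition shape of $\rho^{-1}(T)$. $NSym$. The quasisymmetric Schur functions $\mathcal S_\alpha=\sum_T\prod_cx_{T(c)}$ (sum over SSCT of shape $\alpha$) form a basis of the Hopf algebra $QSym$ of quasisymmetric functions over $\mathbb Q$, with coproduct $\Delta M_\alpha=\sum_{\beta\gamma=\alpha}M_\beta\otimes M_\gamma$ (concatenation) on the monomial basis. $NSym$ is the graded Hopf dual of $QSym$ (product dual to $\Delta$: $\langle F,xy\rangle=\langle\Delta F,x\otimes y\rangle$), and $\{\mathcal S^*_\alpha\}$ is its basis dual to $\{\mathcal S_\alpha\}$. *)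

theory Defs
  imports Complex_Main "HOL-Library.Poly_Mapping"
begin

section \<open>Compositions, diagrams and reverse tableaux\<close>

definition is_composition :: "nat list \<Rightarrow> bool"
  where "is_composition \<alpha> \<longleftrightarrow> 0 \<notin> set \<alpha>"

definition is_partition :: "nat list \<Rightarrow> bool"
  where "is_partition \<nu> \<longleftrightarrow> is_composition \<nu> \<and> sorted_wrt (\<ge>) \<nu>"

text \<open>Cells are pairs (row, column), both counted from 0, in English convention.\<close>

definition diagram :: "nat list \<Rightarrow> (nat \<times> nat) set"
  where "diagram \<alpha> = {(i, j). i < length \<alpha> \<and> j < \<alpha> ! i}"

text \<open>A filling, of a straight, skew or composition shape, is a partial map whose domain is the
  set of cells. Restriction to a set of cells is restriction of partial maps.\<close>

type_synonym filling = "nat \<times> nat \<rightharpoonup> nat"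

definition skew_SRT :: "nat list \<Rightarrow> nat list \<Rightarrow> filling \<Rightarrow> bool"
  where "skew_SRT \<nu> \<mu> T \<longleftrightarrow>
    is_partition \<nu> \<and> is_partition \<mu> \<and> diagram \<mu> \<subseteq> diagram \<nu> \<and>
    dom T = diagram \<nu> - diagram \<mu> \<and>
    bij_betw T (dom T) (Some ` {1..sum_list \<nu> - sum_list \<mu>}) \<and>
    (\<forall>i j j' a b. T (i, j) = Some a \<and> T (i, j') = Some b \<and> j < j' \<longrightarrow> b < a) \<and>
    (\<forall>i i' j a b. T (i, j) = Some a \<and> T (i', j) = Some b \<and> i < i' \<longrightarrow> b < a)"

definition columns :: "filling \<Rightarrow> nat list"
  where "columns T = sorted_list_of_set (snd ` dom T)"

definition column :: "filling \<Rightarrow> nat \<Rightarrow> nat set"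
  where "column T j = {a. \<exists>i. T (i, j) = Some a}"

text \<open>Columns are strictly decreasing, so no multiplicities are lost by listing the set of
  entries of a column.\<close>

definition column_word :: "filling \<Rightarrow> nat list"
  where "column_word T = concat (map (\<lambda>j. sorted_list_of_set (column T j)) (columns T))"

fun row_insert :: "nat \<Rightarrow> nat list \<Rightarrow> nat list \<times> nat option"
  where
    "row_insert x [] = ([x], None)"
  | "row_insert x (y # ys) =
      (if y < x then (x # ys, Some y)
       else (case row_insert x ys of (zs, bumped) \<Rightarrow> (y # zs, bumped)))"

fun rs_insert :: "nat \<Rightarrow> nat list list \<Rightarrow> nat list list"
  where
    "rs_insert x [] = [[x]]"
  | "rs_insert x (r # rs) =
      (case row_insert x r of
         (r', None) \<Rightarrow> r' # rs
       | (r', Some y) \<Rightarrow> r' # rs_insert y rs)"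

definition filling_of_rows :: "nat list list \<Rightarrow> filling"
  where "filling_of_rows rs =
    (\<lambda>(i, j). if i < length rs \<and> j < length (rs ! i) then Some (rs ! i ! j) else None)"

definition P_tableau :: "nat list \<Rightarrow> filling"
  where "P_tableau w = filling_of_rows (fold rs_insert w [])"

definition rectification :: "filling \<Rightarrow> filling"
  where "rectification T = P_tableau (column_word T)"


section \<open>Linear extension\<close>

text \<open>\<open>'b \<Rightarrow>\<^sub>0 rat\<close> is the rational vector space with basis \<open>'b\<close>, the basis
  vector of \<open>b\<close> being \<open>basis b\<close>.\<close>

definition basis :: "'b \<Rightarrow> 'b \<Rightarrow>\<^sub>0 rat"
  where "basis b = Poly_Mapping.single b 1"

definition free_scale :: "rat \<Rightarrow> ('b \<Rightarrow>\<^sub>0 rat) \<Rightarrow> ('b \<Rightarrow>\<^sub>0 rat)"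
  where "free_scale c p = Poly_Mapping.map ((*) c) p"

text \<open>\<open>linear_extension s g\<close> is the linear map sending each basis vector \<open>basis b\<close> to \<open>g b\<close>,
  where \<open>s\<close> is the scalar multiplication of the target.\<close>

definition linear_extension ::
    "(rat \<Rightarrow> 'v \<Rightarrow> 'v) \<Rightarrow> ('b \<Rightarrow> 'v) \<Rightarrow> ('b \<Rightarrow>\<^sub>0 rat) \<Rightarrow> 'v::comm_monoid_add"
  where "linear_extension s g p =
    (\<Sum>b\<in>Poly_Mapping.keys p. s (Poly_Mapping.lookup p b) (g b))"

lemma lookup_free_scale [simp]:
  "Poly_Mapping.lookup (free_scale c p) b = c * Poly_Mapping.lookup p b"
  by (simp add: free_scale_def Poly_Mapping.map.rep_eq when_def)

lemma vector_space_free_scale: "vector_space free_scale"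
  by unfold_locales (auto intro!: poly_mapping_eqI simp: lookup_add algebra_simps)

lemma vector_space_rat: "vector_space ((*) :: rat \<Rightarrow> rat \<Rightarrow> rat)"
  by unfold_locales (auto simp: algebra_simps)

lemma linear_linear_extension:
  fixes s :: "rat \<Rightarrow> 'v \<Rightarrow> 'v::ab_group_add" and g :: "'b \<Rightarrow> 'v"
  assumes "vector_space s"
  shows "Vector_Spaces.linear free_scale s (linear_extension s g)"
proof -
  interpret vector_space s by fact
  interpret free: vector_space free_scale by (fact vector_space_free_scale)
  show ?thesis
    unfolding Vector_Spaces.linear_iff
  proof (intro conjI allI)
    fix p q :: "'b \<Rightarrow>\<^sub>0 rat" and c :: rat
    show "linear_extension s g (p + q) = linear_extension s g p + linear_extension s g q"
      unfolding linear_extension_def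
      by (rule setsum_keys_plus_distrib) (auto simp: scale_left_distrib)
    have "linear_extension s g (free_scale c p) =
        (\<Sum>b\<in>Poly_Mapping.keys p. s (Poly_Mapping.lookup (free_scale c p) b) (g b))"
      unfolding linear_extension_def
      by (rule sum.mono_neutral_left) (auto simp: in_keys_iff)
    also have "\<dots> = s c (linear_extension s g p)"
      by (simp add: linear_extension_def scale_sum_right)
    finally show "linear_extension s g (free_scale c p) = s c (linear_extension s g p)" .
  qed unfold_locales
qed

lemma linear_extension_basis [simp]:
  assumes "vector_space s"
  shows "linear_extension s g (basis b) = g b"
proof -
  interpret vector_space s by fact
  show ?thesis by (simp add: linear_extension_def basis_def)
qed


section \<open>The Poirier--Reutenauer algebra\<close>

typedef srt = "{T. \<exists>\<nu>. skew_SRT \<nu> [] T}"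
proof -
  have "skew_SRT [] [] Map.empty"
    by (simp add: skew_SRT_def is_partition_def is_composition_def diagram_def bij_betw_def)
  then show ?thesis by blast
qed

definition empty_srt :: srt
  where "empty_srt = Abs_srt Map.empty"

definition cells :: "srt \<Rightarrow> (nat \<times> nat) set"
  where "cells T = dom (Rep_srt T)"

type_synonym PR = "srt \<Rightarrow>\<^sub>0 rat"

text \<open>The tableaux occurring in the product of two basis elements. As \<open>T\<close> is a standard reverse
  tableau of straight shape, \<open>Rep_srt T |` (- cells T1)\<close> is its skew part outside the shape
  of \<open>T1\<close>.\<close>

definition PR_product_set :: "srt \<Rightarrow> srt \<Rightarrow> srt set"
  where "PR_product_set T1 T2 = {T.
    cells T1 \<subseteq> cells T \<and>
    card (cells T) = card (cells T1) + card (cells T2) \<and>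
    Rep_srt T |` cells T1 = map_option (\<lambda>a. a + card (cells T2)) \<circ> Rep_srt T1 \<and>
    rectification (Rep_srt T |` (- cells T1)) = Rep_srt T2}"

definition PR_mult :: "PR \<Rightarrow> PR \<Rightarrow> PR"  (infixl \<open>\<star>\<close> 70)
  where "x \<star> y =
    linear_extension free_scale
      (\<lambda>T1. linear_extension free_scale
        (\<lambda>T2. \<Sum>T\<in>PR_product_set T1 T2. basis T) y) x"


section \<open>C-shape\<close>

text \<open>A composition tableau under construction is the list of its rows. \<open>place k a\<close> puts \<open>a\<close>
  in column \<open>k\<close> (counted from 0) of the highest row in which that cell is the next free one
  and the row stays weakly decreasing. For reverse tableaux of straight shape such a row always
  exists, and the nonempty columns are numbered \<open>0, 1, \<dots>\<close> without gaps.\<close>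

fun place :: "nat \<Rightarrow> nat \<Rightarrow> nat list list \<Rightarrow> nat list list"
  where
    "place k a [] = []"
  | "place k a (r # rs) =
      (if length r = k \<and> a \<le> last r then (r @ [a]) # rs else r # place k a rs)"

definition rho_inv :: "filling \<Rightarrow> nat list list"
  where "rho_inv T =
    fold (\<lambda>k. fold (place k) (rev (sorted_list_of_set (column T k))))
      (tl (columns T))
      (map (\<lambda>a. [a]) (sorted_list_of_set (column T 0)))"

definition C_shape :: "srt \<Rightarrow> nat list"
  where "C_shape T = map length (rho_inv (Rep_srt T))"


section \<open>Quasisymmetric functions\<close>

text \<open>A formal power series in \<open>x\<^sub>1, x\<^sub>2, \<dots>\<close> is the function giving its coefficients. The
  variable \<open>x\<^bsub>i+1\<^esub>\<close> has index \<open>i\<close> in the exponent vector of a monomial.\<close>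

type_synonym monomial = "nat \<Rightarrow>\<^sub>0 nat"

text \<open>The exponents \<open>a\<^sub>1, \<dots>, a\<^sub>k > 0\<close> of a monomial
  \<open>x\<^bsub>i\<^sub>1\<^esub>^a\<^sub>1 \<cdots> x\<^bsub>i\<^sub>k\<^esub>^a\<^sub>k\<close> with \<open>i\<^sub>1 < \<cdots> < i\<^sub>k\<close>.\<close>

definition exponents :: "monomial \<Rightarrow> nat list"
  where "exponents m =
    map (Poly_Mapping.lookup m) (sorted_list_of_set (Poly_Mapping.keys m))"

definition mdegree :: "monomial \<Rightarrow> nat"
  where "mdegree m = (\<Sum>i\<in>Poly_Mapping.keys m. Poly_Mapping.lookup m i)"

typedef qsym = "{F :: monomial \<Rightarrow> rat.
    (\<forall>m m'. exponents m = exponents m' \<longrightarrow> F m = F m') \<and>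
    (\<exists>N. \<forall>m. F m \<noteq> 0 \<longrightarrow> mdegree m \<le> N)}"
  morphisms coeff Abs_qsym
  by (rule exI[of _ "\<lambda>_. 0"]) simp

setup_lifting type_definition_qsym

instantiation qsym :: ab_group_add
begin

lift_definition zero_qsym :: qsym is "\<lambda>_. 0" by simp

lift_definition plus_qsym :: "qsym \<Rightarrow> qsym \<Rightarrow> qsym" is "\<lambda>F G m. F m + G m"
proof (elim conjE exE, intro conjI allI impI)
  fix F G :: "monomial \<Rightarrow> rat" and N N' m m'
  assume "\<forall>m m'. exponents m = exponents m' \<longrightarrow> F m = F m'"
    "\<forall>m m'. exponents m = exponents m' \<longrightarrow> G m = G m'" "exponents m = exponents m'"
  then have "F m = F m'" "G m = G m'" by blast+
  then show "F m + G m = F m' + G m'" by simp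
next
  fix F G :: "monomial \<Rightarrow> rat" and N N'
  assume F: "\<forall>m. F m \<noteq> 0 \<longrightarrow> mdegree m \<le> N" and G: "\<forall>m. G m \<noteq> 0 \<longrightarrow> mdegree m \<le> N'"
  have "mdegree m \<le> max N N'" if "F m + G m \<noteq> 0" for m
  proof -
    have "F m \<noteq> 0 \<or> G m \<noteq> 0" using that by auto
    then show ?thesis using F G by (meson max.coboundedI1 max.coboundedI2)
  qed
  then show "\<exists>N. \<forall>m. F m + G m \<noteq> 0 \<longrightarrow> mdegree m \<le> N" by blast
qed

lift_definition uminus_qsym :: "qsym \<Rightarrow> qsym" is "\<lambda>F m. - F m"
  unfolding neg_equal_iff_equal neg_equal_0_iff_equal .

definition minus_qsym :: "qsym \<Rightarrow> qsym \<Rightarrow> qsym" where "minus_qsym F G = F + - G"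

instance
  by standard
    (simp_all add: minus_qsym_def coeff_inject[symmetric] fun_eq_iff
      plus_qsym.rep_eq zero_qsym.rep_eq uminus_qsym.rep_eq)

end

lift_definition qscale :: "rat \<Rightarrow> qsym \<Rightarrow> qsym" is "\<lambda>c F m. c * F m"
proof (elim conjE exE, intro conjI allI impI)
  fix c and F :: "monomial \<Rightarrow> rat" and m m'
  assume "\<forall>m m'. exponents m = exponents m' \<longrightarrow> F m = F m'" "exponents m = exponents m'"
  then have "F m = F m'" by blast
  then show "c * F m = c * F m'" by simp
next
  fix c and F :: "monomial \<Rightarrow> rat" and N
  assume "\<forall>m. F m \<noteq> 0 \<longrightarrow> mdegree m \<le> N"
  then show "\<exists>N. \<forall>m. c * F m \<noteq> 0 \<longrightarrow> mdegree m \<le> N" by (intro exI[of _ N]) simp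
qed

lemma vector_space_qscale: "vector_space qscale"
  by unfold_locales
    (simp_all add: coeff_inject[symmetric] fun_eq_iff
      plus_qsym.rep_eq qscale.rep_eq algebra_simps)

definition homogeneous :: "nat \<Rightarrow> qsym \<Rightarrow> bool"
  where "homogeneous d F \<longleftrightarrow> (\<forall>m. coeff F m \<noteq> 0 \<longrightarrow> mdegree m = d)"

lemma mdegree_eq_sum_exponents: "mdegree m = sum_list (exponents m)"
  unfolding mdegree_def exponents_def
  by (metis distinct_sorted_list_of_set finite_keys set_sorted_list_of_set
      sum.distinct_set_conv_list)

subsection \<open>Monomial basis and coproduct\<close>

lift_definition monomial_qsym :: "nat list \<Rightarrow> qsym"
  is "\<lambda>\<alpha> m. if exponents m = \<alpha> then 1 else 0"
  by (auto simp: mdegree_eq_sum_exponents)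

lemma sorted_list_of_set_lessThan: "sorted_list_of_set {..<n} = [0..<n]"
  by (metis atLeast_upt sorted_list_of_set_range atLeast0LessThan)

lemma keys_nth_composition:
  assumes "is_composition \<alpha>"
  shows "Poly_Mapping.keys (Poly_Mapping.nth \<alpha>) = {..<length \<alpha>}"
proof -
  have "\<alpha> ! i \<noteq> 0" if "i < length \<alpha>" for i
    using assms nth_mem[OF that] unfolding is_composition_def by metis
  then have "i \<in> Poly_Mapping.keys (Poly_Mapping.nth \<alpha>) \<longleftrightarrow> i < length \<alpha>" for i
    by (simp add: in_keys_iff nth_default_def del: keys_nth)
  then show ?thesis by auto
qed

lemma exponents_nth:
  assumes "is_composition \<alpha>"
  shows "exponents (Poly_Mapping.nth \<alpha>) = \<alpha>"
  unfolding exponents_def keys_nth_composition[OF assms] sorted_list_of_set_lessThan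
  by (rule nth_equalityI) (auto simp: nth_default_def)

lemma is_composition_exponents: "is_composition (exponents m)"
  by (auto simp: is_composition_def exponents_def in_keys_iff)

lemma finite_compositions_le: "finite {\<alpha>. is_composition \<alpha> \<and> sum_list \<alpha> \<le> N}"
proof (rule finite_subset)
  have "length \<alpha> \<le> sum_list \<alpha>" if "is_composition \<alpha>" for \<alpha>
    using that by (induction \<alpha>) (auto simp: is_composition_def)
  then show "{\<alpha>. is_composition \<alpha> \<and> sum_list \<alpha> \<le> N} \<subseteq> {xs. set xs \<subseteq> {..N} \<and> length xs \<le> N}"
    using le_trans member_le_sum_list by fastforce
  show "finite {xs. set xs \<subseteq> {..N} \<and> length xs \<le> N}"
    by (rule finite_lists_length_le) simp
qed

text \<open>Coordinates with respect to the basis \<open>monomial_qsym\<close> (see \<open>monomial_expansion\<close>): the coordinate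
  at \<open>\<alpha>\<close> is the coefficient of \<open>x\<^sub>1^\<alpha>\<^sub>1 \<cdots> x\<^sub>k^\<alpha>\<^sub>k\<close>.\<close>

lift_definition monomial_coords :: "qsym \<Rightarrow> nat list \<Rightarrow>\<^sub>0 rat"
  is "\<lambda>F \<alpha>. if is_composition \<alpha> then F (Poly_Mapping.nth \<alpha>) else 0"
proof (elim conjE exE)
  fix F :: "monomial \<Rightarrow> rat" and N
  assume N: "\<forall>m. F m \<noteq> 0 \<longrightarrow> mdegree m \<le> N"
  have "sum_list \<alpha> \<le> N" if "is_composition \<alpha>" "F (Poly_Mapping.nth \<alpha>) \<noteq> 0" for \<alpha>
    using N that exponents_nth[OF that(1)] by (metis mdegree_eq_sum_exponents)
  then show "finite {\<alpha>. (if is_composition \<alpha> then F (Poly_Mapping.nth \<alpha>) else 0) \<noteq> 0}"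
    by (intro finite_subset[OF _ finite_compositions_le[of N]]) auto
qed

lemma linear_monomial_coords: "Vector_Spaces.linear qscale free_scale monomial_coords"
  unfolding Vector_Spaces.linear_iff
  by (auto simp: vector_space_qscale vector_space_free_scale lookup_add
      monomial_coords.rep_eq plus_qsym.rep_eq qscale.rep_eq intro!: poly_mapping_eqI)

lemma coeff_sum: "coeff (\<Sum>i\<in>A. f i) m = (\<Sum>i\<in>A. coeff (f i) m)"
  by (induction A rule: infinite_finite_induct) (auto simp: zero_qsym.rep_eq plus_qsym.rep_eq)

lemma monomial_expansion: "linear_extension qscale monomial_qsym (monomial_coords F) = F"
proof -
  have "coeff (linear_extension qscale monomial_qsym (monomial_coords F)) m = coeff F m" for m
  proof -
    have *: "coeff F (Poly_Mapping.nth (exponents m)) = coeff F m"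
      using coeff[of F] exponents_nth[OF is_composition_exponents, of m] by blast
    have "coeff (linear_extension qscale monomial_qsym (monomial_coords F)) m =
       (\<Sum>\<alpha>\<in>Poly_Mapping.keys (monomial_coords F).
          if \<alpha> = exponents m then Poly_Mapping.lookup (monomial_coords F) \<alpha> else 0)"
      unfolding linear_extension_def coeff_sum qscale.rep_eq monomial_qsym.rep_eq
      by (rule sum.cong) auto
    also have "\<dots> = Poly_Mapping.lookup (monomial_coords F) (exponents m)"
      by (simp add: in_keys_iff)
    also have "\<dots> = coeff F m"
      by (simp add: monomial_coords.rep_eq is_composition_exponents *)
    finally show ?thesis .
  qed
  then show ?thesis by (simp add: coeff_inject[symmetric] fun_eq_iff)
qed

text \<open>The tensor square of \<open>qsym\<close> is represented by coordinates: \<open>basis (\<beta>, \<gamma>)\<close> stands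
  for \<open>monomial_qsym \<beta> \<otimes> monomial_qsym \<gamma>\<close>.\<close>

definition coproduct :: "qsym \<Rightarrow> nat list \<times> nat list \<Rightarrow>\<^sub>0 rat"
  where "coproduct F =
    linear_extension free_scale (\<lambda>\<alpha>. \<Sum>(\<beta>, \<gamma>) | \<beta> @ \<gamma> = \<alpha>. basis (\<beta>, \<gamma>)) (monomial_coords F)"

definition tensor_eval ::
    "(qsym \<Rightarrow> rat) \<Rightarrow> (qsym \<Rightarrow> rat) \<Rightarrow> (nat list \<times> nat list \<Rightarrow>\<^sub>0 rat) \<Rightarrow> rat"
  where "tensor_eval x y = linear_extension (*) (\<lambda>(\<beta>, \<gamma>). x (monomial_qsym \<beta>) * y (monomial_qsym \<gamma>))"

lemma linear_coproduct: "Vector_Spaces.linear qscale free_scale coproduct"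
proof -
  have *: "coproduct = linear_extension free_scale
      (\<lambda>\<alpha>. \<Sum>(\<beta>, \<gamma>) | \<beta> @ \<gamma> = \<alpha>. basis (\<beta>, \<gamma>)) \<circ> monomial_coords"
    by (simp add: fun_eq_iff coproduct_def)
  show ?thesis
    unfolding *
    by (rule Vector_Spaces.linear_compose[OF linear_monomial_coords
        linear_linear_extension[OF vector_space_free_scale]])
qed

subsection \<open>Quasisymmetric Schur functions\<close>

definition SSCT :: "nat list \<Rightarrow> filling \<Rightarrow> bool"
  where "SSCT \<alpha> T \<longleftrightarrow>
    dom T = diagram \<alpha> \<and> 0 \<notin> ran T \<and>
    (\<forall>i j j' a b. T (i, j) = Some a \<and> T (i, j') = Some b \<and> j < j' \<longrightarrow> b \<le> a) \<and>
    (\<forall>i i' a b. T (i, 0) = Some a \<and> T (i', 0) = Some b \<and> i < i' \<longrightarrow> a < b) \<and>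
    (\<forall>i j k a b. i < j \<and> T (i, k) = Some a \<and> T (j, Suc k) = Some b \<and> b \<le> a \<longrightarrow>
      (\<exists>c. T (i, Suc k) = Some c \<and> b < c))"

text \<open>\<open>x\<^sup>T = m\<close>, where \<open>x\<^sup>T\<close> is the product of \<open>x\<^bsub>T(c)\<^esub>\<close> over all cells \<open>c\<close>.\<close>

definition has_content :: "filling \<Rightarrow> monomial \<Rightarrow> bool"
  where "has_content T m \<longleftrightarrow>
    (\<forall>i. card {c. T c = Some (Suc i)} = Poly_Mapping.lookup m i)"

definition SSCT_with_content :: "nat list \<Rightarrow> monomial \<Rightarrow> filling set"
  where "SSCT_with_content \<alpha> m = {T. SSCT \<alpha> T \<and> has_content T m}"

lemma finite_diagram: "finite (diagram \<alpha>)"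
proof -
  have "diagram \<alpha> = (SIGMA i:{..<length \<alpha>}. {..<\<alpha> ! i})"
    by (auto simp: diagram_def)
  then show ?thesis by simp
qed

lemma finite_entry:
  assumes "dom T = diagram \<alpha>"
  shows "finite {c. T c = Some a}"
proof (rule finite_subset)
  show "{c. T c = Some a} \<subseteq> dom T" by blast
  show "finite (dom T)" unfolding assms by (rule finite_diagram)
qed

lemma SSCT_with_content_entry:
  assumes "T \<in> SSCT_with_content \<alpha> m" "T c = Some a"
  shows "a > 0" "a - 1 \<in> Poly_Mapping.keys m"
proof -
  have T: "dom T = diagram \<alpha>" "0 \<notin> ran T" "has_content T m"
    using assms(1) by (auto simp: SSCT_with_content_def SSCT_def)
  show a: "a > 0" using T(2) assms(2) by (metis gr0I ranI)
  have "finite {c. T c = Some a}"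
    using T(1) by (rule finite_entry)
  moreover have "c \<in> {c. T c = Some a}" using assms(2) by (rule CollectI)
  ultimately have "card {c. T c = Some a} > 0" by (metis card_gt_0_iff empty_iff)
  moreover have "card {c. T c = Some (Suc (a - 1))} = Poly_Mapping.lookup m (a - 1)"
    using T(3) by (simp add: has_content_def)
  ultimately show "a - 1 \<in> Poly_Mapping.keys m" using a by (simp add: in_keys_iff)
qed

lemma SSCT_with_content_degree:
  assumes "T \<in> SSCT_with_content \<alpha> m"
  shows "mdegree m = card (diagram \<alpha>)"
proof -
  have T: "dom T = diagram \<alpha>" "has_content T m"
    using assms by (auto simp: SSCT_with_content_def SSCT_def)
  have "diagram \<alpha> = (\<Union>i\<in>Poly_Mapping.keys m. {c. T c = Some (Suc i)})"
    unfolding T(1)[symmetric]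
  proof (intro equalityI subsetI)
    fix c assume "c \<in> dom T"
    then obtain a where a: "T c = Some a" by blast
    then show "c \<in> (\<Union>i\<in>Poly_Mapping.keys m. {c. T c = Some (Suc i)})"
      using SSCT_with_content_entry[OF assms a] by (intro UN_I[of "a - 1"]) auto
  qed auto
  moreover have "card (\<Union>i\<in>Poly_Mapping.keys m. {c. T c = Some (Suc i)}) =
      (\<Sum>i\<in>Poly_Mapping.keys m. card {c. T c = Some (Suc i)})"
  proof (rule card_UN_disjoint)
    show "\<forall>i\<in>Poly_Mapping.keys m. finite {c. T c = Some (Suc i)}"
      using finite_entry[OF T(1)] by blast
  qed auto
  ultimately show ?thesis using T(2) by (simp add: has_content_def mdegree_def)
qed

definition relabel :: "(nat \<Rightarrow> nat) \<Rightarrow> filling \<Rightarrow> filling"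
  where "relabel f T = map_option (\<lambda>a. Suc (f (a - 1))) \<circ> T"

lemma relabel_SSCT_with_content:
  assumes mono: "strict_mono_on (Poly_Mapping.keys m) f"
    and keys: "Poly_Mapping.keys m' = f ` Poly_Mapping.keys m"
    and lookup: "\<And>i. i \<in> Poly_Mapping.keys m \<Longrightarrow>
      Poly_Mapping.lookup m' (f i) = Poly_Mapping.lookup m i"
    and T: "T \<in> SSCT_with_content \<alpha> m"
  shows "relabel f T \<in> SSCT_with_content \<alpha> m'"
proof -
  note entry = SSCT_with_content_entry[OF T]
  have less: "f (a - 1) < f (b - 1) \<longleftrightarrow> a < b" if "T c = Some a" "T d = Some b" for a b c d
    using strict_mono_on_less[OF mono entry(2)[OF that(1)] entry(2)[OF that(2)]]
      entry(1)[OF that(1)] entry(1)[OF that(2)] by linarith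
  then have le: "f (a - 1) \<le> f (b - 1) \<longleftrightarrow> a \<le> b" if "T c = Some a" "T d = Some b" for a b c d
    using less[OF that(2,1)] by linarith
  have S: "SSCT \<alpha> T" and C: "has_content T m"
    using T by (auto simp: SSCT_with_content_def)
  have "has_content (relabel f T) m'"
    unfolding has_content_def
  proof
    fix i
    show "card {c. relabel f T c = Some (Suc i)} = Poly_Mapping.lookup m' i"
    proof (cases "i \<in> Poly_Mapping.keys m'")
      case True
      then obtain k where k: "k \<in> Poly_Mapping.keys m" "i = f k" using keys by auto
      have "{c. relabel f T c = Some (Suc i)} = {c. T c = Some (Suc k)}"
      proof -
        have *: "a = Suc k" if "T c = Some a" "f (a - 1) = f k" for a c
          using inj_onD[OF strict_mono_on_imp_inj_on[OF mono] that(2) entry(2)[OF that(1)] k(1)]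
            entry(1)[OF that(1)] by linarith
        have "relabel f T c = Some (Suc i) \<longleftrightarrow> T c = Some (Suc k)" for c
          using *[of c] unfolding k(2) by (cases "T c") (auto simp: relabel_def)
        then show ?thesis by simp
      qed
      then show ?thesis using C k lookup by (simp add: has_content_def)
    next
      case False
      have "relabel f T c \<noteq> Some (Suc i)" for c
        using False entry(2)[of c] unfolding keys by (cases "T c") (auto simp: relabel_def)
      then have *: "{c. relabel f T c = Some (Suc i)} = {}" by simp
      show ?thesis unfolding * using False by (simp add: in_keys_iff)
    qed
  qed
  moreover have "SSCT \<alpha> (relabel f T)"
    unfolding SSCT_def
  proof (intro conjI allI impI)
    show "dom (relabel f T) = diagram \<alpha>"
    proof -
      have "dom T = diagram \<alpha>" using S unfolding SSCT_def by blast
      moreover have "dom (relabel f T) = dom T" by (auto simp: relabel_def)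
      ultimately show ?thesis by simp
    qed
    show "0 \<notin> ran (relabel f T)" by (auto simp: relabel_def ran_def)
  next
    fix i j j' a b
    assume "relabel f T (i, j) = Some a \<and> relabel f T (i, j') = Some b \<and> j < j'"
    then obtain a' b' where "T (i, j) = Some a'" "T (i, j') = Some b'" "j < j'"
      "a = Suc (f (a' - 1))" "b = Suc (f (b' - 1))" by (auto simp: relabel_def)
    moreover from this have "b' \<le> a'" using S unfolding SSCT_def by blast
    ultimately show "b \<le> a" using le[of "(i, j')" b' "(i, j)" a'] by simp
  next
    fix i i' a b
    assume "relabel f T (i, 0) = Some a \<and> relabel f T (i', 0) = Some b \<and> i < i'"
    then obtain a' b' where "T (i, 0) = Some a'" "T (i', 0) = Some b'" "i < i'"
      "a = Suc (f (a' - 1))" "b = Suc (f (b' - 1))" by (auto simp: relabel_def)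
    moreover from this have "a' < b'" using S unfolding SSCT_def by blast
    ultimately show "a < b" using less[of "(i, 0)" a' "(i', 0)" b'] by simp
  next
    fix i j k a b
    assume *: "i < j \<and> relabel f T (i, k) = Some a \<and> relabel f T (j, Suc k) = Some b \<and> b \<le> a"
    then obtain a' b' where **: "T (i, k) = Some a'" "T (j, Suc k) = Some b'"
      "a = Suc (f (a' - 1))" "b = Suc (f (b' - 1))" by (auto simp: relabel_def)
    have "b' \<le> a'" using * ** le[OF **(2,1)] by simp
    then obtain c where c: "T (i, Suc k) = Some c" "b' < c"
      using S * ** unfolding SSCT_def by blast
    then show "\<exists>c. relabel f T (i, Suc k) = Some c \<and> b < c"
      using ** less[OF **(2) c(1)] by (simp add: relabel_def)
  qed
  ultimately show ?thesis by (simp add: SSCT_with_content_def)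
qed

lemma card_SSCT_with_content_relabel:
  assumes mono: "strict_mono_on (Poly_Mapping.keys m) f"
    and keys: "Poly_Mapping.keys m' = f ` Poly_Mapping.keys m"
    and lookup: "\<And>i. i \<in> Poly_Mapping.keys m \<Longrightarrow>
      Poly_Mapping.lookup m' (f i) = Poly_Mapping.lookup m i"
  shows "card (SSCT_with_content \<alpha> m) = card (SSCT_with_content \<alpha> m')"
proof -
  define g where "g = the_inv_into (Poly_Mapping.keys m) f"
  have gf: "g (f i) = i" if "i \<in> Poly_Mapping.keys m" for i
    unfolding g_def using the_inv_into_f_f[OF strict_mono_on_imp_inj_on[OF mono] that] .
  have fg: "f (g i) = i" if "i \<in> Poly_Mapping.keys m'" for i
    using that gf unfolding keys by auto
  have keys': "Poly_Mapping.keys m = g ` Poly_Mapping.keys m'"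
    unfolding keys image_image using gf by auto
  have mono': "strict_mono_on (Poly_Mapping.keys m') g"
  proof (rule strict_mono_onI)
    fix r t assume "r \<in> Poly_Mapping.keys m'" "t \<in> Poly_Mapping.keys m'" "r < t"
    moreover from this obtain i j where "i \<in> Poly_Mapping.keys m" "j \<in> Poly_Mapping.keys m"
      "r = f i" "t = f j" unfolding keys by blast
    ultimately show "g r < g t" using gf strict_mono_on_less[OF mono, of i j] by simp
  qed
  have lookup': "Poly_Mapping.lookup m (g i) = Poly_Mapping.lookup m' i"
    if "i \<in> Poly_Mapping.keys m'" for i
    using that lookup gf unfolding keys by auto
  have "bij_betw (relabel f) (SSCT_with_content \<alpha> m) (SSCT_with_content \<alpha> m')"
  proof (rule bij_betw_byWitness[where f' = "relabel g"])
    show "\<forall>T\<in>SSCT_with_content \<alpha> m. relabel g (relabel f T) = T"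
    proof (intro ballI ext)
      fix T c assume T: "T \<in> SSCT_with_content \<alpha> m"
      show "relabel g (relabel f T) c = T c"
        using SSCT_with_content_entry[OF T, of c] gf
        by (cases "T c") (auto simp: relabel_def)
    qed
    show "\<forall>T\<in>SSCT_with_content \<alpha> m'. relabel f (relabel g T) = T"
    proof (intro ballI ext)
      fix T c assume T: "T \<in> SSCT_with_content \<alpha> m'"
      show "relabel f (relabel g T) c = T c"
        using SSCT_with_content_entry[OF T, of c] fg
        by (cases "T c") (auto simp: relabel_def)
    qed
    show "relabel f ` SSCT_with_content \<alpha> m \<subseteq> SSCT_with_content \<alpha> m'"
      using relabel_SSCT_with_content[OF mono keys lookup] by blast
    show "relabel g ` SSCT_with_content \<alpha> m' \<subseteq> SSCT_with_content \<alpha> m"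
      using relabel_SSCT_with_content[OF mono' keys' lookup'] by blast
  qed
  then show ?thesis by (rule bij_betw_same_card)
qed

lemma card_SSCT_with_content:
  "card (SSCT_with_content \<alpha> (Poly_Mapping.nth (exponents m))) = card (SSCT_with_content \<alpha> m)"
proof (rule card_SSCT_with_content_relabel)
  let ?ks = "sorted_list_of_set (Poly_Mapping.keys m)"
  let ?m = "Poly_Mapping.nth (exponents m)"
  have keys: "Poly_Mapping.keys ?m = {..<length ?ks}"
    unfolding keys_nth_composition[OF is_composition_exponents]
    by (simp only: exponents_def length_map)
  show "strict_mono_on (Poly_Mapping.keys ?m) ((!) ?ks)"
    unfolding keys using strict_sorted_list_of_set[of "Poly_Mapping.keys m"]
    by (auto simp: strict_mono_on_def sorted_wrt_iff_nth_less simp del: strict_sorted_list_of_set)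
  have "Poly_Mapping.keys m = set ?ks" by simp
  also have "\<dots> = (!) ?ks ` {..<length ?ks}"
    by (auto simp: set_conv_nth simp del: set_sorted_list_of_set)
  finally show "Poly_Mapping.keys m = (!) ?ks ` Poly_Mapping.keys ?m" unfolding keys .
  show "Poly_Mapping.lookup m (?ks ! i) = Poly_Mapping.lookup ?m i"
    if "i \<in> Poly_Mapping.keys ?m" for i
    using that unfolding keys by (simp add: exponents_def nth_default_def)
qed

lift_definition qschur :: "nat list \<Rightarrow> qsym"
  is "\<lambda>\<alpha> m. of_nat (card (SSCT_with_content \<alpha> m))"
proof (intro conjI allI impI)
  fix \<alpha> m m'
  assume "exponents m = exponents m'"
  then show "(of_nat (card (SSCT_with_content \<alpha> m)) :: rat) =
      of_nat (card (SSCT_with_content \<alpha> m'))"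
    using card_SSCT_with_content by metis
next
  fix \<alpha>
  have "mdegree m \<le> card (diagram \<alpha>)"
    if "(of_nat (card (SSCT_with_content \<alpha> m)) :: rat) \<noteq> 0" for m
  proof -
    have "SSCT_with_content \<alpha> m \<noteq> {}" using that by force
    then show ?thesis using SSCT_with_content_degree by fastforce
  qed
  then show "\<exists>N. \<forall>m. (of_nat (card (SSCT_with_content \<alpha> m)) :: rat) \<noteq> 0 \<longrightarrow> mdegree m \<le> N"
    by blast
qed


section \<open>Noncommutative symmetric functions\<close>

text \<open>The graded dual of \<open>qsym\<close>: linear forms vanishing on all but finitely many
  homogeneous components.\<close>

typedef nsym = "{x :: qsym \<Rightarrow> rat. Vector_Spaces.linear qscale (*) x \<and>
    (\<exists>N. \<forall>d F. N \<le> d \<longrightarrow> homogeneous d F \<longrightarrow> x F = 0)}"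
  morphisms pairing Abs_nsym
  by (rule exI[of _ "\<lambda>_. 0"])
    (simp add: Vector_Spaces.linear_iff vector_space_qscale vector_space_rat)

setup_lifting type_definition_nsym

instantiation nsym :: ab_group_add
begin

lift_definition zero_nsym :: nsym is "\<lambda>_. 0"
  by (simp add: Vector_Spaces.linear_iff vector_space_qscale vector_space_rat)

lift_definition plus_nsym :: "nsym \<Rightarrow> nsym \<Rightarrow> nsym" is "\<lambda>x y F. x F + y F"
proof (elim conjE exE, intro conjI)
  fix x y :: "qsym \<Rightarrow> rat" and N N'
  assume "\<forall>d F. N \<le> d \<longrightarrow> homogeneous d F \<longrightarrow> x F = 0" "\<forall>d F. N' \<le> d \<longrightarrow> homogeneous d F \<longrightarrow> y F = 0"
  then show "\<exists>N. \<forall>d F. N \<le> d \<longrightarrow> homogeneous d F \<longrightarrow> x F + y F = 0"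
    by (intro exI[of _ "max N N'"]) auto
qed (auto simp: Vector_Spaces.linear_iff algebra_simps)

lift_definition uminus_nsym :: "nsym \<Rightarrow> nsym" is "\<lambda>x F. - x F"
  by (auto simp: Vector_Spaces.linear_iff algebra_simps)

definition minus_nsym :: "nsym \<Rightarrow> nsym \<Rightarrow> nsym" where "minus_nsym x y = x + - y"

instance
  by standard
    (simp_all add: minus_nsym_def pairing_inject[symmetric] fun_eq_iff
      plus_nsym.rep_eq zero_nsym.rep_eq uminus_nsym.rep_eq)

end

lift_definition nscale :: "rat \<Rightarrow> nsym \<Rightarrow> nsym" is "\<lambda>c x F. c * x F"
proof (elim conjE exE, intro conjI)
  fix c and x :: "qsym \<Rightarrow> rat" and N
  assume "\<forall>d F. N \<le> d \<longrightarrow> homogeneous d F \<longrightarrow> x F = 0"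
  then show "\<exists>N. \<forall>d F. N \<le> d \<longrightarrow> homogeneous d F \<longrightarrow> c * x F = 0" by (intro exI[of _ N]) simp
qed (simp add: Vector_Spaces.linear_iff algebra_simps)

lemma vector_space_nscale: "vector_space nscale"
  by unfold_locales
    (simp_all add: pairing_inject[symmetric] fun_eq_iff
      plus_nsym.rep_eq nscale.rep_eq algebra_simps)

lemma linear_tensor_eval: "Vector_Spaces.linear free_scale (*) (tensor_eval x y)"
  unfolding tensor_eval_def by (rule linear_linear_extension[OF vector_space_rat])

lemma homogeneous_monomial: "homogeneous (sum_list \<alpha>) (monomial_qsym \<alpha>)"
  by (auto simp: homogeneous_def monomial_qsym.rep_eq mdegree_eq_sum_exponents)

lemma linear_sum_rat:
  assumes "Vector_Spaces.linear s ((*) :: rat \<Rightarrow> rat \<Rightarrow> rat) f"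
  shows "f (\<Sum>i\<in>A. g i) = (\<Sum>i\<in>A. f (g i))"
proof -
  interpret Vector_Spaces.linear s "(*)" f by fact
  show ?thesis by (rule sum)
qed

instantiation nsym :: "{one, times}"
begin

text \<open>The unit is the counit (constant coefficient) of \<open>qsym\<close>, and the product is dual to the coproduct.\<close>

lift_definition one_nsym :: nsym is "\<lambda>F. coeff F 0"
proof (intro conjI exI allI impI)
  show "Vector_Spaces.linear qscale (*) (\<lambda>F. coeff F 0)"
    by (simp add: Vector_Spaces.linear_iff vector_space_qscale vector_space_rat
        plus_qsym.rep_eq qscale.rep_eq)
next
  fix d F assume "1 \<le> d" "homogeneous d F"
  then show "coeff F 0 = 0" by (auto simp: homogeneous_def mdegree_def)
qed

lift_definition times_nsym :: "nsym \<Rightarrow> nsym \<Rightarrow> nsym"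
  is "\<lambda>x y F. tensor_eval x y (coproduct F)"
proof (elim conjE exE, intro conjI)
  fix x y :: "qsym \<Rightarrow> rat" and N N'
  show lin: "Vector_Spaces.linear qscale (*) (\<lambda>F. tensor_eval x y (coproduct F))"
    using Vector_Spaces.linear_compose[OF linear_coproduct linear_tensor_eval]
    by (simp add: o_def)
  assume N: "\<forall>d F. N \<le> d \<longrightarrow> homogeneous d F \<longrightarrow> x F = 0"
    and N': "\<forall>d F. N' \<le> d \<longrightarrow> homogeneous d F \<longrightarrow> y F = 0"
  have M: "tensor_eval x y (coproduct F) = 0" if d: "N + N' \<le> d" and F: "homogeneous d F" for d F
  proof -
    interpret t: Vector_Spaces.linear free_scale "(*)" "tensor_eval x y"
      by (rule linear_tensor_eval)
    have "tensor_eval x y (coproduct F) = (\<Sum>\<alpha>\<in>Poly_Mapping.keys (monomial_coords F).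
        Poly_Mapping.lookup (monomial_coords F) \<alpha> *
        (\<Sum>(\<beta>, \<gamma>) | \<beta> @ \<gamma> = \<alpha>. x (monomial_qsym \<beta>) * y (monomial_qsym \<gamma>)))"
      unfolding coproduct_def linear_extension_def[of free_scale] t.sum t.scale
      by (intro sum.cong refl arg_cong2[of _ _ _ _ "(*)"])
        (auto simp: tensor_eval_def linear_extension_basis[OF vector_space_rat])
    also have "\<dots> = 0"
    proof (rule sum.neutral, rule ballI)
      fix \<alpha> assume "\<alpha> \<in> Poly_Mapping.keys (monomial_coords F)"
      then have "coeff F (Poly_Mapping.nth \<alpha>) \<noteq> 0" "is_composition \<alpha>"
        by (auto simp: in_keys_iff monomial_coords.rep_eq split: if_splits)
      then have deg: "sum_list \<alpha> = d"
        using F by (auto simp: homogeneous_def mdegree_eq_sum_exponents exponents_nth)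
      have "x (monomial_qsym \<beta>) * y (monomial_qsym \<gamma>) = 0" if "\<beta> @ \<gamma> = \<alpha>" for \<beta> \<gamma>
      proof -
        have "N \<le> sum_list \<beta> \<or> N' \<le> sum_list \<gamma>" using that deg d by auto
        then show ?thesis using N N' homogeneous_monomial by fastforce
      qed
      then have "(\<Sum>(\<beta>, \<gamma>) | \<beta> @ \<gamma> = \<alpha>. x (monomial_qsym \<beta>) * y (monomial_qsym \<gamma>)) = 0"
        by (intro sum.neutral) auto
      then show "Poly_Mapping.lookup (monomial_coords F) \<alpha> *
        (\<Sum>(\<beta>, \<gamma>) | \<beta> @ \<gamma> = \<alpha>. x (monomial_qsym \<beta>) * y (monomial_qsym \<gamma>)) = 0"
        by simp
    qed
    finally show ?thesis .
  qed
  then show "\<exists>N. \<forall>d F. N \<le> d \<longrightarrow> homogeneous d F \<longrightarrow> tensor_eval x y (coproduct F) = 0"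
    by blast
qed

instance ..

end

text \<open>The family \<open>qschur\<close>, indexed by compositions, is a basis of \<open>qsym\<close>, so the dual
  basis vectors are determined by their values on it.\<close>

definition qschur_dual :: "nat list \<Rightarrow> nsym"
  where "qschur_dual \<alpha> = (THE x. \<forall>\<beta>. is_composition \<beta> \<longrightarrow>
    pairing x (qschur \<beta>) = (if \<beta> = \<alpha> then 1 else 0))"


section \<open>The map from tableaux to noncommutative symmetric functions\<close>

definition phi :: "PR \<Rightarrow> nsym"
  where "phi = linear_extension nscale (\<lambda>T. qschur_dual (C_shape T))"

end

theory Submission
  imports Defs "HOL-Library.Multiset"
begin

text \<open>
  Record a standard reverse tableau with \<open>n\<close> cells by its word: the list of the column numbers of
  \<open>n\<close>, \<open>n - 1\<close>, ..., \<open>1\<close>. The words that occur are the Yamanouchi words (those that are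
  \<open>admissible\<close>), and the C-shape is computed by reading the word from left to right: a letter \<open>j\<close>
  extends the first row of length \<open>j\<close> by a cell, or starts a new first row if \<open>j = 0\<close>
  (\<open>C_shape_walk\<close>). So the C-shape is the end of a walk in a poset of compositions. The tableaux in
  the product of \<open>T1\<close> and \<open>T2\<close> are the words \<open>c @ s\<close> with \<open>c\<close> the word of \<open>T1\<close> and with the skew part
  \<open>s\<close> rectifying to \<open>T2\<close> (\<open>PR_product_set_iff\<close>). As \<open>s\<close> continues the walk from the C-shape of \<open>T1\<close>, the
  number \<open>lr\<close> of tableaux in the product with a given C-shape depends on \<open>T1\<close> only through its C-shape. The
  theorem says that it depends on \<open>T2\<close> only through its C-shape as well, and that it is a structure
  constant of the coproduct of the quasisymmetric Schur functions.

  Dependence on \<open>T2\<close>. Deleting the largest entry of a tableau and rectifying the rest is a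
  jeu de taquin slide. Read letter by letter, the slide is a reversible transducer (\<open>slide\<close>). It shows
  that undoing a slide acts on C-shapes by an operator \<open>outer j\<close> that depends on the C-shape and on
  the column \<open>j\<close> of the cell that is gained, and on nothing else (\<open>slide_correct\<close>). Hence a tableau
  with \<open>m + n\<close> cells is the same as a tableau \<open>q\<close> with \<open>n\<close> cells, to which its \<open>n\<close> smallest entries
  rectify, together with \<open>m\<close> column numbers \<open>js\<close>; its C-shape is a function of \<open>js\<close> and of the
  C-shape of \<open>q\<close>, and the descents of its \<open>m\<close> largest entries are visible in \<open>js\<close>
  (\<open>rectify_correct\<close>, \<open>first_two_slides\<close>). So for every composition \<open>\<epsilon>\<close> of \<open>m\<close> the sum of \<open>lr \<beta> q \<alpha>\<close>,
  weighted by the number \<open>kostka \<beta> \<epsilon>\<close> of tableaux of C-shape \<open>\<beta>\<close> whose descents are compatible with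
  \<open>\<epsilon>\<close>, depends only on the C-shape of \<open>q\<close> (\<open>lr_sum_cong\<close>). The matrix \<open>kostka\<close> is unitriangular,
  therefore each \<open>lr \<beta> q \<alpha>\<close> depends only on the C-shape of \<open>q\<close> (\<open>lr_cong\<close>).

  Coproduct. The number \<open>kostka \<alpha> \<epsilon>\<close> is also the coefficient of the monomial function of \<open>\<epsilon>\<close> in
  \<open>qschur \<alpha>\<close> (\<open>kostka_eq_card\<close>): this is standardization. Unitriangularity makes \<open>qschur\<close> a basis,
  and cutting a word in two expresses \<open>kostka \<alpha> (\<delta>1 @ \<delta>2)\<close> through the numbers \<open>lr\<close>
  (\<open>kostka_append\<close>). Since the coproduct cuts compositions, the dual statement is that the structure
  constants of the dual basis are the numbers \<open>lr\<close>; the later letters belong to the left factor of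
  the coproduct, which is why the map reverses products (\<open>phi_product_basis\<close>).
\<close>

section \<open>Walks on compositions\<close>

fun raise :: "nat \<Rightarrow> nat list \<Rightarrow> nat list" where
  "raise j [] = []"
| "raise j (a # \<alpha>) = (if a = j then Suc a # \<alpha> else a # raise j \<alpha>)"

text \<open>The covering relation of the poset of compositions that governs C-shapes: the cell gained in
  column \<open>j\<close> (counted from 0) goes to the highest row that ends just before this column.\<close>

definition up :: "nat \<Rightarrow> nat list \<Rightarrow> nat list"
  where "up j \<alpha> = (if j = 0 then 1 # \<alpha> else raise j \<alpha>)"

definition addable :: "nat \<Rightarrow> nat list \<Rightarrow> bool"
  where "addable j \<alpha> \<longleftrightarrow> j = 0 \<or> j \<in> set \<alpha>"

abbreviation walk :: "nat list \<Rightarrow> nat list \<Rightarrow> nat list"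
  where "walk \<alpha> c \<equiv> fold up c \<alpha>"

fun admissible :: "nat list \<Rightarrow> nat list \<Rightarrow> bool" where
  "admissible \<alpha> [] \<longleftrightarrow> True"
| "admissible \<alpha> (j # c) \<longleftrightarrow> addable j \<alpha> \<and> admissible (up j \<alpha>) c"

text \<open>The number of cells in column \<open>j\<close> of the diagram.\<close>

definition height :: "nat list \<Rightarrow> nat \<Rightarrow> nat"
  where "height \<alpha> j = length (filter (\<lambda>a. j < a) \<alpha>)"

lemma admissible_append:
  "admissible \<alpha> (c @ d) \<longleftrightarrow> admissible \<alpha> c \<and> admissible (walk \<alpha> c) d"
  by (induction c arbitrary: \<alpha>) auto

lemma raise_append:
  "raise j (\<alpha> @ \<beta>) = (if j \<in> set \<alpha> then raise j \<alpha> @ \<beta> else \<alpha> @ raise j \<beta>)"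
  by (induction \<alpha>) auto

lemma up_append: "addable j \<alpha> \<Longrightarrow> up j (\<alpha> @ \<beta>) = up j \<alpha> @ \<beta>"
  by (auto simp: up_def addable_def raise_append)

lemma height_Nil [simp]: "height [] j = 0"
  by (simp add: height_def)

lemma height_Cons: "height (a # \<alpha>) j = (if j < a then 1 else 0) + height \<alpha> j"
  by (simp add: height_def)

lemma height_append: "height (\<alpha> @ \<beta>) j = height \<alpha> j + height \<beta> j"
  by (simp add: height_def)

lemma height_antimono: "i \<le> j \<Longrightarrow> height \<alpha> j \<le> height \<alpha> i"
  by (induction \<alpha>) (auto simp: height_Cons)

lemma height_count: "height \<alpha> j = count_list \<alpha> (Suc j) + height \<alpha> (Suc j)"
  by (induction \<alpha>) (auto simp: height_Cons)

lemma height_raise: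
  "j \<in> set \<alpha> \<Longrightarrow> height (raise j \<alpha>) i = height \<alpha> i + (if i = j then 1 else 0)"
  by (induction \<alpha>) (auto simp: height_Cons)

lemma height_up:
  "addable j \<alpha> \<Longrightarrow> height (up j \<alpha>) i = height \<alpha> i + (if i = j then 1 else 0)"
  by (auto simp: up_def addable_def height_raise height_Cons)

lemma in_set_iff_count: "x \<in> set \<alpha> \<longleftrightarrow> 0 < count_list \<alpha> x"
  by (metis count_list_0_iff gr0I less_irrefl)

text \<open>There is a row of length \<open>j > 0\<close> if and only if column \<open>j\<close> is shorter than column
  \<open>j - 1\<close>. So the columns that can gain a cell, unlike the row that gains it, are determined by the
  underlying partition.\<close>

lemma addable_iff_height: "addable j \<alpha> \<longleftrightarrow> j = 0 \<or> height \<alpha> j < height \<alpha> (j - 1)"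
  using height_count[of \<alpha> "j - 1"]
  by (cases j) (auto simp: addable_def in_set_iff_count)

lemma height_walk:
  "admissible \<alpha> c \<Longrightarrow> height (walk \<alpha> c) i = height \<alpha> i + count_list c i"
  by (induction c arbitrary: \<alpha>) (auto simp: height_up)

lemma pos_raise: "0 \<notin> set \<alpha> \<Longrightarrow> 0 \<notin> set (raise j \<alpha>)"
  by (induction \<alpha>) auto

lemma pos_up: "0 \<notin> set \<alpha> \<Longrightarrow> 0 \<notin> set (up j \<alpha>)"
  by (auto simp: up_def pos_raise)

lemma pos_walk: "0 \<notin> set \<alpha> \<Longrightarrow> 0 \<notin> set (walk \<alpha> c)"
  by (induction c arbitrary: \<alpha>) (auto simp: pos_up)

lemma sum_list_raise: "j \<in> set \<alpha> \<Longrightarrow> sum_list (raise j \<alpha>) = Suc (sum_list \<alpha>)"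
  by (induction \<alpha>) auto

lemma sum_list_up: "addable j \<alpha> \<Longrightarrow> sum_list (up j \<alpha>) = Suc (sum_list \<alpha>)"
  by (auto simp: up_def addable_def sum_list_raise)

lemma sum_list_walk: "admissible \<alpha> c \<Longrightarrow> sum_list (walk \<alpha> c) = sum_list \<alpha> + length c"
  by (induction c arbitrary: \<alpha>) (auto simp: sum_list_up)

text \<open>The heights of the columns along a walk from the empty composition count letters, which turns
  admissibility into the ballot condition of Yamanouchi words.\<close>

lemma admissible_iff_prefix:
  "admissible [] c \<longleftrightarrow>
    (\<forall>d e j. c = d @ e \<longrightarrow> count_list d (Suc j) \<le> count_list d j)"
proof (induction c rule: rev_induct)
  case Nil
  show ?case by simp
next
  case (snoc x c)
  have split: "(\<forall>d e j. c @ [x] = d @ e \<longrightarrow> count_list d (Suc j) \<le> count_list d j) \<longleftrightarrow>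
    (\<forall>d e j. c = d @ e \<longrightarrow> count_list d (Suc j) \<le> count_list d j) \<and>
    (\<forall>j. count_list (c @ [x]) (Suc j) \<le> count_list (c @ [x]) j)" (is "?L = (?R1 \<and> ?R2)")
  proof
    assume L: ?L
    show "?R1 \<and> ?R2"
      using L by (metis append_assoc append_Nil2)
  next
    assume R: "?R1 \<and> ?R2"
    show ?L
    proof (intro allI impI)
      fix d e j assume "c @ [x] = d @ e"
      then show "count_list d (Suc j) \<le> count_list d j"
        using R by (cases e rule: rev_cases) (auto simp del: count_list_append)
    qed
  qed
  show ?case
  proof (cases "admissible [] c")
    case True
    have h: "height (walk [] c) i = count_list c i" for i
      using height_walk[OF True, of i] by simp
    have mono: "count_list c (Suc j) \<le> count_list c j" for j
      using snoc.IH True by (metis append_Nil2)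
    have "admissible [] (c @ [x]) \<longleftrightarrow> x = 0 \<or> count_list c x < count_list c (x - 1)"
      using True by (simp add: admissible_append addable_iff_height h)
    also have "\<dots> \<longleftrightarrow> (\<forall>j. count_list (c @ [x]) (Suc j) \<le> count_list (c @ [x]) j)"
    proof
      assume a: "x = 0 \<or> count_list c x < count_list c (x - 1)"
      show "\<forall>j. count_list (c @ [x]) (Suc j) \<le> count_list (c @ [x]) j"
        using a mono by (auto simp: le_SucI)
    next
      assume "\<forall>j. count_list (c @ [x]) (Suc j) \<le> count_list (c @ [x]) j"
      then show "x = 0 \<or> count_list c x < count_list c (x - 1)"
        by (cases x) (auto dest: spec[of _ "x - 1"])
    qed
    finally show ?thesis using split True snoc.IH by blast
  next
    case False
    then have "\<not> admissible [] (c @ [x])" by (simp add: admissible_append)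
    then show ?thesis using split snoc.IH False by blast
  qed
qed

section \<open>Adding a cell at the outer end\<close>

text \<open>The last row of length \<open>k\<close> loses its last cell. While \<open>raise\<close> acts on the first row of a given
  length, this acts on the last one; that makes the two almost commute.\<close>

fun lower :: "nat \<Rightarrow> nat list \<Rightarrow> nat list" where
  "lower k [] = []"
| "lower k (a # \<alpha>) =
    (if a = k \<and> k \<notin> set \<alpha> then (if k = 1 then \<alpha> else (k - 1) # \<alpha>) else a # lower k \<alpha>)"

fun lowers :: "nat \<Rightarrow> nat list \<Rightarrow> nat list" where
  "lowers 0 \<alpha> = \<alpha>"
| "lowers (Suc k) \<alpha> = lowers k (lower (Suc k) \<alpha>)"

text \<open>The effect on the C-shape of undoing a slide that gains a cell in column \<open>j\<close>: the new largest
  entry starts a last row, and this row receives one cell from each of the columns \<open>1\<close>, ..., \<open>j\<close>, at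
  the expense of the last rows of length \<open>j\<close>, ..., \<open>1\<close>.\<close>

definition outer :: "nat \<Rightarrow> nat list \<Rightarrow> nat list"
  where "outer j \<alpha> = lowers j \<alpha> @ [Suc j]"

lemma count_raise:
  "x \<in> set \<alpha> \<Longrightarrow> count_list (raise x \<alpha>) k + (if k = x then 1 else 0) =
    count_list \<alpha> k + (if k = Suc x then 1 else 0)"
  by (induction \<alpha>) auto

lemma count_lower:
  "k \<in> set \<alpha> \<Longrightarrow> 0 < k \<Longrightarrow> i > 0 \<Longrightarrow> count_list (lower k \<alpha>) i + (if i = k then 1 else 0) =
    count_list \<alpha> i + (if Suc i = k then 1 else 0)"
  by (induction \<alpha>) (auto simp: count_list_0_iff)

lemma height_lower:
  "k \<in> set \<alpha> \<Longrightarrow> 0 < k \<Longrightarrow> height (lower k \<alpha>) i + (if Suc i = k then 1 else 0) = height \<alpha> i"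
  by (induction \<alpha>) (auto simp: height_Cons)

lemma lower_raise_cancel:
  "x \<in> set \<alpha> \<Longrightarrow> Suc x \<notin> set \<alpha> \<Longrightarrow> 0 < x \<Longrightarrow> lower (Suc x) (raise x \<alpha>) = \<alpha>"
proof (induction \<alpha>)
  case (Cons a \<alpha>)
  show ?case
  proof (cases "a = x")
    case True then show ?thesis using Cons by auto
  next
    case False then show ?thesis using Cons by auto
  qed
qed simp

text \<open>The operators interfere only through a row that both of them touch. If \<open>k = x\<close> they choose
  different rows as soon as there are two rows of this length. If \<open>k = Suc x\<close> the row produced by
  one may be chosen by the other, and both orders still give the same list.\<close>

lemma lower_raise_commute:
  "x \<in> set \<alpha> \<Longrightarrow> k \<in> set \<alpha> \<Longrightarrow> 0 < k \<Longrightarrow> 0 < x \<Longrightarrow> (k = x \<Longrightarrow> 2 \<le> count_list \<alpha> k) \<Longrightarrow>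
    lower k (raise x \<alpha>) = raise x (lower k \<alpha>)"
proof (induction \<alpha>)
  case (Cons a \<alpha>)
  show ?case
  proof (cases "a = x")
    case True
    show ?thesis
    proof (cases "k = x")
      case True
      then have "k \<in> set \<alpha>" using Cons.prems(5) \<open>a = x\<close> by (auto simp: in_set_iff_count)
      then show ?thesis using True \<open>a = x\<close> by auto
    next
      case False
      then show ?thesis using True Cons.prems by auto
    qed
  next
    case False
    then have x: "x \<in> set \<alpha>" using Cons.prems by auto
    have k2: "k \<in> set (raise x \<alpha>) \<longleftrightarrow> (if k = x then 2 \<le> count_list \<alpha> k else k \<in> set \<alpha> \<or> k = Suc x)"
      using count_raise[OF x, of k] by (auto simp: in_set_iff_count split: if_splits)
    show ?thesis
    proof (cases "a = k")
      case True
      have "k \<noteq> x" using True False by simp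
      show ?thesis
      proof (cases "k \<in> set \<alpha>")
        case kin: True
        then have "lower k (raise x \<alpha>) = raise x (lower k \<alpha>)"
          using Cons.IH[OF x kin] Cons.prems \<open>k \<noteq> x\<close> by simp
        then show ?thesis using kin k2 \<open>a = k\<close> \<open>k \<noteq> x\<close> False by simp
      next
        case kout: False
        show ?thesis
        proof (cases "k = Suc x")
          case True
          then show ?thesis
            using kout k2 \<open>a = k\<close> \<open>k \<noteq> x\<close> False lower_raise_cancel[OF x] Cons.prems by simp
        next
          case False
          then show ?thesis
            using kout k2 \<open>a = k\<close> \<open>k \<noteq> x\<close> \<open>a \<noteq> x\<close> Cons.prems by auto
        qed
      qed
    next
      case ak: False
      then have kin: "k \<in> set \<alpha>" using Cons.prems by auto
      have "lower k (raise x \<alpha>) = raise x (lower k \<alpha>)"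
        using Cons.IH[OF x kin] Cons.prems False by auto
      then show ?thesis using ak False by simp
    qed
  qed
qed simp

lemma lower_up_commute:
  assumes "addable x \<alpha>" "k \<in> set \<alpha>" "0 < k" "k = x \<Longrightarrow> 2 \<le> count_list \<alpha> k"
  shows "lower k (up x \<alpha>) = up x (lower k \<alpha>)"
  using assms lower_raise_commute[of x \<alpha> k] by (auto simp: up_def addable_def)

lemma addable_count: "addable x \<alpha> \<longleftrightarrow> x = 0 \<or> 0 < count_list \<alpha> x"
  by (auto simp: addable_def in_set_iff_count)

text \<open>The condition of the previous commutation is inherited: once the last row of length
  \<open>Suc h\<close> is lowered, there is one more row of length \<open>h\<close>.\<close>

lemma lowers_up_commute:
  "addable h \<alpha> \<Longrightarrow> addable x \<alpha> \<Longrightarrow> (x = h \<Longrightarrow> 0 < h \<Longrightarrow> 2 \<le> count_list \<alpha> h) \<Longrightarrow>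
    lowers h (up x \<alpha>) = up x (lowers h \<alpha>) \<and> addable x (lowers h \<alpha>)"
proof (induction h arbitrary: \<alpha>)
  case (Suc h)
  have mem: "Suc h \<in> set \<alpha>" using Suc.prems(1) by (simp add: addable_def)
  have comm: "lower (Suc h) (up x \<alpha>) = up x (lower (Suc h) \<alpha>)"
    using lower_up_commute[OF Suc.prems(2) mem] Suc.prems(3) by auto
  note cnt = count_lower[OF mem]
  have 1: "addable h (lower (Suc h) \<alpha>)"
    using cnt[of h] by (cases "h = 0") (auto simp: addable_count)
  have 2: "addable x (lower (Suc h) \<alpha>)"
    using cnt[of x] Suc.prems(2,3) by (cases "x = 0"; cases "x = h") (auto simp: addable_count split: if_splits)
  have 3: "2 \<le> count_list (lower (Suc h) \<alpha>) h" if "x = h" "0 < h"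
    using cnt[of h] Suc.prems(2) that by (auto simp: addable_count)
  show ?case using Suc.IH[OF 1 2 3] comm by simp
qed simp

lemma mem_lowers: "j < i \<Longrightarrow> addable j \<alpha> \<Longrightarrow> i \<in> set (lowers j \<alpha>) \<longleftrightarrow> i \<in> set \<alpha>"
proof (induction j arbitrary: \<alpha>)
  case (Suc j)
  have mem: "Suc j \<in> set \<alpha>" using Suc.prems by (simp add: addable_def)
  note cnt = count_lower[OF mem]
  have 1: "addable j (lower (Suc j) \<alpha>)"
    using cnt[of j] by (cases "j = 0") (auto simp: addable_count)
  show ?case using Suc.IH[OF _ 1] Suc.prems(1) cnt[of i] by (simp add: in_set_iff_count)
qed simp

lemma height_lowers: "addable j \<alpha> \<Longrightarrow> height (lowers j \<alpha>) i + (if i < j then 1 else 0) = height \<alpha> i"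
proof (induction j arbitrary: \<alpha>)
  case (Suc j)
  have mem: "Suc j \<in> set \<alpha>" using Suc.prems by (simp add: addable_def)
  have 1: "addable j (lower (Suc j) \<alpha>)"
    using count_lower[OF mem, of j] by (cases "j = 0") (auto simp: addable_count)
  show ?case using Suc.IH[OF 1] height_lower[OF mem, of i] by (cases "i = j") (auto split: if_splits)
qed simp

lemma height_outer: "addable j \<alpha> \<Longrightarrow> height (outer j \<alpha>) i = height \<alpha> i + (if i = j then 1 else 0)"
  using height_lowers[of j \<alpha> i] by (cases "i = j") (auto simp: outer_def height_append height_Cons split: if_splits)

lemma addable_outer:
  assumes "addable h \<alpha>"
  shows "addable x (outer h \<alpha>) \<longleftrightarrow>
    x = 0 \<or> height \<alpha> x + (if x = h then 1 else 0) < height \<alpha> (x - 1) + (if x = Suc h then 1 else 0)"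
  using height_outer[OF assms] by (cases x) (auto simp: addable_iff_height)

text \<open>The first local rule of the slide: if column \<open>x\<close> can gain a cell both before and after
  \<open>outer h\<close>, the two additions commute.\<close>

lemma outer_up_same:
  assumes "addable h \<alpha>" "addable x \<alpha>" "addable x (outer h \<alpha>)"
  shows "up x (outer h \<alpha>) = outer h (up x \<alpha>)" "addable h (up x \<alpha>)"
proof -
  have c: "2 \<le> count_list \<alpha> h" if "x = h" "0 < h"
    using assms(3) that height_count[of \<alpha> "h - 1"]
    unfolding addable_outer[OF assms(1)] by auto
  from lowers_up_commute[OF assms(1,2) c] show "up x (outer h \<alpha>) = outer h (up x \<alpha>)"
    by (simp add: outer_def up_append)
  show "addable h (up x \<alpha>)"
    using assms height_up[OF assms(2)] unfolding addable_outer[OF assms(1)]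
    by (auto simp: addable_iff_height)
qed

text \<open>The second local rule. If column \<open>x\<close> can gain a cell only after \<open>outer h\<close>, then the new cell
  lies directly to the right of the one that \<open>outer h\<close> produced, at the end of the last row, and the
  two cells are a horizontal domino.\<close>

lemma outer_up_new:
  assumes "addable h \<alpha>" "\<not> addable x \<alpha>" "addable x (outer h \<alpha>)"
  shows "x = Suc h" "up x (outer h \<alpha>) = outer x (up h \<alpha>)" "addable x (up h \<alpha>)"
proof -
  have ha: "height \<alpha> x \<ge> height \<alpha> (x - 1)" "x \<noteq> 0" using assms(2) by (auto simp: addable_iff_height)
  show x: "x = Suc h"
    using assms(3) ha unfolding addable_outer[OF assms(1)] by (auto split: if_splits)
  have nx: "Suc h \<notin> set \<alpha>" using assms(2) x by (simp add: addable_def)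
  have "lower (Suc h) (up h \<alpha>) = \<alpha>"
    using assms(1) lower_raise_cancel[of h \<alpha>] nx by (auto simp: up_def addable_def)
  moreover have "Suc h \<notin> set (lowers h \<alpha>)"
    using mem_lowers[OF _ assms(1)] nx by simp
  ultimately show "up x (outer h \<alpha>) = outer x (up h \<alpha>)"
    by (simp add: x outer_def up_def raise_append)
  show "addable x (up h \<alpha>)"
    using height_up[OF assms(1)] ha height_antimono[of h "Suc h" \<alpha>] x by (auto simp: addable_iff_height)
qed

section \<open>Jeu de taquin slides on words\<close>

text \<open>The jeu de taquin slide read along a word. Here \<open>\<alpha>\<close> is the C-shape of what has been slid so far
  and \<open>h\<close> is the column of the hole. A letter that is not addable to \<open>\<alpha>\<close> belongs to the right
  neighbour of the hole in its row; this entry moves left into column \<open>h\<close>, and the hole takes its place.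
  The result consists of the slid word and the final column of the hole.\<close>

fun slide :: "nat list \<Rightarrow> nat \<Rightarrow> nat list \<Rightarrow> nat list \<times> nat" where
  "slide \<alpha> h [] = ([], h)"
| "slide \<alpha> h (x # s) =
    (if addable x \<alpha> then apfst (Cons x) (slide (up x \<alpha>) h s)
     else apfst (Cons h) (slide (up h \<alpha>) x s))"

lemma slide_correct:
  assumes "addable h \<alpha>" "admissible (outer h \<alpha>) s" "slide \<alpha> h s = (c, j)"
  shows "admissible \<alpha> c \<and> addable j (walk \<alpha> c) \<and> length c = length s \<and>
    walk (outer h \<alpha>) s = outer j (walk \<alpha> c)"
  using assms
proof (induction s arbitrary: \<alpha> h c j)
  case (Cons x s)
  show ?case
  proof (cases "addable x \<alpha>")
    case True
    obtain c' where c: "c = x # c'" "slide (up x \<alpha>) h s = (c', j)"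
      using Cons.prems(3) True by (cases "slide (up x \<alpha>) h s") auto
    note * = outer_up_same[OF Cons.prems(1) True]
    show ?thesis using Cons.IH[OF *(2) _ c(2)] *(1) Cons.prems(2) True c(1) by auto
  next
    case False
    obtain c' where c: "c = h # c'" "slide (up h \<alpha>) x s = (c', j)"
      using Cons.prems(3) False by (cases "slide (up h \<alpha>) x s") auto
    note * = outer_up_new[OF Cons.prems(1) False]
    show ?thesis using Cons.IH[OF *(3) _ c(2)] *(2) Cons.prems(1,2) False c(1) by auto
  qed
qed auto

lemma slide_snoc:
  "slide \<alpha> h (s @ [x]) = (case slide \<alpha> h s of (c, j) \<Rightarrow>
    if addable x (walk \<alpha> c) then (c @ [x], j) else (c @ [j], x))"
  by (induction s arbitrary: \<alpha> h) (auto split: prod.splits)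

text \<open>The last step of a slide can be undone: the final hole column and the last letter decide which of
  the two local rules was applied.\<close>

lemma slide_inj:
  "admissible (outer h \<alpha>) s \<Longrightarrow> admissible (outer h \<alpha>) s' \<Longrightarrow> addable h \<alpha> \<Longrightarrow>
    slide \<alpha> h s = slide \<alpha> h s' \<Longrightarrow> s = s'"
proof (induction s arbitrary: s' rule: rev_induct)
  case Nil
  then show ?case by (cases s' rule: rev_cases) (auto simp: slide_snoc split: prod.splits if_splits)
next
  case (snoc x s)
  then obtain x' t where s': "s' = t @ [x']"
    by (cases s' rule: rev_cases) (auto simp: slide_snoc split: prod.splits if_splits)
  obtain c j c' j' where e: "slide \<alpha> h s = (c, j)" "slide \<alpha> h t = (c', j')"
    by (meson surj_pair)
  have adm: "admissible (outer h \<alpha>) s" "admissible (outer h \<alpha>) t"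
    "addable x (walk (outer h \<alpha>) s)" "addable x' (walk (outer h \<alpha>) t)"
    using snoc.prems s' by (auto simp: admissible_append)
  note 1 = slide_correct[OF snoc.prems(3) adm(1) e(1)]
  note 2 = slide_correct[OF snoc.prems(3) adm(2) e(2)]
  have eq: "(if addable x (walk \<alpha> c) then (c @ [x], j) else (c @ [j], x)) =
      (if addable x' (walk \<alpha> c') then (c' @ [x'], j') else (c' @ [j'], x'))"
    using snoc.prems(4) e by (simp add: s' slide_snoc)
  then have "c = c' \<and> j = j' \<and> x = x'"
    using 1 2 by (auto split: if_splits)
  then have "s = t" using snoc.IH[OF adm(1,2) snoc.prems(3)] e by simp
  then show ?case using \<open>c = c' \<and> j = j' \<and> x = x'\<close> s' by simp
qed

lemma slide_surj:
  "admissible [] c \<Longrightarrow> addable j (walk [] c) \<Longrightarrow>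
    \<exists>s. admissible (outer 0 []) s \<and> slide [] 0 s = (c, j)"
proof (induction c arbitrary: j rule: rev_induct)
  case Nil
  then show ?case by (intro exI[of _ "[]"]) (auto simp: addable_def)
next
  case (snoc y c)
  let ?\<gamma> = "walk [] c"
  have zero: "addable 0 []" by (simp add: addable_def)
  have adm: "admissible [] c" and y: "addable y ?\<gamma>" and j: "addable j (up y ?\<gamma>)"
    using snoc.prems by (auto simp: admissible_append)
  note hj = j[unfolded addable_iff_height height_up[OF y]]
  show ?case
  proof (cases "addable j ?\<gamma>")
    case True
    obtain s where s: "admissible (outer 0 []) s" "slide [] 0 s = (c, j)"
      using snoc.IH[OF adm True] by blast
    have "addable y (outer j ?\<gamma>)"
      unfolding addable_outer[OF True] using hj y
      by (cases "y = 0"; cases "y = j") (auto simp: addable_iff_height split: if_splits)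
    then have "admissible (outer 0 []) (s @ [y])"
      using s slide_correct[OF zero s] by (simp add: admissible_append)
    moreover have "slide [] 0 (s @ [y]) = (c @ [y], j)"
      using s y by (simp add: slide_snoc)
    ultimately show ?thesis by blast
  next
    case False
    obtain s where s: "admissible (outer 0 []) s" "slide [] 0 s = (c, y)"
      using snoc.IH[OF adm y] by blast
    have "addable j (outer y ?\<gamma>)"
      unfolding addable_outer[OF y] using hj False by (auto simp: addable_iff_height split: if_splits)
    then have "admissible (outer 0 []) (s @ [j])"
      using s slide_correct[OF zero s] by (simp add: admissible_append)
    moreover have "slide [] 0 (s @ [j]) = (c @ [y], j)"
      using s False by (simp add: slide_snoc)
    ultimately show ?thesis by blast
  qed
qed

text \<open>In two consecutive slides the second hole stays strictly to the right of the first one, or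
  weakly to the left of it, from beginning to end. They could change sides only if they are in the
  same column or in adjacent ones and just one of them moves; but then some column would be longer
  than its left neighbour.\<close>

lemma slide_twice:
  assumes "addable h \<alpha>" "admissible (outer h \<alpha>) s" "slide \<alpha> h s = (c, j)"
    "addable h' (outer h \<alpha>)" "admissible (outer h' (outer h \<alpha>)) r" "slide (outer h \<alpha>) h' r = (s, j')"
  shows "h < h' \<longleftrightarrow> j < j'"
  using assms
proof (induction r arbitrary: \<alpha> h h' s c)
  case Nil
  then show ?case by auto
next
  case (Cons y r)
  let ?u = "outer h \<alpha>"
  note h' = Cons.prems(4)[unfolded addable_outer[OF Cons.prems(1)]]
  show ?case
  proof (cases "addable y ?u")
    case yu: True
    obtain s' where s: "s = y # s'" "slide (up y ?u) h' r = (s', j')"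
      using Cons.prems(6) yu by (cases "slide (up y ?u) h' r") auto
    have yt: "addable y (outer h' ?u)" using Cons.prems(5) by simp
    note st = outer_up_same[OF Cons.prems(4) yu yt]
    show ?thesis
    proof (cases "addable y \<alpha>")
      case True
      obtain c' where c: "c = y # c'" "slide (up y \<alpha>) h s' = (c', j)"
        using Cons.prems(3) True s by (cases "slide (up y \<alpha>) h s'") auto
      note su = outer_up_same[OF Cons.prems(1) True yu]
      show ?thesis
        by (rule Cons.IH[of h "up y \<alpha>" s' c' h'])
          (use c s su st Cons.prems in auto)
    next
      case False
      obtain c' where c: "c = h # c'" "slide (up h \<alpha>) y s' = (c', j)"
        using Cons.prems(3) False s by (cases "slide (up h \<alpha>) y s'") auto
      note su = outer_up_new[OF Cons.prems(1) False yu]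
      have "y < h' \<longleftrightarrow> j < j'"
        by (rule Cons.IH[of y "up h \<alpha>" s' c' h'])
          (use c s su st Cons.prems in auto)
      moreover have "h' \<noteq> Suc h"
      proof
        assume e: "h' = Suc h"
        have "height \<alpha> (Suc h) \<ge> height \<alpha> h" using False su(1) by (auto simp: addable_iff_height)
        then show False using yt unfolding addable_outer[OF Cons.prems(4)] 
          using su(1) e height_outer[OF Cons.prems(1)] by auto
      qed
      ultimately show ?thesis using su(1) by auto
    qed
  next
    case yu: False
    obtain s' where s: "s = h' # s'" "slide (up h' ?u) y r = (s', j')"
      using Cons.prems(6) yu by (cases "slide (up h' ?u) y r") auto
    have yt: "addable y (outer h' ?u)" using Cons.prems(5) by simp
    note st = outer_up_new[OF Cons.prems(4) yu yt]
    have h'u: "addable h' ?u" by fact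
    show ?thesis
    proof (cases "addable h' \<alpha>")
      case True
      obtain c' where c: "c = h' # c'" "slide (up h' \<alpha>) h s' = (c', j)"
        using Cons.prems(3) True s by (cases "slide (up h' \<alpha>) h s'") auto
      note su = outer_up_same[OF Cons.prems(1) True h'u]
      have "h < y \<longleftrightarrow> j < j'"
        by (rule Cons.IH[of h "up h' \<alpha>" s' c' y])
          (use c s su st Cons.prems in auto)
      moreover have "h \<noteq> h'"
        using yu st(1) height_outer[OF Cons.prems(1)] height_antimono[of h "Suc h" \<alpha>]
        by (auto simp: addable_iff_height)
      ultimately show ?thesis using st(1) by auto
    next
      case False
      obtain c' where c: "c = h # c'" "slide (up h \<alpha>) h' s' = (c', j)"
        using Cons.prems(3) False s by (cases "slide (up h \<alpha>) h' s'") auto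
      note su = outer_up_new[OF Cons.prems(1) False h'u]
      have "h' < y \<longleftrightarrow> j < j'"
        by (rule Cons.IH[of h' "up h \<alpha>" s' c' y])
          (use c s su st Cons.prems in auto)
      then show ?thesis using st(1) su(1) by auto
    qed
  qed
qed

section \<open>Knuth equivalence\<close>

text \<open>The Knuth relations exchange \<open>x < z\<close> next to an intermediate value \<open>y\<close>. They are invariant
  under reversal of the order of the letters, so the usual relations also fit reverse insertion.\<close>

inductive knuth1 :: "nat list \<Rightarrow> nat list \<Rightarrow> bool" where
  before: "x < y \<Longrightarrow> y < z \<Longrightarrow> knuth1 (u @ [y, x, z] @ v) (u @ [y, z, x] @ v)"
| after: "x < y \<Longrightarrow> y < z \<Longrightarrow> knuth1 (u @ [x, z, y] @ v) (u @ [z, x, y] @ v)"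

abbreviation knuth :: "nat list \<Rightarrow> nat list \<Rightarrow> bool"  (infix "\<approx>" 50)
  where "knuth \<equiv> equivclp knuth1"

lemma knuth1_context: "knuth1 w w' \<Longrightarrow> knuth1 (a @ w @ b) (a @ w' @ b)"
proof (induction rule: knuth1.induct)
  case (before x y z u v)
  then show ?case using knuth1.before[of x y z "a @ u" "v @ b"] by simp
next
  case (after x y z u v)
  then show ?case using knuth1.after[of x y z "a @ u" "v @ b"] by simp
qed

lemma knuth_step: "knuth1 w w' \<Longrightarrow> w \<approx> w'"
  by (rule r_into_equivclp)

lemma knuth_sym: "w \<approx> w' \<Longrightarrow> w' \<approx> w"
  by (rule equivclp_sym)

lemma knuth_trans [trans]: "u \<approx> v \<Longrightarrow> v \<approx> w \<Longrightarrow> u \<approx> w"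
  by (rule equivclp_trans)

lemma knuth_context: "w \<approx> w' \<Longrightarrow> a @ w @ b \<approx> a @ w' @ b"
proof (induction rule: equivclp_induct)
  case (step y z)
  then have "a @ y @ b \<approx> a @ z @ b"
    using knuth1_context knuth_step knuth_sym by blast
  with step.IH show ?case by (rule knuth_trans)
qed simp

lemma knuth1_mset: "knuth1 w w' \<Longrightarrow> mset w = mset w'"
  by (induction rule: knuth1.induct) auto

lemma knuth_mset: "w \<approx> w' \<Longrightarrow> mset w = mset w'"
  by (induction rule: equivclp_induct) (auto dest: knuth1_mset)

text \<open>If the exchanged letters survive the restriction to an interval, so does their witness, which
  lies between them.\<close>

lemma knuth_filter:
  assumes "w \<approx> w'"
  shows "filter (\<lambda>x. lo \<le> x \<and> x \<le> hi) w \<approx> filter (\<lambda>x. lo \<le> x \<and> x \<le> hi) w'"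
proof -
  let ?f = "filter (\<lambda>x. lo \<le> x \<and> x \<le> hi)"
  have 1: "?f w \<approx> ?f w'" if "knuth1 w w'" for w w'
    using that
  proof (induction rule: knuth1.induct)
    case (before x y z u v)
    then show ?case
      using knuth_step[OF knuth1.before[of x y z "?f u" "?f v"]] by auto
  next
    case (after x y z u v)
    then show ?case
      using knuth_step[OF knuth1.after[of x y z "?f u" "?f v"]] by auto
  qed
  show ?thesis
    using assms
  proof (induction rule: equivclp_induct)
    case (step y z)
    then show ?case using 1 knuth_sym knuth_trans by blast
  qed simp
qed

lemma knuth_short: "w \<approx> w' \<Longrightarrow> length w \<le> 2 \<Longrightarrow> w = w'"
proof (induction rule: equivclp_induct)
  case (step y z)
  then have "w = y" by simp
  have "length y \<ge> 3 \<and> length z \<ge> 3" using step.hyps(2) by (auto elim!: knuth1.cases)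
  then show ?case using step.prems \<open>w = y\<close> by simp
qed simp

section \<open>Row insertion\<close>

text \<open>Insertion of a whole word into a single row: the final row and the word of bumped letters. This
  word is then inserted into the next row, so that insertion can be studied row by row
  (\<open>P_rows_Cons\<close>).\<close>

fun insert_word :: "nat list \<Rightarrow> nat list \<Rightarrow> nat list \<times> nat list" where
  "insert_word r [] = (r, [])"
| "insert_word r (x # w) = (case row_insert x r of
      (r', None) \<Rightarrow> insert_word r' w
    | (r', Some y) \<Rightarrow> apsnd (Cons y) (insert_word r' w))"

lemma insert_word_append:
  "insert_word r (u @ v) = (case insert_word r u of (r', b) \<Rightarrow> apsnd ((@) b) (insert_word r' v))"
  by (induction u arbitrary: r)
    (auto simp: apsnd_def map_prod_def split_def split: option.splits)

lemma insert_word_Cons_gt: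
  assumes "\<forall>x\<in>set w. x \<le> f"
  shows "insert_word (f # r) w = apfst (Cons f) (insert_word r w)"
  using assms
  by (induction w arbitrary: r) (auto split: prod.splits option.splits)

lemma row_insert_bump:
  assumes "row_insert x r = (r', b)"
  shows "mset r' + mset (case b of None \<Rightarrow> [] | Some y \<Rightarrow> [y]) = add_mset x (mset r)"
  using assms
  by (induction r arbitrary: r' b) (auto split: if_splits prod.splits option.splits)

lemma row_insert_bump_less:
  "row_insert x r = (r', Some y) \<Longrightarrow> y < x \<and> y \<in> set r"
  by (induction r arbitrary: r' y) (auto split: if_splits prod.splits)

lemma row_insert_sorted:
  "sorted_wrt (>) r \<Longrightarrow> x \<notin> set r \<Longrightarrow> row_insert x r = (r', b) \<Longrightarrow> sorted_wrt (>) r'"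
proof (induction r arbitrary: r' b)
  case (Cons f r)
  show ?case
  proof (cases "f < x")
    case True then show ?thesis using Cons.prems by (auto, meson less_trans)
  next
    case False
    obtain s where s: "row_insert x r = (s, b)" "r' = f # s"
      using Cons.prems(3) False by (auto split: prod.splits)
    have "set s \<subseteq> insert x (set r)"
      using arg_cong[OF row_insert_bump[OF s(1)], of set_mset] by auto
    moreover have "x < f" using False Cons.prems(2) by auto
    ultimately show ?thesis using Cons s by auto
  qed
qed auto

lemma insert_word_mset:
  "insert_word r w = (r', b) \<Longrightarrow> mset r' + mset b = mset r + mset w"
proof (induction w arbitrary: r b)
  case (Cons x w)
  obtain s c where s: "row_insert x r = (s, c)" by fastforce
  show ?case
  proof (cases c)
    case None
    then show ?thesis using Cons.IH[of s b] Cons.prems s row_insert_bump[OF s] by auto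
  next
    case (Some y)
    then obtain b' where "insert_word s w = (r', b')" "b = y # b'"
      using Cons.prems s by (cases "insert_word s w") auto
    then show ?thesis using Cons.IH[of s b'] s row_insert_bump[OF s] Some by auto
  qed
qed auto

lemma insert_word_sorted:
  "sorted_wrt (>) r \<Longrightarrow> distinct (r @ w) \<Longrightarrow> insert_word r w = (r', b) \<Longrightarrow> sorted_wrt (>) r'"
proof (induction w arbitrary: r b)
  case (Cons x w)
  obtain s c where s: "row_insert x r = (s, c)" by fastforce
  obtain b' where b': "insert_word s w = (r', b')"
    using Cons.prems(3) s by (cases "insert_word s w"; cases c) auto
  have m: "mset s + mset (case c of None \<Rightarrow> [] | Some y \<Rightarrow> [y]) = mset (x # r)"
    using row_insert_bump[OF s] by simp
  have "mset (s @ (case c of None \<Rightarrow> [] | Some y \<Rightarrow> [y]) @ w) = mset (x # r @ w)"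
    using m by simp
  moreover have "distinct (x # r @ w)" using Cons.prems by auto
  ultimately have "distinct (s @ (case c of None \<Rightarrow> [] | Some y \<Rightarrow> [y]) @ w)"
    by (metis mset_eq_imp_distinct_iff)
  then have "distinct (s @ w)" by auto
  then show ?case
    using Cons.IH[OF row_insert_sorted[OF Cons.prems(1) _ s] _ b'] Cons.prems by auto
qed auto

text \<open>The row bumping lemma, in both directions, for two letters inserted one after the other.\<close>

lemma row_insert_then_greater:
  "sorted_wrt (>) r \<Longrightarrow> x < y \<Longrightarrow> row_insert x r = (s, b) \<Longrightarrow>
    \<exists>t z. row_insert y s = (t, Some z) \<and> x \<le> z \<and> z < y \<and> z \<in> insert x (set r)"
proof (induction r arbitrary: s b)
  case (Cons f r)
  show ?case
  proof (cases "f < x")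
    case True then show ?thesis using Cons.prems by auto
  next
    case False
    then obtain s' where s': "row_insert x r = (s', b)" "s = f # s'"
      using Cons.prems by (auto split: prod.splits)
    then obtain t z where t: "row_insert y s' = (t, Some z)" "x \<le> z" "z < y" "z \<in> insert x (set r)"
      using Cons by fastforce
    show ?thesis
      using t s' False by (cases "f < y") auto
  qed
qed auto

lemma row_insert_then_less:
  "sorted_wrt (>) r \<Longrightarrow> x < y \<Longrightarrow> row_insert y r = (s, b) \<Longrightarrow> row_insert x s = (t, Some x') \<Longrightarrow>
    \<exists>y'. b = Some y' \<and> x' < y'"
proof (induction r arbitrary: s t b)
  case (Cons f r)
  show ?case
  proof (cases "f < y")
    case True
    then obtain t' where "row_insert x r = (t', Some x')" "b = Some f"
      using Cons.prems by (auto split: prod.splits)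
    then show ?thesis using row_insert_bump_less[of x r t' x'] Cons.prems(1) by auto
  next
    case False
    then obtain s' where s': "row_insert y r = (s', b)" "s = f # s'"
      using Cons.prems by (auto split: prod.splits)
    then obtain t' where "row_insert x s' = (t', Some x')"
      using Cons.prems False by (auto split: prod.splits)
    then show ?thesis using Cons s' by auto
  qed
qed auto

definition knuth01 :: "nat list \<Rightarrow> nat list \<Rightarrow> bool"
  where "knuth01 b b' \<longleftrightarrow> b = b' \<or> knuth1 b b' \<or> knuth1 b' b"

lemma knuth01_context: "knuth01 w w' \<Longrightarrow> knuth01 (a @ w @ b) (a @ w' @ b)"
  using knuth1_context by (auto simp: knuth01_def)

lemmas knuth1_before = knuth1.before[of _ _ _ "[]" "[]", simplified]
lemmas knuth1_after = knuth1.after[of _ _ _ "[]" "[]", simplified]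

text \<open>A Knuth move passes through a row: the row does not notice it, and the bumped words are equal or
  differ by a Knuth move again. The induction runs along the row, and only the head \<open>f\<close> matters: if it
  exceeds the three letters it is skipped, otherwise it is bumped and becomes part of the bumped
  word.\<close>

lemma insert_before:
  assumes "sorted_wrt (>) r" "x < y" "y < z" "distinct ([x, y, z] @ r)"
  shows "\<exists>r' b b'. insert_word r [y, x, z] = (r', b) \<and> insert_word r [y, z, x] = (r', b') \<and> knuth01 b b'"
  using assms
proof (induction r)
  case Nil
  then show ?case by (auto simp: knuth01_def)
next
  case (Cons f r)
  consider "f < y" | "y < f" "f < z" | "z < f"
    using Cons.prems(4) by fastforce
  then show ?case
  proof cases
    case 1
    obtain s b where s: "row_insert x r = (s, b)" by fastforce
    have "x' < f" if "b = Some x'" for x'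
      using row_insert_bump_less[of x r s x'] s that Cons.prems(1) by auto
    then show ?thesis
      using 1 Cons.prems s knuth1_before[of _ f y]
      by (cases b) (auto simp: knuth01_def)
  next
    case 2
    obtain s b where s: "row_insert y r = (s, b)" by fastforce
    obtain t c where t: "row_insert x s = (t, c)" by fastforce
    show ?thesis
    proof (cases c)
      case None
      then show ?thesis using 2 Cons.prems s t by (cases b) (auto simp: knuth01_def)
    next
      case (Some x')
      then obtain y' where y': "b = Some y'" "x' < y'"
        using row_insert_then_less[of r x y s b t x'] s t Cons.prems by auto
      then have "y' < f" using row_insert_bump_less[of y r s y'] s 2 Cons.prems by auto
      then show ?thesis
        using 2 Cons.prems s t Some y' knuth1_before[of x' y' f] by (auto simp: knuth01_def)
    qed
  next
    case 3
    obtain r' b b' where r: "insert_word r [y, x, z] = (r', b)" "insert_word r [y, z, x] = (r', b')"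
      "knuth01 b b'" using Cons by auto
    have "insert_word (f # r) w = apfst (Cons f) (insert_word r w)"
      if "set w = {x, y, z}" for w
      by (rule insert_word_Cons_gt) (use 3 Cons.prems that in auto)
    note * = this
    have "insert_word (f # r) [y, x, z] = (f # r', b)" "insert_word (f # r) [y, z, x] = (f # r', b')"
      using r *[of "[y, x, z]"] *[of "[y, z, x]"] by (auto simp del: insert_word.simps)
    then show ?thesis using r by blast
  qed
qed

lemma insert_after:
  assumes "sorted_wrt (>) r" "x < y" "y < z" "distinct ([x, y, z] @ r)"
  shows "\<exists>r' b b'. insert_word r [x, z, y] = (r', b) \<and> insert_word r [z, x, y] = (r', b') \<and> knuth01 b b'"
  using assms
proof (induction r)
  case Nil
  then show ?case by (auto simp: knuth01_def)
next
  case (Cons f r)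
  consider "f < x" | "x < f" "f < z" | "z < f"
    using Cons.prems(4) by fastforce
  then show ?case
  proof cases
    case 1
    show ?thesis
    proof (cases r)
      case Nil
      then show ?thesis using 1 Cons.prems by (auto simp: knuth01_def)
    next
      case (Cons g r')
      then show ?thesis
        using 1 Cons.prems knuth1_before[of g f x] by (auto simp: knuth01_def)
    qed
  next
    case 2
    obtain s b where s: "row_insert x r = (s, b)" by fastforce
    have "\<exists>t z. row_insert y s = (t, Some z) \<and> x \<le> z \<and> z < y \<and> z \<in> insert x (set r)"
      by (rule row_insert_then_greater[OF _ _ s]) (use Cons.prems in auto)
    then obtain t y' where t: "row_insert y s = (t, Some y')" "x \<le> y'" "y' < y" "y' \<in> insert x (set r)"
      by blast
    have "y' < f" using t 2 Cons.prems(1) by auto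
    moreover have "x' < y'" if "b = Some x'" for x'
      using row_insert_bump_less[of x r s x'] s that t by auto
    ultimately show ?thesis
      using 2 Cons.prems s t knuth1_after[of _ y' f] by (cases b) (auto simp: knuth01_def)
  next
    case 3
    obtain r' b b' where r: "insert_word r [x, z, y] = (r', b)" "insert_word r [z, x, y] = (r', b')"
      "knuth01 b b'" using Cons by auto
    have "insert_word (f # r) w = apfst (Cons f) (insert_word r w)"
      if "set w = {x, y, z}" for w
      by (rule insert_word_Cons_gt) (use 3 Cons.prems that in auto)
    note * = this
    have "insert_word (f # r) [x, z, y] = (f # r', b)" "insert_word (f # r) [z, x, y] = (f # r', b')"
      using r *[of "[x, z, y]"] *[of "[z, x, y]"] by (auto simp del: insert_word.simps)
    then show ?thesis using r by blast
  qed
qed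

lemma insert_word_distinct:
  assumes "insert_word r w = (r', b)" "distinct (r @ w)"
  shows "distinct (r' @ b)"
proof -
  have "mset (r' @ b) = mset (r @ w)" using insert_word_mset[OF assms(1)] by simp
  then show ?thesis using assms(2) by (metis mset_eq_imp_distinct_iff)
qed

lemma insert_word_knuth1:
  assumes "knuth1 w w'" "distinct w" 
  shows "\<exists>r b b'. insert_word [] w = (r, b) \<and> insert_word [] w' = (r, b') \<and> knuth01 b b'"
proof -
  have *: "\<exists>r b b'. insert_word [] (u @ p @ v) = (r, b) \<and> insert_word [] (u @ p' @ v) = (r, b') \<and> knuth01 b b'"
    if d: "distinct (u @ p @ v)" and
      H: "\<And>r. sorted_wrt (>) r \<Longrightarrow> distinct (r @ p) \<Longrightarrow>
        \<exists>r' b b'. insert_word r p = (r', b) \<and> insert_word r p' = (r', b') \<and> knuth01 b b'" for u p p' v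
  proof -
    obtain r b where r: "insert_word [] u = (r, b)" by fastforce
    have s: "sorted_wrt (>) r" using insert_word_sorted[OF _ _ r] d by simp
    have "set r \<subseteq> set u" using arg_cong[OF insert_word_mset[OF r], of set_mset] by auto
    moreover have "distinct r" using insert_word_distinct[OF r] d by simp
    ultimately have "distinct (r @ p)" using d by auto
    then obtain r' c c' where r': "insert_word r p = (r', c)" "insert_word r p' = (r', c')" "knuth01 c c'"
      using H[OF s] by blast
    obtain t e where "insert_word r' v = (t, e)" by fastforce
    then show ?thesis
      using r r' knuth01_context[OF r'(3), of b e] by (auto simp: insert_word_append)
  qed
  show ?thesis
    using assms(1)
  proof cases
    case (before x y z u v)
    show ?thesis
      unfolding before
    proof (rule *)
      show "distinct (u @ [y, x, z] @ v)" using assms(2) before by simp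
      then show "\<exists>r' b b'. insert_word r [y, x, z] = (r', b) \<and> insert_word r [y, z, x] = (r', b') \<and>
          knuth01 b b'" if "sorted_wrt (>) r" "distinct (r @ [y, x, z])" for r
        using that before by (intro insert_before) auto
    qed
  next
    case (after x y z u v)
    show ?thesis
      unfolding after
    proof (rule *)
      show "distinct (u @ [x, z, y] @ v)" using assms(2) after by simp
      then show "\<exists>r' b b'. insert_word r [x, z, y] = (r', b) \<and> insert_word r [z, x, y] = (r', b') \<and>
          knuth01 b b'" if "sorted_wrt (>) r" "distinct (r @ [x, z, y])" for r
        using that after by (intro insert_after) auto
    qed
  qed
qed

abbreviation P_rows :: "nat list \<Rightarrow> nat list list"
  where "P_rows w \<equiv> fold rs_insert w []"

lemma fold_rs_insert_Cons:
  "fold rs_insert w (r # rs) = fst (insert_word r w) # fold rs_insert (snd (insert_word r w)) rs"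
  by (induction w arbitrary: r rs) (auto split: prod.splits option.splits)

lemma P_rows_Cons:
  "w \<noteq> [] \<Longrightarrow> P_rows w = fst (insert_word [] w) # P_rows (snd (insert_word [] w))"
  by (cases w) (auto simp: fold_rs_insert_Cons)

lemma length_insert_word: "length (snd (insert_word r w)) \<le> length w"
  by (induction w arbitrary: r) (auto split: prod.splits option.splits intro: le_SucI)

lemma insert_word_length:
  assumes "w \<noteq> []"
  shows "length (snd (insert_word [] w)) < length w"
  using assms length_insert_word[of "[hd w]" "tl w"] by (cases w) auto

text \<open>A Knuth move does not change the first row and is passed on to the word for the next rows, which
  is shorter.\<close>

lemma P_rows_knuth1: "knuth1 w w' \<Longrightarrow> distinct w \<Longrightarrow> P_rows w = P_rows w'"
proof (induction w arbitrary: w' rule: length_induct)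
  case (1 w)
  have ne: "w \<noteq> []" "w' \<noteq> []" using 1(2) by (auto elim: knuth1.cases)
  obtain r b b' where r: "insert_word [] w = (r, b)" "insert_word [] w' = (r, b')" "knuth01 b b'"
    using insert_word_knuth1[OF 1(2,3)] by blast
  have "length b < length w" using insert_word_length[OF ne(1)] r by simp
  moreover have "distinct b" using insert_word_distinct[OF r(1)] 1(3) by simp
  moreover have "mset b = mset b'"
    using r(3) by (auto simp: knuth01_def dest: knuth1_mset)
  then have "length b = length b'" "distinct b = distinct b'"
    by (auto dest: mset_eq_length mset_eq_imp_distinct_iff)
  ultimately have "P_rows b = P_rows b'" using 1(1) r(3) by (auto simp: knuth01_def)
  then show ?case using r ne by (simp add: P_rows_Cons)
qed

lemma P_rows_knuth: "w \<approx> w' \<Longrightarrow> distinct w \<Longrightarrow> P_rows w = P_rows w'"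
proof (induction rule: equivclp_induct)
  case (step y z)
  have "distinct y" "distinct z"
    using step.prems knuth_mset[OF step.hyps(1)] step.hyps(2) knuth1_mset
    by (metis mset_eq_imp_distinct_iff)+
  then show ?case using step P_rows_knuth1 by metis
qed simp

text \<open>The letter \<open>x\<close> passes an entry \<open>z\<close> because the entry \<open>l\<close> in front of \<open>z\<close> satisfies
  \<open>z < l < x\<close>.\<close>

lemma knuth_move_left:
  "sorted_wrt (>) (y # ys) \<Longrightarrow> y < x \<Longrightarrow> (y # ys) @ [x] \<approx> y # x # ys"
proof (induction ys rule: rev_induct)
  case (snoc z ys)
  have "(y # ys) @ [z, x] \<approx> (y # ys) @ [x, z]"
  proof -
    define l where "l = last (y # ys)"
    define u where "u = butlast (y # ys)"
    have e: "y # ys = u @ [l]" unfolding l_def u_def by simp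
    have "l \<in> set (y # ys)" unfolding l_def by (rule last_in_set) simp
    then have "z < l" "l < x" using snoc.prems by (auto simp: sorted_wrt_append)
    then show ?thesis unfolding e using knuth_step[OF knuth1.before[of z l x u "[]"]] by simp
  qed
  also have "(y # ys) @ [x, z] \<approx> (y # x # ys) @ [z]"
    using knuth_context[OF snoc.IH, of "[]" "[z]"] snoc.prems by (simp add: sorted_wrt_append)
  finally show ?case by simp
qed simp

lemma row_insert_hd: "row_insert x r = (r', Some y) \<Longrightarrow> \<exists>g t. r' = g # t \<and> (g = x \<or> r \<noteq> [] \<and> g = hd r \<and> x \<le> g)"
  by (cases r) (auto split: if_splits prod.splits)

text \<open>The bumped letter \<open>y\<close> travels to the front, past entries that all exceed the entry which follows
  \<open>y\<close> at that moment, and that entry is the witness.\<close>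

lemma knuth_row_insert:
  "sorted_wrt (>) r \<Longrightarrow> x \<notin> set r \<Longrightarrow> row_insert x r = (r', Some y) \<Longrightarrow> r @ [x] \<approx> y # r'"
proof (induction r arbitrary: r')
  case (Cons f r)
  show ?case
  proof (cases "f < x")
    case True
    then show ?thesis using Cons.prems knuth_move_left[of f r x] by auto
  next
    case False
    then obtain s where s: "row_insert x r = (s, Some y)" "r' = f # s"
      using Cons.prems by (auto split: prod.splits)
    then have "f # r @ [x] \<approx> f # y # s"
      using Cons knuth_context[of "r @ [x]" "y # s" "[f]" "[]"] by simp
    also have "f # y # s \<approx> y # f # s"
    proof -
      obtain g t where g: "s = g # t" "g = x \<or> r \<noteq> [] \<and> g = hd r \<and> x \<le> g"
        using row_insert_hd[OF s(1)] by blast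
      have "y < x" using row_insert_bump_less[OF s(1)] by simp
      then have "y < g" "g < f" using g Cons.prems False by (cases r; auto)+
      then show ?thesis
        using knuth_sym[OF knuth_step[OF knuth1.after[of y g f "[]" t]]] by (simp add: g)
    qed
    finally show ?thesis by (simp add: s)
  qed
qed auto

lemma row_insert_None: "row_insert x r = (r', None) \<Longrightarrow> r' = r @ [x]"
  by (induction r arbitrary: r') (auto split: if_splits prod.splits)

lemma knuth_insert_word:
  "sorted_wrt (>) r \<Longrightarrow> distinct (r @ w) \<Longrightarrow> insert_word r w = (r', b) \<Longrightarrow> r @ w \<approx> b @ r'"
proof (induction w arbitrary: r' b rule: rev_induct)
  case (snoc x w)
  obtain s c where s: "insert_word r w = (s, c)" by fastforce
  have IH: "r @ w \<approx> c @ s" using snoc.IH[OF snoc.prems(1) _ s] snoc.prems by simp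
  have srt: "sorted_wrt (>) s" using insert_word_sorted[OF snoc.prems(1) _ s] snoc.prems by simp
  have x: "x \<notin> set s"
    using arg_cong[OF insert_word_mset[OF s], of set_mset] snoc.prems(2) by auto
  have 1: "r @ w @ [x] \<approx> c @ s @ [x]"
    using knuth_context[OF IH, of "[]" "[x]"] by simp
  obtain t d where t: "row_insert x s = (t, d)" by fastforce
  show ?case
  proof (cases d)
    case None
    then show ?thesis
      using snoc.prems(3) s t 1 row_insert_None[of x s t] by (simp add: insert_word_append)
  next
    case (Some y)
    have "c @ (s @ [x]) \<approx> c @ (y # t)"
      using knuth_context[OF knuth_row_insert[OF srt x], of t y c "[]"] t Some by simp
    then show ?thesis
      using snoc.prems(3) s t Some 1 knuth_trans by (fastforce simp: insert_word_append)
  qed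
qed auto

text \<open>This makes it possible to prove Knuth equivalences by inserting both sides into one row and
  comparing the bumped words.\<close>

lemma knuth_bumps:
  "distinct w \<Longrightarrow> insert_word [] w = (r, b) \<Longrightarrow> w \<approx> b @ r"
  using knuth_insert_word[of "[]" w r b] by simp

section \<open>Insertion of columns\<close>

text \<open>Two columns of a reverse tableau, the left one first, both listed from top to bottom.\<close>

fun below :: "nat list \<Rightarrow> nat list \<Rightarrow> bool" where
  "below A [] \<longleftrightarrow> True"
| "below [] (b # B) \<longleftrightarrow> False"
| "below (a # A) (b # B) \<longleftrightarrow> b < a \<and> below A B"

lemma below_iff: "below A B \<longleftrightarrow> length B \<le> length A \<and> (\<forall>i<length B. B ! i < A ! i)"
  by (induction A B rule: below.induct) (auto simp: less_Suc_eq_0_disj nth_Cons')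

lemma row_insert_last: "\<forall>z\<in>set r. x < z \<Longrightarrow> row_insert x (r @ s) = apfst ((@) r) (row_insert x s)"
  by (induction r) (auto simp: apfst_def map_prod_def split_def)

text \<open>A column is read from bottom to top, so that each of its entries bumps the one before it, and
  only the top entry stays in the row.\<close>

lemma insert_column:
  "sorted_wrt (>) (x # A) \<Longrightarrow> \<forall>z\<in>set r. x < z \<Longrightarrow> insert_word r (rev (x # A)) = (r @ [x], rev A)"
proof (induction A arbitrary: x)
  case Nil
  then show ?case using row_insert_last[of r x "[]"] by simp
next
  case (Cons a A)
  have 1: "insert_word r (rev (a # A)) = (r @ [a], rev A)"
    by (rule Cons.IH) (use Cons.prems in auto)
  have 2: "row_insert x (r @ [a]) = (r @ [x], Some a)"
    using row_insert_last[of r x "[a]"] Cons.prems by simp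
  have "insert_word r (rev (a # A) @ [x]) = (r @ [x], rev A @ [a])"
    unfolding insert_word_append 1 using 2 by simp
  then show ?case by simp
qed

text \<open>The hole is at the top of a column \<open>A\<close>, and its right neighbour \<open>a\<close> moves into it. Inserting
  both sides into one row bumps the same words up to the same claim with one row less, where the
  top of \<open>A\<close> plays the role of \<open>a\<close>.\<close>

lemma knuth_slide_top:
  "sorted_wrt (>) (a # A) \<Longrightarrow> sorted_wrt (>) (a # B) \<Longrightarrow> below A B \<Longrightarrow> distinct (a # A @ B) \<Longrightarrow>
    rev A @ rev B @ [a] \<approx> rev A @ [a] @ rev B"
proof (induction B arbitrary: A a)
  case (Cons y B)
  obtain x A' where A: "A = x # A'" "y < x" "below A' B" using Cons.prems(3) by (cases A) auto
  have 1: "insert_word [] (rev (x # A')) = ([x], rev A')"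
    using insert_column[of x A' "[]"] Cons.prems A by simp
  have 2: "insert_word [x] (rev (y # B)) = ([x, y], rev B)"
    using insert_column[of y B "[x]"] Cons.prems A by simp
  have 3: "insert_word [x, y] [a] = ([a, y], [x])"
    using Cons.prems A by auto
  have 4: "insert_word [] (rev (a # x # A')) = ([a], rev A' @ [x])"
    using insert_column[of a "x # A'" "[]"] Cons.prems A by simp
  have 5: "insert_word [a] (rev (y # B)) = ([a, y], rev B)"
    using insert_column[of y B "[a]"] Cons.prems A by simp
  have d: "distinct (rev A @ rev (y # B) @ [a])" "distinct (rev A @ [a] @ rev (y # B))"
    using Cons.prems(4) by auto
  have L: "insert_word [] (rev A @ rev (y # B) @ [a]) = ([a, y], rev A' @ rev B @ [x])"
    unfolding A insert_word_append 1 prod.case 2 3 by simp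
  have "insert_word [] (rev (a # x # A') @ rev (y # B)) = ([a, y], rev A' @ [x] @ rev B)"
    unfolding insert_word_append 4 prod.case 5 by simp
  then have R: "insert_word [] (rev A @ [a] @ rev (y # B)) = ([a, y], rev A' @ [x] @ rev B)"
    by (simp add: A)
  have IH: "rev A' @ rev B @ [x] \<approx> rev A' @ [x] @ rev B"
    by (rule Cons.IH) (use Cons.prems A in \<open>auto intro: less_trans\<close>)
  have "rev A @ rev (y # B) @ [a] \<approx> (rev A' @ rev B @ [x]) @ [a, y]"
    using knuth_bumps[OF d(1) L] by simp
  also have "\<dots> \<approx> (rev A' @ [x] @ rev B) @ [a, y]"
    using knuth_context[OF IH, of "[]" "[a, y]"] by simp
  also have "\<dots> \<approx> rev A @ [a] @ rev (y # B)"
    using knuth_sym[OF knuth_bumps[OF d(2) R]] by simp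
  finally show ?case .
qed simp

text \<open>A slide through two columns: the hole first moves down along the column \<open>A1 @ A2\<close> past the
  entries of \<open>A1\<close>, and then \<open>a\<close> moves left into it. As long as the hole is moving down, the first row
  is the same on both sides and can be split off.\<close>

lemma knuth_slide_columns:
  assumes "length A1 = length B1" "below A1 B1" "below A2 B2"
    "sorted_wrt (>) (A1 @ a # A2)" "sorted_wrt (>) (B1 @ a # B2)" "distinct (A1 @ A2 @ B1 @ a # B2)"
  shows "rev (A1 @ A2) @ rev (B1 @ a # B2) \<approx> rev (A1 @ a # A2) @ rev (B1 @ B2)"
  using assms
proof (induction A1 B1 rule: list_induct2)
  case Nil
  then show ?case using knuth_slide_top[of a A2 B2] by simp
next
  case (Cons x A1 y B1)
  have row: "insert_word [] (rev (x # A) @ rev (y # B)) = ([x, y], rev A @ rev B)"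
    if "sorted_wrt (>) (x # A)" "sorted_wrt (>) (y # B)" for A B
  proof -
    have 1: "insert_word [] (rev (x # A)) = ([x], rev A)"
      using insert_column[of x A "[]"] that by simp
    have 2: "insert_word [x] (rev (y # B)) = ([x, y], rev B)"
      using insert_column[of y B "[x]"] that Cons.prems by simp
    show ?thesis unfolding insert_word_append 1 prod.case 2 by simp
  qed
  have 1: "insert_word [] (rev ((x # A1) @ A2) @ rev ((y # B1) @ a # B2)) =
      ([x, y], rev (A1 @ A2) @ rev (B1 @ a # B2))"
    using row[of "A1 @ A2" "B1 @ a # B2"] Cons.prems by (simp add: sorted_wrt_append del: rev.simps)
  have 2: "insert_word [] (rev ((x # A1) @ a # A2) @ rev ((y # B1) @ B2)) =
      ([x, y], rev (A1 @ a # A2) @ rev (B1 @ B2))"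
    using row[of "A1 @ a # A2" "B1 @ B2"] Cons.prems by (simp add: sorted_wrt_append del: rev.simps)
  have IH: "rev (A1 @ A2) @ rev (B1 @ a # B2) \<approx> rev (A1 @ a # A2) @ rev (B1 @ B2)"
    by (rule Cons.IH) (use Cons.prems in auto)
  have d: "distinct (rev ((x # A1) @ A2) @ rev ((y # B1) @ a # B2))"
    "distinct (rev ((x # A1) @ a # A2) @ rev ((y # B1) @ B2))"
    using Cons.prems by auto
  have "rev ((x # A1) @ A2) @ rev ((y # B1) @ a # B2) \<approx> (rev (A1 @ A2) @ rev (B1 @ a # B2)) @ [x, y]"
    by (rule knuth_bumps[OF d(1) 1])
  also have "\<dots> \<approx> (rev (A1 @ a # A2) @ rev (B1 @ B2)) @ [x, y]"
    using knuth_context[OF IH, of "[]" "[x, y]"] by simp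
  also have "\<dots> \<approx> rev ((x # A1) @ a # A2) @ rev ((y # B1) @ B2)"
    by (rule knuth_sym[OF knuth_bumps[OF d(2) 2]])
  finally show ?case .
qed

lemma insert_columns:
  "\<forall>C\<in>set cols. sorted_wrt (>) C \<and> (C \<noteq> [] \<longrightarrow> (\<forall>z\<in>set r. hd C < z)) \<Longrightarrow> sorted_wrt below cols \<Longrightarrow>
    insert_word r (concat (map rev cols)) =
      (r @ map hd (filter (\<lambda>C. C \<noteq> []) cols), concat (map (rev \<circ> tl) cols))"
proof (induction cols arbitrary: r)
  case (Cons C cols)
  show ?case
  proof (cases C)
    case Nil
    then show ?thesis using Cons by simp
  next
    case C: (Cons x A)
    have 1: "insert_word r (rev (x # A)) = (r @ [x], rev A)"
      using insert_column[of x A r] Cons.prems C by simp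
    have hd: "hd D < x" if "D \<in> set cols" "D \<noteq> []" for D
      using Cons.prems(2) that C by (cases D) auto
    have 2: "insert_word (r @ [x]) (concat (map rev cols)) =
      ((r @ [x]) @ map hd (filter (\<lambda>C. C \<noteq> []) cols), concat (map (rev \<circ> tl) cols))"
      by (rule Cons.IH) (use Cons.prems hd in auto)
    have "insert_word r (rev (x # A) @ concat (map rev cols)) =
      (r @ map hd (filter (\<lambda>C. C \<noteq> []) (C # cols)), concat (map (rev \<circ> tl) (C # cols)))"
      unfolding insert_word_append 1 using 2 by (simp add: C)
    then show ?thesis by (simp add: C o_def)
  qed
qed simp

definition rows_of :: "nat list list \<Rightarrow> nat list list"
  where "rows_of cols = map (\<lambda>i. map (\<lambda>C. C ! i) (filter (\<lambda>C. i < length C) cols))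
    [0..<(case cols of [] \<Rightarrow> 0 | C # _ \<Rightarrow> length C)]"

lemma below_tl: "below A B \<Longrightarrow> below (tl A) (tl B)"
  by (cases "(A, B)" rule: below.cases) auto

text \<open>Inserting the columns of a tableau from left to right puts their top entries into the first row
  and bumps the column word of the remaining rows.\<close>

lemma P_rows_columns:
  "\<forall>C\<in>set cols. sorted_wrt (>) C \<Longrightarrow> sorted_wrt below cols \<Longrightarrow>
    P_rows (concat (map rev cols)) = rows_of cols"
proof (induction "case cols of [] \<Rightarrow> 0 | C # _ \<Rightarrow> length C" arbitrary: cols)
  case 0
  have "C = []" if "C \<in> set cols" for C
    using 0 that by (cases cols) (auto simp: below_iff)
  then have "concat (map rev cols) = []" by simp
  moreover have "rows_of cols = []" unfolding rows_of_def using 0 by simp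
  ultimately show ?case by (simp only: fold_simps id_apply)
next
  case (Suc n)
  then obtain C D where cols: "cols = C # D" "length C = Suc n" by (cases cols) auto
  have ne: "concat (map rev cols) \<noteq> []" using cols by auto
  have 1: "insert_word [] (concat (map rev cols)) =
      ([] @ map hd (filter (\<lambda>C. C \<noteq> []) cols), concat (map (rev \<circ> tl) cols))"
    by (rule insert_columns) (use Suc.prems in auto)
  have 2: "P_rows (concat (map rev (map tl cols))) = rows_of (map tl cols)"
  proof (rule Suc.hyps(1))
    show "n = (case map tl cols of [] \<Rightarrow> 0 | C # _ \<Rightarrow> length C)" by (simp add: cols)
    show "\<forall>C\<in>set (map tl cols). sorted_wrt (>) C"
    proof
      fix A assume "A \<in> set (map tl cols)"
      then obtain B where "B \<in> set cols" "A = tl B" by auto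
      then show "sorted_wrt (>) A"
        using Suc.prems(1) sorted_wrt_drop[of "(>)" B 1] by (simp add: drop_Suc)
    qed
    show "sorted_wrt below (map tl cols)"
      using Suc.prems(2) by (auto simp: sorted_wrt_map intro: below_tl elim: sorted_wrt_mono_rel[rotated])
  qed
  have "rows_of cols = map hd (filter (\<lambda>C. C \<noteq> []) cols) # rows_of (map tl cols)"
  proof -
    have upt: "[0..<Suc n] = 0 # map Suc [0..<n]" by (simp add: map_Suc_upt upt_conv_Cons del: upt_Suc)
    have a: "map (\<lambda>C. C ! 0) (filter (\<lambda>C. 0 < length C) cols) = map hd (filter (\<lambda>C. C \<noteq> []) cols)"
      by (auto simp: hd_conv_nth intro!: map_cong)
    have b: "map (\<lambda>C. C ! Suc i) (filter (\<lambda>C. Suc i < length C) cols) =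
        map (\<lambda>C. C ! i) (filter (\<lambda>C. i < length C) (map tl cols))" for i
      by (induction cols) (auto simp: nth_tl)
    have "rows_of cols = map (\<lambda>i. map (\<lambda>C. C ! i) (filter (\<lambda>C. i < length C) cols)) [0..<Suc n]"
      using cols by (simp add: rows_of_def)
    also have "\<dots> = map hd (filter (\<lambda>C. C \<noteq> []) cols) #
        map (\<lambda>i. map (\<lambda>C. C ! i) (filter (\<lambda>C. i < length C) (map tl cols))) [0..<n]"
      unfolding upt list.map a by (simp add: b o_def)
    also have "map (\<lambda>i. map (\<lambda>C. C ! i) (filter (\<lambda>C. i < length C) (map tl cols))) [0..<n] =
        rows_of (map tl cols)"
      unfolding rows_of_def using cols by simp
    finally show ?thesis .
  qed
  then show ?case using P_rows_Cons[OF ne] 1 2 by simp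
qed

text \<open>A word \<open>s\<close> gives the labels \<open>length s\<close>, ..., \<open>1\<close> to its letters, in this order. The labels of
  the letters equal to \<open>k\<close> are the entries of column \<open>k\<close>, from top to bottom.\<close>

fun col_list :: "nat list \<Rightarrow> nat \<Rightarrow> nat list" where
  "col_list [] k = []"
| "col_list (x # s) k = (if x = k then [Suc (length s)] else []) @ col_list s k"

definition colof :: "nat list \<Rightarrow> nat \<Rightarrow> nat"
  where "colof s e = s ! (length s - e)"

text \<open>The column word of the (skew) tableau encoded by \<open>s\<close>. It is obtained by sorting the labels by
  column; since sorting is stable, the labels of a column are increasing. This description makes
  restriction to small labels immediate.\<close>

definition colword :: "nat list \<Rightarrow> nat list"
  where "colword s = sort_key (colof s) [1..<Suc (length s)]"

lemma upt_split: "i \<le> j \<Longrightarrow> j \<le> k \<Longrightarrow> [i..<k] = [i..<j] @ [j..<k]"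
  by (metis le_add_diff_inverse upt_add_eq_append)

lemma insort_key_cong:
  "f x = g x \<Longrightarrow> (\<And>y. y \<in> set ys \<Longrightarrow> f y = g y) \<Longrightarrow> insort_key f x ys = insort_key g x ys"
  by (induction ys) auto

lemma sort_key_cong: "(\<And>x. x \<in> set xs \<Longrightarrow> f x = g x) \<Longrightarrow> sort_key f xs = sort_key g xs"
  by (induction xs) (auto intro: insort_key_cong)

lemma col_list_append:
  "col_list (p @ r) k = map (\<lambda>e. e + length r) (col_list p k) @ col_list r k"
  by (induction p) auto

lemma set_col_list: "set (col_list s k) = {e. 1 \<le> e \<and> e \<le> length s \<and> colof s e = k}"
proof (induction s)
  case (Cons x s)
  have "colof (x # s) e = (if e = Suc (length s) then x else colof s e)" if "1 \<le> e" "e \<le> Suc (length s)" for e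
    using that by (auto simp: colof_def nth_Cons' Suc_diff_le)
  then have "{e. 1 \<le> e \<and> e \<le> length (x # s) \<and> colof (x # s) e = k} =
     {e. 1 \<le> e \<and> e \<le> Suc (length s) \<and> (if e = Suc (length s) then x else colof s e) = k}"
    by auto
  also have "\<dots> = (if x = k then {Suc (length s)} else {}) \<union> set (col_list s k)"
    unfolding Cons.IH by auto
  finally show ?case by simp
qed simp

lemma sorted_col_list: "sorted_wrt (>) (col_list s k)"
  by (induction s) (auto simp: set_col_list)

lemma distinct_col_list: "distinct (col_list s k)"
  by (induction s) (auto simp: set_col_list)

lemma length_col_list: "length (col_list s k) = count_list s k"
  by (induction s) auto

lemma distinct_colword [simp]: "distinct (colword s)"
  by (simp add: colword_def)

lemma colword_filter:
  "filter (\<lambda>e. 1 \<le> e \<and> e \<le> length s) (colword (c @ s)) = colword s"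
proof -
  have "filter (\<lambda>e. 1 \<le> e \<and> e \<le> length s) [1..<Suc (length (c @ s))] = [1..<Suc (length s)]"
  proof -
    have "[1..<Suc (length (c @ s))] = [1..<Suc (length s)] @ [Suc (length s)..<Suc (length (c @ s))]"
      by (rule upt_split) auto
    then show ?thesis by (simp add: filter_id_conv del: upt_Suc)
  qed
  then have "filter (\<lambda>e. 1 \<le> e \<and> e \<le> length s) (colword (c @ s)) =
      sort_key (colof (c @ s)) [1..<Suc (length s)]"
    unfolding colword_def filter_sort by simp
  also have "\<dots> = colword s"
    unfolding colword_def
    by (rule sort_key_cong) (auto simp: colof_def nth_append)
  finally show ?thesis .
qed

lemma knuth_colword_suffix:
  assumes "colword (c @ s) \<approx> colword (c' @ s')" "length s = length s'"
  shows "colword s \<approx> colword s'"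
  using knuth_filter[OF assms(1), of 1 "length s"] colword_filter[of s c] colword_filter[of s' c'] assms(2)
  by simp

text \<open>An ascent of \<open>s\<close> means that of two consecutive labels the larger one comes first in the column
  word. Knuth moves never exchange consecutive values, because nothing lies between them.\<close>

lemma knuth_colword_ascents:
  assumes "colword s \<approx> colword s'" "length s = length s'" "Suc i < length s"
  shows "s ! i < s ! Suc i \<longleftrightarrow> s' ! i < s' ! Suc i"
proof -
  define e where "e = length s - Suc i"
  have e: "1 \<le> e" "Suc e \<le> length s" "length s - e = Suc i" "length s - Suc e = i"
    using assms(3) by (auto simp: e_def)
  have *: "filter (\<lambda>x. e \<le> x \<and> x \<le> Suc e) (colword t) =
      (if t ! i < t ! Suc i then [Suc e, e] else [e, Suc e])" if "length t = length s" for t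
  proof -
    have "filter (\<lambda>x. e \<le> x \<and> x \<le> Suc e) [1..<Suc (length t)] = [e, Suc e]"
    proof -
      have "[1..<Suc (length t)] = [1..<e] @ [e, Suc e] @ [Suc (Suc e)..<Suc (length t)]"
        using e that upt_split[of 1 e "Suc (length t)"] upt_conv_Cons[of e "Suc (length t)"]
          upt_conv_Cons[of "Suc e" "Suc (length t)"] by (simp del: upt_Suc)
      then show ?thesis by (simp add: filter_empty_conv del: upt_Suc)
    qed
    then have "filter (\<lambda>x. e \<le> x \<and> x \<le> Suc e) (colword t) = sort_key (colof t) [e, Suc e]"
      unfolding colword_def filter_sort by simp
    then show ?thesis using e that by (simp add: colof_def)
  qed
  have "filter (\<lambda>x. e \<le> x \<and> x \<le> Suc e) (colword s) \<approx> filter (\<lambda>x. e \<le> x \<and> x \<le> Suc e) (colword s')"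
    by (rule knuth_filter[OF assms(1)])
  then have "filter (\<lambda>x. e \<le> x \<and> x \<le> Suc e) (colword s) = filter (\<lambda>x. e \<le> x \<and> x \<le> Suc e) (colword s')"
    by (rule knuth_short) (simp add: *)
  then show ?thesis using *[of s] *[of s'] assms(2) by (auto split: if_splits)
qed

lemma colword_columns:
  assumes "\<forall>x\<in>set s. x < K"
  shows "colword s = concat (map rev (map (col_list s) [0..<K]))"
proof -
  let ?w = "concat (map rev (map (col_list s) [0..<K]))"
  have lt: "colof s e < K" if "1 \<le> e" "e \<le> length s" for e
    using assms that by (auto simp: colof_def)
  have sw: "set ?w = {1..<Suc (length s)}"
    using lt by (auto simp: set_col_list)
  have f: "filter (\<lambda>x. colof s x = k) (rev (col_list s i)) = (if i = k then rev (col_list s k) else [])" for i k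
    by (auto simp: filter_empty_conv filter_id_conv set_col_list)
  have g: "filter (\<lambda>x. colof s x = k) (concat (map rev (map (col_list s) [0..<n]))) =
      (if k < n then rev (col_list s k) else [])" for k n
    by (induction n) (auto simp: f)
  have h: "filter (\<lambda>x. colof s x = k) [1..<Suc (length s)] = rev (col_list s k)" for k
  proof -
    have "sorted_wrt (<) (rev (col_list s k))" using sorted_col_list[of s k] by (simp add: sorted_wrt_rev)
    moreover have "sorted_wrt (<) (filter (\<lambda>x. colof s x = k) [1..<Suc (length s)])"
      by (intro sorted_wrt_filter) (simp del: upt_Suc)
    moreover have "set (filter (\<lambda>x. colof s x = k) [1..<Suc (length s)]) = set (rev (col_list s k))"
      by (auto simp: set_col_list)
    ultimately show ?thesis by (intro strict_sorted_equal) auto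
  qed
  have d: "distinct (concat (map rev (map (col_list s) [0..<n])))" for n
    by (induction n) (auto simp: distinct_col_list set_col_list)
  have srt1: "sorted (map (colof s) (rev (col_list s n)))" for n
  proof -
    have "map (colof s) (rev (col_list s n)) = map (\<lambda>_. n) (rev (col_list s n))"
      by (auto simp: set_col_list)
    then show ?thesis by (simp add: map_replicate_const del: map_eq_conv)
  qed
  have srt: "sorted (map (colof s) (concat (map rev (map (col_list s) [0..<n]))))" for n
    using srt1 by (induction n) (auto simp: sorted_append set_col_list)
  show ?thesis
    unfolding colword_def
  proof (rule properties_for_sort_key)
    show "mset ?w = mset [1..<Suc (length s)]"
      using set_eq_iff_mset_eq_distinct[OF d distinct_upt, of K 1 "Suc (length s)"] sw by (simp del: upt_Suc)
    fix k assume "k \<in> set ?w"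
    then have "1 \<le> k" "k \<le> length s" unfolding sw by auto
    then have "colof s k < K" by (rule lt)
    then show "filter (\<lambda>x. colof s k = colof s x) ?w = filter (\<lambda>x. colof s k = colof s x) [1..<Suc (length s)]"
      using g[of "colof s k" K] h[of "colof s k"] by (simp only: eq_commute[of "colof s k"] if_True)
  next
    show "sorted (map (colof s) ?w)" by (rule srt)
  qed
qed

lemma below_shift: "below (map (\<lambda>e. e + n) A) (map (\<lambda>e. e + n) B) \<longleftrightarrow> below A B"
  by (induction A B rule: below.induct) auto

text \<open>The \<open>i\<close>-th label in column \<open>k'\<close> is preceded, at larger labels, by at least \<open>i\<close> labels in
  column \<open>k\<close>.\<close>

lemma below_col_list:
  assumes "k \<noteq> k'" "\<And>d e. s = d @ e \<Longrightarrow> count_list d k' \<le> count_list d k"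
  shows "below (col_list s k) (col_list s k')"
  using assms(2)
proof (induction s rule: rev_induct)
  case (snoc x s)
  have IH: "below (col_list s k) (col_list s k')"
    using snoc by (metis append_assoc)
  have le: "count_list (s @ [x]) k' \<le> count_list (s @ [x]) k" using snoc.prems[of "s @ [x]" "[]"] by simp
  have pos: "\<forall>i<count_list s k. Suc 0 < col_list s k ! i \<or> Suc 0 = col_list s k ! i"
    using nth_mem[of _ "col_list s k"] by (fastforce simp: set_col_list length_col_list)
  show ?case
    using IH le pos assms(1)
    by (auto simp: col_list_append below_iff nth_append length_col_list less_Suc_eq split: if_splits)
qed simp

lemma below_filter: "below A B \<Longrightarrow> sorted_wrt (>) A \<Longrightarrow> sorted_wrt (>) B \<Longrightarrow>
    length (filter (\<lambda>x. t < x) B) \<le> length (filter (\<lambda>x. t < x) A)"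
  by (induction A B rule: below.induct) auto

lemma count_prefix: "count_list d k = length (filter (\<lambda>x. length e < x) (col_list (d @ e) k))"
proof -
  have "filter (\<lambda>x. length e < x) (map (\<lambda>x. x + length e) (col_list d k)) = map (\<lambda>x. x + length e) (col_list d k)"
    by (auto simp: filter_id_conv set_col_list)
  moreover have "filter (\<lambda>x. length e < x) (col_list e k) = []"
    by (auto simp: filter_empty_conv set_col_list)
  ultimately show ?thesis by (simp add: col_list_append length_col_list[symmetric])
qed

lemma admissible_count_antimono:
  assumes "admissible [] (d @ e)" "i \<le> j"
  shows "count_list d j \<le> count_list d i"
proof -
  have "admissible [] d" using assms(1) by (simp add: admissible_append)
  from height_walk[OF this] show ?thesis using height_antimono[OF assms(2), of "walk [] d"] by simp
qed

lemma admissible_iff_below: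
  "admissible [] s \<longleftrightarrow> (\<forall>j. below (col_list s j) (col_list s (Suc j)))"
proof
  assume "admissible [] s"
  then show "\<forall>j. below (col_list s j) (col_list s (Suc j))"
    by (auto intro!: below_col_list simp: admissible_count_antimono)
next
  assume b: "\<forall>j. below (col_list s j) (col_list s (Suc j))"
  show "admissible [] s"
    unfolding admissible_iff_prefix
  proof (intro allI impI)
    fix d e j assume s: "s = d @ e"
    show "count_list d (Suc j) \<le> count_list d j"
      unfolding count_prefix[of d _ e]
      by (rule below_filter) (use b s sorted_col_list in auto)
  qed
qed

lemma admissible_below:
  "admissible [] s \<Longrightarrow> i < j \<Longrightarrow> below (col_list s i) (col_list s j)"
  by (intro below_col_list) (auto intro: admissible_count_antimono)

text \<open>One move of the hole from column \<open>h\<close> to column \<open>Suc h\<close>, at a moment where these columns have equal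
  length in \<open>p\<close>. The labels of \<open>p\<close> are the ones above the moving entry, those of \<open>r\<close> are below it, and
  the situation is that of \<open>knuth_slide_columns\<close>.\<close>

lemma knuth_move_letter:
  assumes "\<And>d e. p = d @ e \<Longrightarrow> count_list d (Suc h) \<le> count_list d h"
    "count_list p (Suc h) = count_list p h"
    "\<And>d e. r = d @ e \<Longrightarrow> count_list d (Suc h) \<le> count_list d h"
  shows "colword (p @ Suc h # r) \<approx> colword (p @ h # r)"
proof -
  let ?w = "p @ Suc h # r" and ?w' = "p @ h # r"
  let ?f = "map (\<lambda>e. e + Suc (length r))"
  let ?A1 = "?f (col_list p h)" and ?B1 = "?f (col_list p (Suc h))"
  let ?A2 = "col_list r h" and ?B2 = "col_list r (Suc h)" and ?a = "Suc (length r)"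
  \<comment> \<open>Any bound on the letters that exceeds \<open>Suc h\<close> will do.\<close>
  define K where "K = Suc (Suc h) + sum_list ?w"
  have K: "x < K" if "x \<in> set ?w \<union> set ?w'" for x
    using member_le_sum_list[of x p] member_le_sum_list[of x r] that by (auto simp: K_def)
  have e: "col_list ?w h = ?A1 @ ?A2" "col_list ?w (Suc h) = ?B1 @ ?a # ?B2"
    "col_list ?w' h = ?A1 @ ?a # ?A2" "col_list ?w' (Suc h) = ?B1 @ ?B2"
    "\<And>k. k \<noteq> h \<Longrightarrow> k \<noteq> Suc h \<Longrightarrow> col_list ?w k = col_list ?w' k"
    by (auto simp: col_list_append)
  have "Suc (Suc h) \<le> K" by (simp add: K_def)
  then have "[0..<K] = [0..<h] @ [h, Suc h] @ [Suc (Suc h)..<K]"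
    using upt_split[of 0 h K] upt_conv_Cons[of h K] upt_conv_Cons[of "Suc h" K] by simp
  then have c: "concat (map rev (map (col_list t) [0..<K])) =
      concat (map rev (map (col_list t) [0..<h])) @ (rev (col_list t h) @ rev (col_list t (Suc h))) @
      concat (map rev (map (col_list t) [Suc (Suc h)..<K]))" for t
    by simp
  have m: "map (col_list ?w) [0..<h] = map (col_list ?w') [0..<h]"
    "map (col_list ?w) [Suc (Suc h)..<K] = map (col_list ?w') [Suc (Suc h)..<K]"
    by (intro map_cong refl e(5); auto)+
  \<comment> \<open>Only the columns \<open>h\<close> and \<open>Suc h\<close> of the two words differ.\<close>
  have slide: "rev (?A1 @ ?A2) @ rev (?B1 @ ?a # ?B2) \<approx> rev (?A1 @ ?a # ?A2) @ rev (?B1 @ ?B2)"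
  proof (rule knuth_slide_columns)
    show "length ?A1 = length ?B1" using assms(2) by (simp add: length_col_list)
    show "below ?A1 ?B1" unfolding below_shift using below_col_list[of h "Suc h" p] assms(1) by simp
    show "below ?A2 ?B2" using below_col_list[of h "Suc h" r] assms(3) by simp
    show "sorted_wrt (>) (?A1 @ ?a # ?A2)" using sorted_col_list[of ?w' h] unfolding e .
    show "sorted_wrt (>) (?B1 @ ?a # ?B2)" using sorted_col_list[of ?w "Suc h"] unfolding e .
    have "set (col_list ?w h) \<inter> set (col_list ?w (Suc h)) = {}" by (auto simp: set_col_list)
    then have "distinct ((?A1 @ ?A2) @ (?B1 @ ?a # ?B2))"
      using distinct_col_list[of ?w h] distinct_col_list[of ?w "Suc h"] unfolding e distinct_append
      by blast
    then show "distinct (?A1 @ ?A2 @ ?B1 @ ?a # ?B2)" by simp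
  qed
  have "colword ?w = concat (map rev (map (col_list ?w) [0..<K]))"
    by (rule colword_columns) (use K in auto)
  moreover have "colword ?w' = concat (map rev (map (col_list ?w') [0..<K]))"
    by (rule colword_columns) (use K in auto)
  ultimately show ?thesis
    unfolding c m e using knuth_context[OF slide] by simp
qed

text \<open>The moves of the hole are carried out from right to left, so that the part \<open>u\<close> of the word that has
  been slid already is admissible at each move.\<close>

lemma knuth_slide:
  "admissible [] u \<Longrightarrow> addable h (walk [] u) \<Longrightarrow> admissible (outer h (walk [] u)) s \<Longrightarrow>
    slide (walk [] u) h s = (c, j) \<Longrightarrow> colword (u @ s) \<approx> colword (u @ c)"
proof (induction s arbitrary: u h c)
  case (Cons x s)
  let ?\<alpha> = "walk [] u"
  show ?case
  proof (cases "addable x ?\<alpha>")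
    case True
    obtain c' where c: "c = x # c'" "slide (up x ?\<alpha>) h s = (c', j)"
      using Cons.prems(4) True by (cases "slide (up x ?\<alpha>) h s") auto
    note * = outer_up_same[OF Cons.prems(2) True]
    show ?thesis
      using Cons.IH[of "u @ [x]" h c'] * c Cons.prems True by (auto simp: admissible_append)
  next
    case False
    obtain c' where c: "c = h # c'" "slide (up h ?\<alpha>) x s = (c', j)"
      using Cons.prems(4) False by (cases "slide (up h ?\<alpha>) x s") auto
    note * = outer_up_new[OF Cons.prems(2) False]
    have x: "x = Suc h" and out: "admissible (outer x (up h ?\<alpha>)) s"
      using * Cons.prems(3) by auto
    have 1: "colword (u @ h # s) \<approx> colword (u @ h # c')"
      using Cons.IH[of "u @ [h]" x c'] * c Cons.prems out by (auto simp: admissible_append)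
    have hu: "height ?\<alpha> i = count_list u i" for i
      using height_walk[OF Cons.prems(1), of i] by simp
    have "colword (u @ Suc h # s) \<approx> colword (u @ h # s)"
    proof (rule knuth_move_letter)
      show "count_list d (Suc h) \<le> count_list d h" if "u = d @ e" for d e
        using admissible_count_antimono[of d e h "Suc h"] Cons.prems(1) that by simp
      show "count_list u (Suc h) = count_list u h"
        using False x height_antimono[of h "Suc h" ?\<alpha>] by (simp add: addable_iff_height hu)
      then show "count_list d (Suc h) \<le> count_list d h" if "s = d @ e" for d e
        using height_antimono[of h "Suc h" "walk (outer x (up h ?\<alpha>)) d"]
          height_walk[of "outer x (up h ?\<alpha>)" d] out that
          height_outer[OF *(3)] height_up[OF Cons.prems(2)] *(3) Cons.prems(3)
        by (simp add: admissible_append x hu)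
    qed
    then show ?thesis using 1 c x knuth_trans by simp
  qed
qed simp

section \<open>Standard reverse tableaux as words\<close>

definition tab :: "nat list \<Rightarrow> filling"
  where "tab s = (\<lambda>(i, j). if i < length (col_list s j) then Some (col_list s j ! i) else None)"

lemma filter_upt_downward:
  "(\<And>a b. a \<le> b \<Longrightarrow> P b \<Longrightarrow> P a) \<Longrightarrow> \<exists>m. filter P [0..<K] = [0..<m]"
proof (induction K)
  case 0
  show ?case by (intro exI[of _ 0]) simp
next
  case (Suc K)
  show ?case
  proof (cases "P K")
    case True
    then have "P x" if "x < K" for x using Suc.prems[of x K] that by simp
    then have "filter P [0..<K] = [0..<K]" by (auto simp: filter_id_conv)
    then show ?thesis using True by (intro exI[of _ "Suc K"]) simp
  next
    case False
    then show ?thesis using Suc by simp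
  qed
qed

lemma P_tableau_colword:
  assumes "admissible [] s"
  shows "P_tableau (colword s) = tab s"
proof -
  define K where "K = Suc (Max (insert 0 (set s)))"
  have K: "\<forall>x\<in>set s. x < K" by (simp add: K_def less_Suc_eq_le)
  let ?cols = "map (col_list s) [0..<K]"
  have P: "P_rows (colword s) = rows_of ?cols"
    unfolding colword_columns[OF K]
  proof (rule P_rows_columns)
    show "\<forall>C\<in>set ?cols. sorted_wrt (>) C" by (auto simp: sorted_col_list)
    show "sorted_wrt below ?cols"
      unfolding sorted_wrt_iff_nth_less by (simp add: admissible_below[OF assms])
  qed
  have anti: "length (col_list s b) \<le> length (col_list s a)" if "a \<le> b" for a b
    using admissible_count_antimono[of s "[]" a b] assms that by (simp add: length_col_list)
  have out: "col_list s j = []" if "j \<ge> K" for j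
  proof -
    have "count_list s j = 0" using K that by (auto simp: count_list_0_iff)
    then show ?thesis by (simp flip: length_col_list)
  qed
  have len: "length (rows_of ?cols) = length (col_list s 0)"
  proof -
    have "[0..<K] = 0 # [Suc 0..<K]" by (rule upt_conv_Cons) (simp add: K_def)
    then show ?thesis by (simp add: rows_of_def)
  qed
  have row: "\<exists>m. rows_of ?cols ! i = map (\<lambda>j. col_list s j ! i) [0..<m] \<and>
      (\<forall>j. j < m \<longleftrightarrow> i < length (col_list s j))" if "i < length (col_list s 0)" for i
  proof -
    let ?P = "\<lambda>j. i < length (col_list s j)"
    obtain m where m: "filter ?P [0..<K] = [0..<m]"
      using filter_upt_downward[of ?P K] anti by (meson less_le_trans)
    have "rows_of ?cols ! i = map (\<lambda>C. C ! i) (filter (\<lambda>C. i < length C) ?cols)"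
      using that len by (simp add: rows_of_def)
    also have "\<dots> = map (\<lambda>j. col_list s j ! i) [0..<m]"
      by (simp add: filter_map o_def m)
    finally have 1: "rows_of ?cols ! i = map (\<lambda>j. col_list s j ! i) [0..<m]" .
    have "j \<in> set [0..<m] \<longleftrightarrow> j < K \<and> ?P j" for j
      unfolding m[symmetric] by simp
    then have "j < m \<longleftrightarrow> ?P j" for j
      using out[of j] by (cases "j < K") auto
    then show ?thesis using 1 by blast
  qed
  have "filling_of_rows (rows_of ?cols) (i, j) = tab s (i, j)" for i j
  proof (cases "i < length (col_list s 0)")
    case True
    obtain m where m: "rows_of ?cols ! i = map (\<lambda>j. col_list s j ! i) [0..<m]"
      "j < m \<longleftrightarrow> i < length (col_list s j)"
      using row[OF True] by blast
    then show ?thesis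
      using True len by (simp add: filling_of_rows_def tab_def)
  next
    case False
    then show ?thesis using anti[of 0 j] by (simp add: filling_of_rows_def tab_def len)
  qed
  then show ?thesis unfolding P_tableau_def P by auto
qed

lemma diagram_partition:
  "sorted_wrt (\<ge>) \<nu> \<Longrightarrow> (i, j) \<in> diagram \<nu> \<longleftrightarrow> i < height \<nu> j"
proof (induction \<nu> arbitrary: i)
  case Nil
  then show ?case by (simp add: diagram_def)
next
  case (Cons a \<nu>)
  have 1: "(i, j) \<in> diagram (a # \<nu>) \<longleftrightarrow> (case i of 0 \<Rightarrow> j < a | Suc i' \<Rightarrow> (i', j) \<in> diagram \<nu>)"
    by (auto simp: diagram_def split: nat.splits)
  have 2: "height \<nu> j = 0" if "\<not> j < a"
    using that Cons.prems by (auto simp: height_def filter_empty_conv)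
  show ?case using Cons 1 2 by (auto simp: height_Cons split: nat.splits)
qed

lemma height_sort: "height (rev (sort \<alpha>)) j = height \<alpha> j"
  unfolding height_def by (metis mset_filter mset_rev mset_sort size_mset)

lemma sum_list_sort: "sum_list (rev (sort \<alpha>)) = sum_list (\<alpha> :: nat list)"
  by (metis mset_rev mset_sort sum_mset_sum_list)

text \<open>The C-shape sorted: this partition has the same column heights.\<close>

definition shape_of :: "nat list \<Rightarrow> nat list"
  where "shape_of s = rev (sort (walk [] s))"

lemma tab_dom: "dom (tab s) = {(i, j). i < count_list s j}"
  by (auto simp: tab_def length_col_list split: if_splits)

lemma skew_SRT_tab:
  assumes "admissible [] s"
  shows "skew_SRT (shape_of s) [] (tab s)"
proof -
  have srt: "sorted_wrt (\<ge>) (shape_of s)" by (simp add: shape_of_def sorted_wrt_rev)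
  have part: "is_partition (shape_of s)"
    using srt pos_walk[of "[]" s] by (simp add: is_partition_def is_composition_def shape_of_def)
  have h: "height (shape_of s) j = count_list s j" for j
    using height_walk[OF assms, of j] by (simp add: shape_of_def height_sort)
  have d: "dom (tab s) = diagram (shape_of s)"
    unfolding tab_dom using diagram_partition[OF srt] h by auto
  have sum: "sum_list (shape_of s) = length s"
    using sum_list_walk[OF assms] unfolding shape_of_def sum_list_sort by simp
  have tabD: "a \<in> set (col_list s j) \<and> colof s a = j \<and> 1 \<le> a \<and> a \<le> length s" if "tab s (i, j) = Some a" for i j a
  proof -
    have "a \<in> set (col_list s j)" using that by (auto simp: tab_def split: if_splits)
    then show ?thesis by (auto simp: set_col_list)
  qed
  have bij: "bij_betw (tab s) (dom (tab s)) (Some ` {1..length s})"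
    unfolding bij_betw_def
  proof
    show "inj_on (tab s) (dom (tab s))"
    proof (rule inj_onI)
      fix x y assume "x \<in> dom (tab s)" "y \<in> dom (tab s)" "tab s x = tab s y"
      then obtain i j i' j' a where x: "x = (i, j)" "y = (i', j')" "tab s (i, j) = Some a" "tab s (i', j') = Some a"
        by (cases x; cases y) auto
      then have "j = j'" using tabD by blast
      moreover have "i = i'"
        using x \<open>j = j'\<close> distinct_col_list[of s j] by (auto simp: tab_def nth_eq_iff_index_eq split: if_splits)
      ultimately show "x = y" using x by simp
    qed
    show "tab s ` dom (tab s) = Some ` {1..length s}"
    proof
      show "tab s ` dom (tab s) \<subseteq> Some ` {1..length s}" using tabD by fastforce
      show "Some ` {1..length s} \<subseteq> tab s ` dom (tab s)"
      proof clarify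
        fix a assume "a \<in> {1..length s}"
        then have "a \<in> set (col_list s (colof s a))" by (simp add: set_col_list)
        then obtain i where "i < length (col_list s (colof s a))" "col_list s (colof s a) ! i = a"
          by (auto simp: in_set_conv_nth)
        then have "tab s (i, colof s a) = Some a" by (simp add: tab_def)
        then show "Some a \<in> tab s ` dom (tab s)" by (metis domI image_eqI)
      qed
    qed
  qed
  have rows: "b < a" if "tab s (i, j) = Some a" "tab s (i, j') = Some b" "j < j'" for i j j' a b
    using admissible_below[OF assms that(3)] that by (auto simp: tab_def below_iff split: if_splits)
  have cols: "b < a" if "tab s (i, j) = Some a" "tab s (i', j) = Some b" "i < i'" for i i' j a b
    using sorted_wrt_nth_less[OF sorted_col_list[of s j], of i i'] that by (auto simp: tab_def split: if_splits)
  have e: "is_partition []" "diagram [] = {}"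
    by (auto simp: is_partition_def is_composition_def diagram_def)
  show ?thesis
    unfolding skew_SRT_def
  proof (intro conjI)
    show "bij_betw (tab s) (dom (tab s)) (Some ` {1..sum_list (shape_of s) - sum_list []})"
      using bij sum by simp
    show "\<forall>i j j' a b. tab s (i, j) = Some a \<and> tab s (i, j') = Some b \<and> j < j' \<longrightarrow> b < a"
      using rows by blast
    show "\<forall>i i' j a b. tab s (i, j) = Some a \<and> tab s (i', j) = Some b \<and> i < i' \<longrightarrow> b < a"
      using cols by blast
  qed (use part d e in simp_all)
qed

definition column_of :: "filling \<Rightarrow> nat \<Rightarrow> nat"
  where "column_of T e = (THE j. e \<in> column T j)"

definition word :: "filling \<Rightarrow> nat list"
  where "word T = map (column_of T) (rev [1..<Suc (card (dom T))])"

lemma sum_list_eq_card_diagram: "sum_list \<nu> = card (diagram \<nu>)"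
proof -
  have "diagram \<nu> = (SIGMA i:{..<length \<nu>}. {..<\<nu> ! i})"
    by (auto simp: diagram_def)
  then show ?thesis by (simp add: sum_list_sum_nth atLeast0LessThan)
qed

lemma SRT_facts:
  assumes "skew_SRT \<nu> [] T"
  shows "card (dom T) = sum_list \<nu>" "\<And>i j. T (i, j) \<noteq> None \<longleftrightarrow> i < height \<nu> j"
    "\<And>c d a. T c = Some a \<Longrightarrow> T d = Some a \<Longrightarrow> c = d"
    "(\<exists>c. T c = Some a) \<longleftrightarrow> 1 \<le> a \<and> a \<le> sum_list \<nu>"
proof -
  have e: "diagram [] = {}" by (simp add: diagram_def)
  have d: "dom T = diagram \<nu>" and b: "bij_betw T (dom T) (Some ` {1..sum_list \<nu>})"
    and p: "is_partition \<nu>"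
    using assms[unfolded skew_SRT_def e Diff_empty sum_list.Nil minus_nat.diff_0] by blast+
  have p': "sorted_wrt (\<ge>) \<nu>" using p by (simp add: is_partition_def)
  show "card (dom T) = sum_list \<nu>" using d sum_list_eq_card_diagram by simp
  show "T (i, j) \<noteq> None \<longleftrightarrow> i < height \<nu> j" for i j
    unfolding diagram_partition[OF p', of i j, symmetric] d[symmetric] by (simp add: dom_def)
  have inj: "inj_on T (dom T)" and im: "T ` dom T = Some ` {1..sum_list \<nu>}"
    using b by (simp_all add: bij_betw_def)
  show "c = d" if "T c = Some a" "T d = Some a" for c d a
    using inj_onD[OF inj, of c d] that by (simp add: dom_def)
  have "(\<exists>c. T c = Some a) \<longleftrightarrow> Some a \<in> T ` dom T"
  proof
    assume "\<exists>c. T c = Some a"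
    then obtain c where "T c = Some a" by blast
    then show "Some a \<in> T ` dom T" by (intro image_eqI[of _ _ c]) auto
  next
    assume "Some a \<in> T ` dom T"
    then obtain c where "Some a = T c" by blast
    then show "\<exists>c. T c = Some a" by (intro exI[of _ c]) simp
  qed
  also have "\<dots> \<longleftrightarrow> 1 \<le> a \<and> a \<le> sum_list \<nu>" unfolding im by auto
  finally show "(\<exists>c. T c = Some a) \<longleftrightarrow> 1 \<le> a \<and> a \<le> sum_list \<nu>" .
qed

lemma col_list_word:
  assumes "skew_SRT \<nu> [] T"
  shows "length (word T) = sum_list \<nu>"
    "col_list (word T) j = map (\<lambda>i. the (T (i, j))) [0..<height \<nu> j]"
    "set (col_list (word T) j) = column T j"
proof -
  note F = SRT_facts[OF assms]
  have cols: "b < a" if "T (i, j) = Some a" "T (i', j) = Some b" "i < i'" for i i' j a b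
    using assms that unfolding skew_SRT_def by blast
  show len: "length (word T) = sum_list \<nu>" by (simp add: word_def F(1) del: upt_Suc)
  have colof: "colof (word T) e = column_of T e" if "1 \<le> e" "e \<le> sum_list \<nu>" for e
    using that by (simp add: colof_def word_def F(1) rev_nth nth_append del: upt_Suc)
  have co: "column_of T e = j \<longleftrightarrow> e \<in> column T j" if e: "1 \<le> e" "e \<le> sum_list \<nu>" for e j
  proof -
    obtain x where "T x = Some e" using F(4)[of e] e by blast
    then obtain i' j' where c: "T (i', j') = Some e" by (cases x) auto
    have u: "e \<in> column T j \<longleftrightarrow> j = j'" for j
    proof
      assume "e \<in> column T j"
      then obtain i where "T (i, j) = Some e" by (auto simp: column_def)
      from F(3)[OF this c] show "j = j'" by simp
    qed (use c in \<open>auto simp: column_def\<close>)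
    then show ?thesis by (auto simp: column_of_def)
  qed
  have rng: "1 \<le> e \<and> e \<le> sum_list \<nu>" if "e \<in> column T j" for e j
    using that F(4)[of e] by (auto simp: column_def)
  show set: "set (col_list (word T) j) = column T j" for j
  proof -
    have "e \<in> set (col_list (word T) j) \<longleftrightarrow> e \<in> column T j" for e
      unfolding set_col_list len using colof[of e] co[of e j] rng[of e j] by auto
    then show ?thesis by blast
  qed
  let ?L = "map (\<lambda>i. the (T (i, j))) [0..<height \<nu> j]"
  have "sorted_wrt (>) ?L"
  proof -
    have "the (T (i', j)) < the (T (i, j))" if "i < i'" "i' < height \<nu> j" for i i'
    proof -
      obtain a b where "T (i, j) = Some a" "T (i', j) = Some b"
        using F(2)[of i j] F(2)[of i' j] \<open>i < i'\<close> \<open>i' < height \<nu> j\<close> by auto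
      then show ?thesis using cols \<open>i < i'\<close> by simp
    qed
    then show ?thesis by (auto simp: sorted_wrt_iff_nth_less)
  qed
  moreover have "set ?L = column T j"
  proof -
    have "a \<in> set ?L \<longleftrightarrow> a \<in> column T j" for a
    proof
      assume "a \<in> set ?L"
      then obtain i where "i < height \<nu> j" "a = the (T (i, j))" by auto
      then show "a \<in> column T j" using F(2)[of i j] by (auto simp: column_def)
    next
      assume "a \<in> column T j"
      then obtain i where "T (i, j) = Some a" by (auto simp: column_def)
      then show "a \<in> set ?L" using F(2)[of i j] unfolding set_map set_upt by (intro image_eqI[of _ _ i]) auto
    qed
    then show ?thesis by blast
  qed
  ultimately have "rev (col_list (word T) j) = rev ?L"
    using sorted_col_list[of "word T" j] set[of j]
    by (intro strict_sorted_equal) (simp_all add: sorted_wrt_rev)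
  then show "col_list (word T) j = ?L" by simp
qed

lemma admissible_word:
  assumes "skew_SRT \<nu> [] T"
  shows "admissible [] (word T)" "tab (word T) = T"
proof -
  note F = SRT_facts[OF assms] and C = col_list_word[OF assms]
  have rows: "b < a" if "T (i, j) = Some a" "T (i, j') = Some b" "j < j'" for i j j' a b
    using assms that unfolding skew_SRT_def by blast
  have "the (T (i, Suc j)) < the (T (i, j))" if "i < height \<nu> (Suc j)" for i j
    using F(2)[of i j] F(2)[of i "Suc j"] that height_antimono[of j "Suc j" \<nu>] rows[of i j _ "Suc j"]
    by fastforce
  then show "admissible [] (word T)"
    unfolding admissible_iff_below below_iff C(2)
    using less_le_trans[OF _ height_antimono[of _ "Suc _" \<nu>]] height_antimono[of _ "Suc _" \<nu>] by simp
  show "tab (word T) = T"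
  proof (rule ext, clarify)
    fix i j
    show "tab (word T) (i, j) = T (i, j)"
      using F(2)[of i j] by (auto simp: tab_def C(2))
  qed
qed

lemma word_tab:
  assumes "admissible [] s"
  shows "word (tab s) = s"
proof -
  note C = col_list_word[OF skew_SRT_tab[OF assms]]
  have len: "length (word (tab s)) = length s"
    using sum_list_walk[OF assms] unfolding C(1) shape_of_def sum_list_sort by simp
  have col: "column (tab s) j = set (col_list s j)" for j
  proof -
    have "tab s (i, j) = Some a \<longleftrightarrow> i < length (col_list s j) \<and> col_list s j ! i = a" for i a
      by (simp add: tab_def)
    then show ?thesis by (simp add: column_def set_conv_nth) blast
  qed
  show ?thesis
  proof (rule nth_equalityI[OF len])
    fix i assume i: "i < length (word (tab s))"
    let ?e = "length s - i"
    have "?e \<in> set (col_list s (colof s ?e))" using i len by (auto simp: set_col_list)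
    then have "?e \<in> set (col_list (word (tab s)) (colof s ?e))" unfolding C(3) col .
    then have "colof (word (tab s)) ?e = colof s ?e" unfolding set_col_list by blast
    then show "word (tab s) ! i = s ! i" using i len by (simp add: colof_def)
  qed
qed

section \<open>The C-shape of a word\<close>

text \<open>The construction of \<open>rho_inv\<close> from the columns \<open>C k\<close>, each listed in decreasing order.\<close>

definition fill_columns :: "(nat \<Rightarrow> nat list) \<Rightarrow> nat \<Rightarrow> nat list list"
  where "fill_columns C K =
    fold (\<lambda>k. fold (place k) (C k)) [1..<K] (map (\<lambda>a. [a]) (rev (C 0)))"

text \<open>The effect of a new smallest entry \<open>v\<close> of column \<open>j\<close>: it can be put into every row of length \<open>j\<close>
  and takes the highest one. On the lengths of the rows this is \<open>up\<close> (\<open>length_add_cell\<close>).\<close>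

definition add_cell :: "nat \<Rightarrow> nat \<Rightarrow> nat list list \<Rightarrow> nat list list"
  where "add_cell j v rows = (if j = 0 then [v] # rows else place j v rows)"

text \<open>Once the smallest entry \<open>e\<close> ends a row, no larger entry of a later column fits into this row.
  Before that, the row was too short for a later column.\<close>

lemma place_commute:
  "x < k \<Longrightarrow> e < a \<Longrightarrow> place k a (place x e rows) = place x e (place k a rows)"
  by (induction rows) auto

lemma add_cell_commute:
  "x < k \<Longrightarrow> e < a \<Longrightarrow> place k a (add_cell x e rows) = add_cell x e (place k a rows)"
  using place_commute[of x k e a rows] by (cases "x = 0") (simp_all add: add_cell_def)

lemma fold_place_add_cell:
  assumes "\<And>k a. k \<in> set ks \<Longrightarrow> a \<in> set (C k) \<Longrightarrow> x < k \<and> e < a"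
  shows "fold (\<lambda>k. fold (place k) (C k)) ks (add_cell x e rows) =
    add_cell x e (fold (\<lambda>k. fold (place k) (C k)) ks rows)"
  using assms
proof (induction ks arbitrary: rows)
  case (Cons k ks)
  have F: "fold (place k) as (add_cell x e rows) = add_cell x e (fold (place k) as rows)"
    if "\<And>a. a \<in> set as \<Longrightarrow> x < k \<and> e < a" for as rows
    using that
  proof (induction as arbitrary: rows)
    case (Cons a as)
    have "place k a (add_cell x e rows) = add_cell x e (place k a rows)"
      using add_cell_commute[of x k e a rows] Cons.prems[of a] by simp
    moreover have "fold (place k) as (add_cell x e (place k a rows)) = add_cell x e (fold (place k) as (place k a rows))"
      by (rule Cons.IH) (rule Cons.prems, simp)
    ultimately show ?case by simp
  qed simp
  have "fold (place k) (C k) (add_cell x e rows) = add_cell x e (fold (place k) (C k) rows)"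
    by (rule F) (rule Cons.prems, simp)
  moreover have "fold (\<lambda>k. fold (place k) (C k)) ks (add_cell x e (fold (place k) (C k) rows)) =
      add_cell x e (fold (\<lambda>k. fold (place k) (C k)) ks (fold (place k) (C k) rows))"
    by (rule Cons.IH) (rule Cons.prems, simp)
  ultimately show ?case by simp
qed simp

text \<open>The smallest entry comes last in its column, and by commutation it may be postponed until all
  columns have been placed.\<close>

lemma fill_columns_add:
  assumes "x < K" "\<And>k a. a \<in> set (C k) \<Longrightarrow> e < a"
  shows "fill_columns (C(x := C x @ [e])) K = add_cell x e (fill_columns C K)"
proof (cases "x = 0")
  case True
  have "fill_columns (C(x := C x @ [e])) K =
      fold (\<lambda>k. fold (place k) ((C(x := C x @ [e])) k)) [1..<K] (add_cell 0 e (map (\<lambda>a. [a]) (rev (C 0))))"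
    by (simp add: fill_columns_def True add_cell_def)
  also have "\<dots> = fold (\<lambda>k. fold (place k) (C k)) [1..<K] (add_cell 0 e (map (\<lambda>a. [a]) (rev (C 0))))"
    by (rule fold_cong) (auto simp: True)
  also have "\<dots> = add_cell 0 e (fold (\<lambda>k. fold (place k) (C k)) [1..<K] (map (\<lambda>a. [a]) (rev (C 0))))"
    by (rule fold_place_add_cell) (use assms in auto)
  finally show ?thesis by (simp add: fill_columns_def True)
next
  case False
  let ?C = "C(x := C x @ [e])"
  have k: "[1..<K] = [1..<x] @ x # [Suc x..<K]"
    using False assms(1) upt_split[of 1 x K] upt_conv_Cons[of x K] by simp
  let ?g = "\<lambda>C k. fold (place k) (C k)"
  have 1: "fold (?g ?C) [1..<x] r = fold (?g C) [1..<x] r" for r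
    by (rule fold_cong) auto
  have 2: "fold (?g ?C) [Suc x..<K] r = fold (?g C) [Suc x..<K] r" for r
    by (rule fold_cong) auto
  have 3: "?g ?C x r = add_cell x e (?g C x r)" for r
    using False by (simp add: add_cell_def)
  have 4: "fold (?g C) [Suc x..<K] (add_cell x e r) = add_cell x e (fold (?g C) [Suc x..<K] r)" for r
    by (rule fold_place_add_cell) (use assms in auto)
  show ?thesis
    unfolding fill_columns_def k fold_append o_apply fold_simps 1 3 2 4 using False by simp
qed

lemma length_add_cell:
  "\<forall>a\<in>set (concat rows). v \<le> a \<Longrightarrow> map length (add_cell j v rows) = up j (map length rows)"
proof -
  have "\<forall>a\<in>set (concat rows). v \<le> a \<Longrightarrow> 0 < j \<Longrightarrow> map length (place j v rows) = raise j (map length rows)"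
  proof (induction rows)
    case (Cons r rows)
    have "v \<le> last r" if "length r = j" using Cons.prems that last_in_set[of r] by auto
    then show ?case using Cons by auto
  qed simp
  then show "\<forall>a\<in>set (concat rows). v \<le> a \<Longrightarrow> ?thesis"
    by (auto simp: add_cell_def up_def)
qed

lemma set_place: "set (concat (place k a rows)) \<subseteq> insert a (set (concat rows))"
  by (induction rows) auto

lemma set_fill_columns: "a \<in> set (concat (fill_columns C K)) \<Longrightarrow> \<exists>k. a \<in> set (C k)"
proof -
  have 1: "set (concat (fold (place k) as rows)) \<subseteq> set as \<union> set (concat rows)" for k as rows
    using set_place by (induction as arbitrary: rows) (simp, fastforce)
  have "set (concat (fold (\<lambda>k. fold (place k) (C k)) ks rows)) \<subseteq> (\<Union>k. set (C k)) \<union> set (concat rows)" for ks rows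
  proof (induction ks arbitrary: rows)
    case (Cons k ks)
    show ?case using Cons[of "fold (place k) (C k) rows"] 1[of k "C k" rows] by auto
  qed simp
  from this[of "[1..<K]" "map (\<lambda>a. [a]) (rev (C 0))"]
  show "a \<in> set (concat (fill_columns C K)) \<Longrightarrow> \<exists>k. a \<in> set (C k)"
    unfolding fill_columns_def[symmetric] by auto
qed

text \<open>The last letter of a word is the column of the smallest entry. The shift \<open>t\<close> keeps the labels
  of a word and of its prefixes comparable.\<close>

lemma length_fill_columns:
  "\<forall>x\<in>set s. x < K \<Longrightarrow> map length (fill_columns (\<lambda>k. map (\<lambda>e. e + t) (col_list s k)) K) = walk [] s"
proof (induction s arbitrary: t rule: rev_induct)
  case Nil
  have "fold (\<lambda>k. fold (place k) []) ks [] = []" for ks by (induction ks) auto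
  then show ?case by (simp add: fill_columns_def)
next
  case (snoc x s)
  let ?C = "\<lambda>k. map (\<lambda>e. e + Suc t) (col_list s k)"
  have "(\<lambda>k. map (\<lambda>e. e + t) (col_list (s @ [x]) k)) = ?C(x := ?C x @ [Suc t])"
    by (auto simp: fun_eq_iff col_list_append)
  moreover have gt: "Suc t < a" if "a \<in> set (?C k)" for k a
    using that by (auto simp: set_col_list)
  ultimately have "fill_columns (\<lambda>k. map (\<lambda>e. e + t) (col_list (s @ [x]) k)) K =
      add_cell x (Suc t) (fill_columns ?C K)"
    using fill_columns_add[of x K ?C "Suc t"] snoc.prems by simp
  moreover have "\<forall>a\<in>set (concat (fill_columns ?C K)). Suc t \<le> a"
    using set_fill_columns[of _ ?C K] gt by (meson less_imp_le)
  moreover have "map length (fill_columns ?C K) = walk [] s"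
    by (rule snoc.IH) (use snoc.prems in simp)
  ultimately show ?case
    using length_add_cell[of "fill_columns ?C K" "Suc t" x] by simp
qed

lemma srt_SRT: "\<exists>\<nu>. skew_SRT \<nu> [] (Rep_srt T)"
  using Rep_srt[of T] by simp

abbreviation srt_word :: "srt \<Rightarrow> nat list"
  where "srt_word T \<equiv> word (Rep_srt T)"

lemma admissible_srt_word [simp]: "admissible [] (srt_word T)"
  using srt_SRT admissible_word(1) by blast

lemma tab_srt_word [simp]: "tab (srt_word T) = Rep_srt T"
  using srt_SRT admissible_word(2) by blast

lemma srt_word_inj: "srt_word T = srt_word T' \<Longrightarrow> T = T'"
  by (metis Rep_srt_inject tab_srt_word)

lemma srt_word_surj: "admissible [] s \<Longrightarrow> \<exists>T. srt_word T = s"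
  using skew_SRT_tab[of s] word_tab[of s] Abs_srt_inverse[of "tab s"] by (metis (mono_tags, lifting) mem_Collect_eq)

lemma dom_srt: "dom (Rep_srt T) = {(i, j). i < count_list (srt_word T) j}"
  using tab_dom[of "srt_word T"] by simp

lemma C_shape_walk: "C_shape T = walk [] (srt_word T)"
proof -
  let ?s = "srt_word T" and ?T = "Rep_srt T"
  obtain \<nu> where \<nu>: "skew_SRT \<nu> [] ?T" using srt_SRT by blast
  have col: "sorted_list_of_set (column ?T k) = rev (col_list ?s k)" for k
  proof -
    have "sorted_wrt (<) (rev (col_list ?s k))" using sorted_col_list by (simp add: sorted_wrt_rev)
    then have "sorted_list_of_set (set (rev (col_list ?s k))) = rev (col_list ?s k)"
      by (intro strict_sorted_equal) auto
    then show ?thesis using col_list_word(3)[OF \<nu>] by simp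
  qed
  have img: "snd ` dom ?T = set ?s"
  proof -
    have "j \<in> snd ` dom ?T \<longleftrightarrow> 0 < count_list ?s j" for j
      by (auto simp: dom_srt image_iff)
    then show ?thesis unfolding set_eq_iff in_set_iff_count by blast
  qed
  obtain K where K: "columns ?T = [0..<K]" "\<forall>x\<in>set ?s. x < K"
  proof -
    have down: "i \<in> set ?s" if "i \<le> j" "j \<in> set ?s" for i j
      using admissible_count_antimono[of ?s "[]" i j] that by (simp add: in_set_iff_count)
    define K where "K = (if set ?s = {} then 0 else Suc (Max (set ?s)))"
    have "set ?s = {..<K}"
    proof (cases "set ?s = {}")
      case False
      then have "Max (set ?s) \<in> set ?s" by (simp add: Max_in)
      then show ?thesis using down False by (auto simp: K_def less_Suc_eq_le)
    qed (simp add: K_def)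
    then show ?thesis using that[of K] by (auto simp: columns_def img sorted_list_of_set_lessThan)
  qed
  have tl: "tl [0..<K] = [1..<K]" by (cases K) (simp_all add: upt_conv_Cons del: upt_Suc)
  have "rho_inv ?T = fill_columns (\<lambda>k. map (\<lambda>e. e + 0) (col_list ?s k)) K"
    unfolding rho_inv_def fill_columns_def K tl col by simp
  then show ?thesis
    unfolding C_shape_def using length_fill_columns[OF K(2), of 0] by simp
qed

section \<open>The product in terms of words\<close>

lemma length_srt_word: "length (srt_word T) = card (cells T)"
  by (simp add: word_def cells_def)

text \<open>The entries of \<open>T\<close> outside the shape of \<open>T1\<close> are the lower parts of the columns of \<open>T\<close>, and these
  are the labels of \<open>s\<close>.\<close>

lemma column_word_suffix:
  assumes "srt_word T = srt_word T1 @ s"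
  shows "column_word (Rep_srt T |` (- cells T1)) = colword s"
proof -
  let ?T = "Rep_srt T |` (- cells T1)"
  have c: "length (col_list (srt_word T) j) = count_list (srt_word T1) j + count_list s j" for j
    by (simp add: assms length_col_list)
  have ent: "?T (i, j) = Some a \<longleftrightarrow>
      count_list (srt_word T1) j \<le> i \<and> i - count_list (srt_word T1) j < count_list s j \<and>
      col_list s j ! (i - count_list (srt_word T1) j) = a" for i j a
  proof -
    have cell: "(i, j) \<in> cells T1 \<longleftrightarrow> i < count_list (srt_word T1) j" by (simp add: cells_def dom_srt)
    have "tab (srt_word T) (i, j) = Some a \<longleftrightarrow> i < count_list (srt_word T1) j + count_list s j \<and>
        col_list (srt_word T) j ! i = a"
      by (simp add: tab_def c del: tab_srt_word)
    then have T: "Rep_srt T (i, j) = Some a \<longleftrightarrow> i < count_list (srt_word T1) j + count_list s j \<and>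
        col_list (srt_word T) j ! i = a" by simp
    show ?thesis
    proof (cases "i < count_list (srt_word T1) j")
      case True
      then show ?thesis using cell by simp
    next
      case False
      then have "col_list (srt_word T) j ! i = col_list s j ! (i - count_list (srt_word T1) j)"
        unfolding assms col_list_append by (simp add: nth_append length_col_list)
      then show ?thesis using False cell T by auto
    qed
  qed
  have col: "column ?T j = set (col_list s j)" for j
  proof -
    have "a \<in> column ?T j \<longleftrightarrow> a \<in> set (col_list s j)" for a
    proof
      assume "a \<in> set (col_list s j)"
      then obtain i where "i < length (col_list s j)" "col_list s j ! i = a" by (auto simp: in_set_conv_nth)
      then have "?T (count_list (srt_word T1) j + i, j) = Some a" unfolding ent by (simp add: length_col_list)
      then show "a \<in> column ?T j" by (auto simp: column_def)
    qed (auto simp: column_def ent length_col_list[symmetric])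
    then show ?thesis by blast
  qed
  have srt: "sorted_list_of_set (column ?T j) = rev (col_list s j)" for j
  proof -
    have "sorted_wrt (<) (rev (col_list s j))" using sorted_col_list by (simp add: sorted_wrt_rev)
    then have "sorted_list_of_set (set (rev (col_list s j))) = rev (col_list s j)"
      by (intro strict_sorted_equal) auto
    then show ?thesis by (simp add: col)
  qed
  define K where "K = Suc (sum_list s)"
  have K: "\<forall>x\<in>set s. x < K" using member_le_sum_list[of _ s] by (auto simp: K_def less_Suc_eq_le)
  have dom: "snd ` dom ?T = set s"
  proof -
    have "j \<in> snd ` dom ?T \<longleftrightarrow> column ?T j \<noteq> {}" for j
      unfolding column_def image_iff dom_def by auto
    also have "column ?T j \<noteq> {} \<longleftrightarrow> j \<in> set s" for j
      unfolding col by (simp add: in_set_iff_count flip: length_col_list)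
    finally show ?thesis by blast
  qed
  have "columns ?T = filter (\<lambda>j. j \<in> set s) [0..<K]"
    unfolding columns_def dom
    by (intro strict_sorted_equal) (use K in \<open>auto intro: sorted_wrt_filter\<close>)
  moreover have "concat (map f (filter (\<lambda>j. j \<in> set s) xs)) = concat (map f xs)"
    if "\<And>j. j \<notin> set s \<Longrightarrow> f j = []" for f :: "nat \<Rightarrow> nat list" and xs
    using that by (induction xs) auto
  moreover have "rev (col_list s j) = []" if "j \<notin> set s" for j
    using that by (auto simp: in_set_iff_count simp flip: length_col_list)
  ultimately have "column_word ?T = concat (map (\<lambda>j. rev (col_list s j)) [0..<K])"
    unfolding column_word_def srt by simp
  then show ?thesis by (simp add: colword_columns[OF K] o_def)
qed

text \<open>Reading words from the largest entry down turns extension of a tableau by smaller entries into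
  extension of its word on the right.\<close>

lemma PR_product_set_iff:
  "T \<in> PR_product_set T1 T2 \<longleftrightarrow>
    (\<exists>s. srt_word T = srt_word T1 @ s \<and> length s = length (srt_word T2) \<and> P_tableau (colword s) = tab (srt_word T2))"
proof -
  let ?n = "card (cells T2)"
  have main: "(cells T1 \<subseteq> cells T \<and> card (cells T) = card (cells T1) + ?n \<and>
      Rep_srt T |` cells T1 = map_option (\<lambda>a. a + ?n) \<circ> Rep_srt T1) \<longleftrightarrow>
    (\<exists>s. srt_word T = srt_word T1 @ s \<and> length s = length (srt_word T2))" (is "?L \<longleftrightarrow> ?R")
  proof
    assume L: ?L
    obtain \<nu>1 \<nu> where \<nu>: "skew_SRT \<nu>1 [] (Rep_srt T1)" "skew_SRT \<nu> [] (Rep_srt T)" using srt_SRT by blast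
    have len: "length (srt_word T) = length (srt_word T1) + length (srt_word T2)" using L by (simp add: length_srt_word)
    have nth: "srt_word T ! i = srt_word T1 ! i" if i: "i < length (srt_word T1)" for i
    proof -
      let ?e = "length (srt_word T1) - i"
      have "?e \<in> set (col_list (srt_word T1) (srt_word T1 ! i))"
        using i by (auto simp: set_col_list colof_def)
      then have "?e \<in> column (Rep_srt T1) (srt_word T1 ! i)" using col_list_word(3)[OF \<nu>(1)] by simp
      then obtain r where r: "Rep_srt T1 (r, srt_word T1 ! i) = Some ?e" by (auto simp: column_def)
      then have "(r, srt_word T1 ! i) \<in> cells T1" by (auto simp: cells_def)
      then have "Rep_srt T (r, srt_word T1 ! i) = (Rep_srt T |` cells T1) (r, srt_word T1 ! i)" by simp
      also have "\<dots> = Some (?e + ?n)" using L r by simp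
      finally have "?e + ?n \<in> column (Rep_srt T) (srt_word T1 ! i)" by (auto simp: column_def)
      then have "?e + ?n \<in> set (col_list (srt_word T) (srt_word T1 ! i))" using col_list_word(3)[OF \<nu>(2)] by simp
      then show ?thesis using i len by (simp add: set_col_list colof_def length_srt_word)
    qed
    have "take (length (srt_word T1)) (srt_word T) = srt_word T1"
      by (rule nth_equalityI) (use len nth in auto)
    then have "srt_word T = srt_word T1 @ drop (length (srt_word T1)) (srt_word T)" by (metis append_take_drop_id)
    then show ?R using len by (intro exI[of _ "drop (length (srt_word T1)) (srt_word T)"]) simp
  next
    assume ?R
    then obtain s where s: "srt_word T = srt_word T1 @ s" "length s = length (srt_word T2)" by blast
    have "cells T1 \<subseteq> cells T" by (auto simp: cells_def dom_srt s)
    moreover have "card (cells T) = card (cells T1) + ?n" using s by (simp flip: length_srt_word)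
    moreover have "Rep_srt T |` cells T1 = map_option (\<lambda>a. a + ?n) \<circ> Rep_srt T1"
    proof
      fix c :: "nat \<times> nat"
      obtain i j where c: "c = (i, j)" by fastforce
      have "Rep_srt T (i, j) = tab (srt_word T) (i, j)" "Rep_srt T1 (i, j) = tab (srt_word T1) (i, j)" by simp_all
      then show "(Rep_srt T |` cells T1) c = (map_option (\<lambda>a. a + ?n) \<circ> Rep_srt T1) c"
        unfolding c
        by (auto simp: restrict_map_def cells_def dom_srt tab_def length_col_list s(1) col_list_append
            nth_append s(2) length_srt_word simp del: tab_srt_word)
    qed
    ultimately show ?L by blast
  qed
  have rectify: "rectification (Rep_srt T |` (- cells T1)) = Rep_srt T2 \<longleftrightarrow> P_tableau (colword s) = tab (srt_word T2)"
    if "srt_word T = srt_word T1 @ s" for s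
    by (simp add: rectification_def column_word_suffix[OF that])
  show ?thesis
    unfolding PR_product_set_def mem_Collect_eq using main rectify by blast
qed

section \<open>Rectification by iterated slides\<close>

text \<open>The \<open>m\<close> largest entries are removed one by one, each followed by a slide. The list records the
  final columns of the holes, and the slide of the largest entry comes first in it.\<close>

fun rectify :: "nat \<Rightarrow> nat list \<Rightarrow> nat list \<times> nat list" where
  "rectify 0 c = (c, [])"
| "rectify (Suc m) c = (case slide [] 0 (tl c) of (c', j) \<Rightarrow> apsnd (Cons j) (rectify m c'))"

fun outers :: "nat list \<Rightarrow> nat list \<Rightarrow> nat list" where
  "outers [] \<alpha> = \<alpha>"
| "outers (j # js) \<alpha> = outer j (outers js \<alpha>)"

fun outers_ok :: "nat list \<Rightarrow> nat list \<Rightarrow> bool" where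
  "outers_ok [] \<alpha> \<longleftrightarrow> True"
| "outers_ok (j # js) \<alpha> \<longleftrightarrow> outers_ok js \<alpha> \<and> addable j (outers js \<alpha>)"

lemma admissible_Nil_Cons: "admissible [] (x # s) \<longleftrightarrow> x = 0 \<and> admissible (outer 0 []) s"
  by (auto simp: addable_def up_def outer_def)

lemma up_0_Nil: "up 0 [] = outer 0 []"
  by (simp add: up_def outer_def)

lemma first_slide:
  assumes "admissible [] (0 # s)" "slide [] 0 s = (c, j)"
  shows "admissible [] c" "addable j (walk [] c)" "length c = length s"
    "walk [] (0 # s) = outer j (walk [] c)" "colword s \<approx> colword c"
proof -
  have a: "addable 0 []" "admissible (outer 0 []) s"
    using assms(1) by (auto simp: admissible_Nil_Cons addable_def simp del: admissible.simps)
  from slide_correct[OF a assms(2)] show "admissible [] c" "addable j (walk [] c)" "length c = length s"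
    "walk [] (0 # s) = outer j (walk [] c)" by (auto simp: up_0_Nil)
  show "colword s \<approx> colword c"
    using knuth_slide[of "[]" 0 s c j] a assms(2) by simp
qed

text \<open>Once the letter \<open>x\<close> of the second largest entry has been read, the hole of the slide that removes
  the largest entry is in column \<open>x\<close>. The hole of the next slide starts in column 0, where that entry
  ends up, and \<open>slide_twice\<close> applies to the two.\<close>

lemma first_two_slides:
  assumes "admissible [] (0 # x # r)" "slide [] 0 (x # r) = (c, j)" "slide [] 0 (tl c) = (d, i)"
  shows "0 < x \<longleftrightarrow> i < j"
proof -
  have x: "x = 0 \<or> x = 1" and adm: "addable x [1]" "admissible (up x [1]) r"
    using assms(1) by (auto simp: addable_def up_def)
  \<comment> \<open>Both are \<open>[1, 1]\<close> for \<open>x = 0\<close> and \<open>[2]\<close> for \<open>x = 1\<close>.\<close>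
  have up: "up x (outer 0 []) = outer x (outer 0 [])"
    using x by (auto simp: up_def outer_def)
  have s: "slide (outer 0 []) x r = (tl c, j)"
    using assms(2) x by (auto simp: addable_def up_0_Nil apfst_def map_prod_def split: prod.splits)
  have o: "outer 0 [] = [1]" by (simp add: outer_def)
  have "admissible (outer x (outer 0 [])) r" using adm up o by simp
  moreover from this have "admissible (outer 0 []) (tl c)"
    using slide_correct[OF _ _ s] adm o by simp
  ultimately show ?thesis
    using slide_twice[of 0 "[]" "tl c" d i x r j] s assms(3) adm o by (simp add: addable_def)
qed

text \<open>Everything that is needed about a word is visible in its rectification \<open>q\<close> and in the columns
  \<open>js\<close>: the C-shape, the Knuth class of its last letters, and the ascents among the first \<open>m\<close>
  letters. The ascent at the front is seen by comparing two slides, and the later ones are preserved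
  by the first slide, as it is a Knuth equivalence.\<close>

lemma rectify_correct:
  "admissible [] c \<Longrightarrow> length c = m + n \<Longrightarrow> rectify m c = (q, js) \<Longrightarrow>
    admissible [] q \<and> length q = n \<and> length js = m \<and> outers_ok js (walk [] q) \<and>
    walk [] c = outers js (walk [] q) \<and> colword (drop m c) \<approx> colword q \<and>
    (\<forall>i. Suc i < m \<longrightarrow> (c ! i < c ! Suc i \<longleftrightarrow> js ! Suc i < js ! i))"
proof (induction m arbitrary: c js)
  case (Suc m)
  obtain s where c: "c = 0 # s"
    using Suc.prems(1,2) by (cases c) (auto simp: admissible_Nil_Cons simp del: admissible.simps)
  obtain c' j where sl: "slide [] 0 s = (c', j)" by fastforce
  obtain js' where js: "js = j # js'" "rectify m c' = (q, js')"
    using Suc.prems(3) sl c by (cases "rectify m c'") auto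
  note F = first_slide[OF Suc.prems(1)[unfolded c] sl]
  have len: "length c' = m + n" using F(3) Suc.prems(2) c by simp
  note IH = Suc.IH[OF F(1) len js(2)]
  have "colword (take m s @ drop m s) \<approx> colword (take m c' @ drop m c')"
    using F(5) by simp
  then have "colword (drop m s) \<approx> colword (drop m c')"
    by (rule knuth_colword_suffix) (use F(3) in simp)
  then have k: "colword (drop (Suc m) c) \<approx> colword q"
    using IH knuth_trans by (auto simp: c)
  have asc: "c ! i < c ! Suc i \<longleftrightarrow> js ! Suc i < js ! i" if im: "Suc i < Suc m" for i
  proof (cases i)
    case 0
    then obtain m' where m: "m = Suc m'" using im by (cases m) auto
    obtain x r where s: "s = x # r" using F(3) len m by (cases s) auto
    obtain d i' where d: "slide [] 0 (tl c') = (d, i')" by fastforce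
    then obtain js'' where "js' = i' # js''" using js(2) m by (cases "rectify m' d") auto
    then show ?thesis
      using first_two_slides[of x r c' j d i'] Suc.prems(1) sl d 0 by (simp add: c s js(1))
  next
    case (Suc i')
    have "s ! i' < s ! Suc i' \<longleftrightarrow> c' ! i' < c' ! Suc i'"
      by (rule knuth_colword_ascents[OF F(5)]) (use F(3) len im Suc in auto)
    then show ?thesis using IH im Suc by (simp add: c js(1))
  qed
  show ?case using IH F k asc js(1) by (simp add: c)
qed simp

lemma rectify_inj:
  "admissible [] c \<Longrightarrow> admissible [] c' \<Longrightarrow> length c = length c' \<Longrightarrow> m \<le> length c \<Longrightarrow> rectify m c = rectify m c' \<Longrightarrow> c = c'"
proof (induction m arbitrary: c c')
  case (Suc m)
  obtain s s' where c: "c = 0 # s" "c' = 0 # s'"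
    using Suc.prems(1-4) by (cases c; cases c') (auto simp: admissible_Nil_Cons simp del: admissible.simps)
  obtain d j d' j' where sl: "slide [] 0 s = (d, j)" "slide [] 0 s' = (d', j')" by (metis surj_pair)
  note F = first_slide[OF Suc.prems(1)[unfolded c] sl(1)]
  note F' = first_slide[OF Suc.prems(2)[unfolded c] sl(2)]
  have eq: "apsnd (Cons j) (rectify m d) = apsnd (Cons j') (rectify m d')"
    using Suc.prems(5) c sl by simp
  then have "j = j'" "rectify m d = rectify m d'"
    by (cases "rectify m d"; cases "rectify m d'"; simp)+
  then have "d = d'" using Suc.IH[OF F(1) F'(1)] F(3) F'(3) Suc.prems(3,4) c by simp
  then have "slide [] 0 s = slide [] 0 s'" using sl \<open>j = j'\<close> by simp
  then have "s = s'"
    by (intro slide_inj[of 0 "[]"]) (use Suc.prems(1,2) c in \<open>auto simp: admissible_Nil_Cons addable_def simp del: admissible.simps\<close>)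
  then show ?case using c by simp
qed simp

lemma rectify_surj:
  "admissible [] q \<Longrightarrow> outers_ok js (walk [] q) \<Longrightarrow>
    \<exists>c. admissible [] c \<and> length c = length js + length q \<and> rectify (length js) c = (q, js)"
proof (induction js)
  case (Cons j js)
  then obtain c where c: "admissible [] c" "length c = length js + length q" "rectify (length js) c = (q, js)"
    by auto
  have "addable j (walk [] c)"
    using rectify_correct[OF c(1,2,3)] Cons.prems(2) by simp
  then obtain s where s: "admissible (outer 0 []) s" "slide [] 0 s = (c, j)"
    using slide_surj[OF c(1)] by blast
  then have "admissible [] (0 # s)" by (simp add: admissible_Nil_Cons del: admissible.simps)
  then show ?case
    using first_slide(3)[of s c j] s(2) c by (intro exI[of _ "0 # s"]) simp
qed auto

section \<open>Counting words by C-shape and descents\<close>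

fun blocks_ok :: "nat list \<Rightarrow> (nat \<Rightarrow> bool) \<Rightarrow> bool" where
  "blocks_ok [] A \<longleftrightarrow> True"
| "blocks_ok (e # \<epsilon>) A \<longleftrightarrow> blocks_ok \<epsilon> A \<and> (\<forall>i. sum_list \<epsilon> \<le> i \<and> Suc i < sum_list \<epsilon> + e \<longrightarrow> A i)"

text \<open>The words of the standardizations of semistandard tableaux of content \<open>\<epsilon>\<close>: equal entries become
  a strictly increasing block of columns. Large entries come first in a word, hence the last part of
  \<open>\<epsilon>\<close> belongs to the first block.\<close>

definition block_increasing :: "nat list \<Rightarrow> nat list \<Rightarrow> bool"
  where "block_increasing \<epsilon> c \<longleftrightarrow> length c = sum_list \<epsilon> \<and> blocks_ok \<epsilon> (\<lambda>i. c ! i < c ! Suc i)"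

lemma blocks_ok_cong:
  "(\<And>i. Suc i < sum_list \<epsilon> \<Longrightarrow> A i = B i) \<Longrightarrow> blocks_ok \<epsilon> A = blocks_ok \<epsilon> B"
proof (induction \<epsilon>)
  case (Cons e \<epsilon>)
  have "blocks_ok \<epsilon> A = blocks_ok \<epsilon> B"
    by (rule Cons.IH) (rule Cons.prems, simp)
  moreover have "(\<forall>i. sum_list \<epsilon> \<le> i \<and> Suc i < sum_list \<epsilon> + e \<longrightarrow> A i) =
      (\<forall>i. sum_list \<epsilon> \<le> i \<and> Suc i < sum_list \<epsilon> + e \<longrightarrow> B i)"
    using Cons.prems by (metis add.commute sum_list.Cons)
  ultimately show ?case by simp
qed simp

lemma blocks_ok_append:
  "blocks_ok (\<delta> @ \<epsilon>) A \<longleftrightarrow> blocks_ok \<epsilon> A \<and> blocks_ok \<delta> (\<lambda>i. A (i + sum_list \<epsilon>))"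
proof (induction \<delta>)
  case (Cons d \<delta>)
  have "(\<forall>i. sum_list \<delta> + sum_list \<epsilon> \<le> i \<and> Suc i < sum_list \<delta> + sum_list \<epsilon> + d \<longrightarrow> A i) \<longleftrightarrow>
    (\<forall>i. sum_list \<delta> \<le> i \<and> Suc i < sum_list \<delta> + d \<longrightarrow> A (i + sum_list \<epsilon>))" (is "?L \<longleftrightarrow> ?R")
  proof
    assume ?R
    show ?L
    proof (intro allI impI)
      fix i assume i: "sum_list \<delta> + sum_list \<epsilon> \<le> i \<and> Suc i < sum_list \<delta> + sum_list \<epsilon> + d"
      then have "A (i - sum_list \<epsilon> + sum_list \<epsilon>)" by (intro \<open>?R\<close>[rule_format]) auto
      then show "A i" using i by simp
    qed
  qed auto
  then show ?case using Cons by auto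
qed simp

lemma block_increasing_append:
  "block_increasing (\<delta> @ \<epsilon>) c \<longleftrightarrow>
    length c = sum_list \<epsilon> + sum_list \<delta> \<and> block_increasing \<epsilon> (take (sum_list \<epsilon>) c) \<and> block_increasing \<delta> (drop (sum_list \<epsilon>) c)"
proof (cases "length c = sum_list \<epsilon> + sum_list \<delta>")
  case True
  have 1: "blocks_ok \<epsilon> (\<lambda>i. c ! i < c ! Suc i) =
      blocks_ok \<epsilon> (\<lambda>i. take (sum_list \<epsilon>) c ! i < take (sum_list \<epsilon>) c ! Suc i)"
    by (rule blocks_ok_cong) simp
  have 2: "blocks_ok \<delta> (\<lambda>i. c ! (i + sum_list \<epsilon>) < c ! Suc (i + sum_list \<epsilon>)) =
      blocks_ok \<delta> (\<lambda>i. drop (sum_list \<epsilon>) c ! i < drop (sum_list \<epsilon>) c ! Suc i)"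
    by (rule blocks_ok_cong) (use True in \<open>simp add: add.commute\<close>)
  show ?thesis
    using True by (simp add: block_increasing_def blocks_ok_append 1 2)
next
  case False
  then show ?thesis by (auto simp: block_increasing_def)
qed

text \<open>Yamanouchi words of length \<open>n\<close>: the words of standard reverse tableaux.\<close>

definition Yam :: "nat \<Rightarrow> nat list set"
  where "Yam n = {c. admissible [] c \<and> length c = n}"

definition words_to :: "nat list \<Rightarrow> nat \<Rightarrow> nat list \<Rightarrow> nat list set"
  where "words_to \<beta> n \<alpha> = {s. length s = n \<and> admissible \<beta> s \<and> walk \<beta> s = \<alpha>}"

text \<open>These are the coefficients of the quasisymmetric Schur functions (\<open>coeff_qschur\<close>).\<close>

definition kostka :: "nat list \<Rightarrow> nat list \<Rightarrow> nat"
  where "kostka \<beta> \<epsilon> = card {c. admissible [] c \<and> walk [] c = \<beta> \<and> block_increasing \<epsilon> c}"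

text \<open>The number of skew tableaux that lead from C-shape \<open>\<beta>\<close> to C-shape \<open>\<alpha>\<close> and rectify to the tableau of
  the word \<open>q\<close>; these turn out to be noncommutative Littlewood--Richardson coefficients.\<close>

definition lr :: "nat list \<Rightarrow> nat list \<Rightarrow> nat list \<Rightarrow> nat"
  where "lr \<beta> q \<alpha> = card {s \<in> words_to \<beta> (length q) \<alpha>. P_tableau (colword s) = tab q}"

definition Comp :: "nat \<Rightarrow> nat list set"
  where "Comp n = {\<alpha>. is_composition \<alpha> \<and> sum_list \<alpha> = n}"

lemma finite_Comp: "finite (Comp n)"
  by (rule finite_subset[OF _ finite_compositions_le[of n]]) (auto simp: Comp_def)

lemma admissible_bound: "admissible [] c \<Longrightarrow> x \<in> set c \<Longrightarrow> x < length c"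
proof (induction c arbitrary: x rule: rev_induct)
  case (snoc y c)
  have "y \<le> length c"
  proof (cases "y = 0")
    case False
    then have "0 < height (walk [] c) (y - 1)"
      using snoc.prems(1) by (auto simp: admissible_append addable_iff_height)
    then have "y - 1 \<in> set c"
      using height_walk[of "[]" c] snoc.prems(1) by (simp add: admissible_append in_set_iff_count)
    then have "y - 1 < length c" using snoc by (simp add: admissible_append)
    then show ?thesis by simp
  qed simp
  then show ?case using snoc by (auto simp: admissible_append less_Suc_eq)
qed simp

lemma finite_Yam: "finite (Yam n)"
proof (rule finite_subset)
  show "Yam n \<subseteq> {c. set c \<subseteq> {..<n} \<and> length c = n}"
    using admissible_bound by (auto simp: Yam_def)
qed (simp add: finite_lists_length_eq)

lemma walk_Comp: "c \<in> Yam n \<Longrightarrow> walk [] c \<in> Comp n"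
  using pos_walk[of "[]" c] sum_list_walk[of "[]" c] by (auto simp: Yam_def Comp_def is_composition_def)

lemma P_tableau_rectify:
  assumes "admissible [] c" "length c = m + n" "rectify m c = (q', js)" "admissible [] q"
  shows "P_tableau (colword (drop m c)) = tab q \<longleftrightarrow> q' = q"
proof -
  note F = rectify_correct[OF assms(1-3)]
  have "P_tableau (colword (drop m c)) = P_tableau (colword q')"
    unfolding P_tableau_def using P_rows_knuth[of "colword (drop m c)" "colword q'"] F by simp
  also have "\<dots> = tab q'" using F P_tableau_colword by simp
  finally show ?thesis using word_tab[of q] word_tab[of q'] assms(4) F by metis
qed

text \<open>Rectification is a bijection onto the pairs of \<open>q\<close> and a valid list of columns. The right-hand
  side contains \<open>q\<close> only in the form \<open>walk [] q\<close>.\<close>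

lemma card_rectifying_to:
  assumes q: "admissible [] q" "length q = n" and \<epsilon>: "sum_list \<epsilon> = m"
  shows "card {c \<in> Yam (m + n). walk [] c = \<alpha> \<and> P_tableau (colword (drop m c)) = tab q \<and> blocks_ok \<epsilon> (\<lambda>i. c ! i < c ! Suc i)} =
    card {js. length js = m \<and> outers_ok js (walk [] q) \<and> outers js (walk [] q) = \<alpha> \<and>
      blocks_ok \<epsilon> (\<lambda>i. js ! Suc i < js ! i)}" (is "card ?A = card ?B")
proof (rule bij_betw_same_card)
  have R: "fst (rectify m c) = q" if "c \<in> ?A" for c
    using P_tableau_rectify[of c m n "fst (rectify m c)" "snd (rectify m c)" q] that q by (auto simp: Yam_def)
  have blk: "blocks_ok \<epsilon> (\<lambda>i. c ! i < c ! Suc i) = blocks_ok \<epsilon> (\<lambda>i. js ! Suc i < js ! i)"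
    if "c \<in> Yam (m + n)" "rectify m c = (q, js)" for c js
    by (rule blocks_ok_cong) (use rectify_correct[of c m n q js] that \<epsilon> in \<open>auto simp: Yam_def\<close>)
  show "bij_betw (\<lambda>c. snd (rectify m c)) ?A ?B"
    unfolding bij_betw_def
  proof
    show "inj_on (\<lambda>c. snd (rectify m c)) ?A"
    proof (rule inj_onI)
      fix c c' assume *: "c \<in> ?A" "c' \<in> ?A" "snd (rectify m c) = snd (rectify m c')"
      then have "rectify m c = rectify m c'" using R[of c] R[of c'] by (intro prod_eqI) simp_all
      then show "c = c'" by (intro rectify_inj) (use * in \<open>auto simp: Yam_def\<close>)
    qed
    show "(\<lambda>c. snd (rectify m c)) ` ?A = ?B"
    proof
      show "(\<lambda>c. snd (rectify m c)) ` ?A \<subseteq> ?B"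
      proof clarify
        fix c assume c: "c \<in> Yam (m + n)" "P_tableau (colword (drop m c)) = tab q"
          "blocks_ok \<epsilon> (\<lambda>i. c ! i < c ! Suc i)" "\<alpha> = walk [] c"
        have "fst (rectify m c) = q" by (rule R) (use c in auto)
        then obtain js where r: "rectify m c = (q, js)" by (cases "rectify m c") auto
        show "length (snd (rectify m c)) = m \<and> outers_ok (snd (rectify m c)) (walk [] q) \<and>
          outers (snd (rectify m c)) (walk [] q) = walk [] c \<and> blocks_ok \<epsilon> (\<lambda>i. snd (rectify m c) ! Suc i < snd (rectify m c) ! i)"
          using rectify_correct[OF _ _ r, of n] c blk[OF c(1) r] by (simp add: Yam_def r)
      qed
      show "?B \<subseteq> (\<lambda>c. snd (rectify m c)) ` ?A"
      proof
        fix js assume js: "js \<in> ?B"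
        then obtain c where c: "admissible [] c" "length c = m + n" "rectify m c = (q, js)"
          using rectify_surj[OF q(1), of js] q(2) by auto
        have "c \<in> ?A"
          using rectify_correct[OF c] c js blk[of c js] P_tableau_rectify[OF c q(1)] by (simp add: Yam_def)
        then show "js \<in> (\<lambda>c. snd (rectify m c)) ` ?A" using c(3) by (intro image_eqI[of _ _ c]) auto
      qed
    qed
  qed
qed

lemma block_increasing_take:
  "length c = m + n \<Longrightarrow> sum_list \<epsilon> = m \<Longrightarrow> block_increasing \<epsilon> (take m c) = blocks_ok \<epsilon> (\<lambda>i. c ! i < c ! Suc i)"
  unfolding block_increasing_def by (auto intro!: blocks_ok_cong)

lemma card_disjoint_sum:
  assumes "finite I" "\<And>i. i \<in> I \<Longrightarrow> finite (A i)" "\<And>i j x. i \<in> I \<Longrightarrow> j \<in> I \<Longrightarrow> x \<in> A i \<Longrightarrow> x \<in> A j \<Longrightarrow> i = j"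
  shows "card (\<Union>i\<in>I. A i) = (\<Sum>i\<in>I. card (A i))"
  using assms by (intro card_UN_disjoint) auto

text \<open>The word is cut after its \<open>m\<close> largest entries, and the cuts are sorted by the C-shape \<open>\<beta>\<close>
  that is reached there.\<close>

lemma card_split:
  assumes \<epsilon>: "sum_list \<epsilon> = m"
  shows "card {c \<in> Yam (m + n). walk [] c = \<alpha> \<and> block_increasing \<epsilon> (take m c) \<and> Q (drop m c)} =
    (\<Sum>\<beta>\<in>Comp m. kostka \<beta> \<epsilon> * card {s \<in> words_to \<beta> n \<alpha>. Q s})"
proof -
  let ?C = "\<lambda>\<beta>. {c. admissible [] c \<and> walk [] c = \<beta> \<and> block_increasing \<epsilon> c}"
  let ?S = "\<lambda>\<beta>. {s \<in> words_to \<beta> n \<alpha>. Q s}"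
  let ?A = "{c \<in> Yam (m + n). walk [] c = \<alpha> \<and> block_increasing \<epsilon> (take m c) \<and> Q (drop m c)}"
  have len: "length c = m" if "block_increasing \<epsilon> c" for c using that \<epsilon> by (simp add: block_increasing_def)
  have "?A = (\<Union>\<beta>\<in>Comp m. (\<lambda>(c, s). c @ s) ` (?C \<beta> \<times> ?S \<beta>))"
  proof (intro equalityI subsetI)
    fix c assume c: "c \<in> ?A"
    have adm: "admissible [] (take m c @ drop m c)" using c by (simp add: Yam_def)
    then have "take m c \<in> Yam m" using c unfolding admissible_append by (simp add: Yam_def)
    then have 1: "walk [] (take m c) \<in> Comp m" by (rule walk_Comp)
    have "walk [] (take m c @ drop m c) = \<alpha>" using c by simp
    then have "walk (walk [] (take m c)) (drop m c) = \<alpha>" by (simp only: fold_append o_apply)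
    then have "take m c \<in> ?C (walk [] (take m c))" "drop m c \<in> ?S (walk [] (take m c))"
      using c adm unfolding admissible_append by (simp_all add: words_to_def Yam_def)
    then have "(\<lambda>(c, s). c @ s) (take m c, drop m c) \<in>
        (\<lambda>(c, s). c @ s) ` (?C (walk [] (take m c)) \<times> ?S (walk [] (take m c)))"
      by (intro imageI SigmaI)
    then have "c \<in> (\<lambda>(c, s). c @ s) ` (?C (walk [] (take m c)) \<times> ?S (walk [] (take m c)))"
      by (simp only: prod.case append_take_drop_id)
    then show "c \<in> (\<Union>\<beta>\<in>Comp m. (\<lambda>(c, s). c @ s) ` (?C \<beta> \<times> ?S \<beta>))"
      using 1 by blast
  next
    fix c assume "c \<in> (\<Union>\<beta>\<in>Comp m. (\<lambda>(c, s). c @ s) ` (?C \<beta> \<times> ?S \<beta>))"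
    then show "c \<in> ?A" using len by (auto simp: Yam_def words_to_def admissible_append)
  qed
  moreover have fin: "finite ((\<lambda>(c, s). c @ s) ` (?C \<beta> \<times> ?S \<beta>))" for \<beta>
  proof (rule finite_subset)
    show "(\<lambda>(c, s). c @ s) ` (?C \<beta> \<times> ?S \<beta>) \<subseteq> Yam (m + n)"
      using len by (auto simp: Yam_def words_to_def admissible_append)
  qed (rule finite_Yam)
  have "card (\<Union>\<beta>\<in>Comp m. (\<lambda>(c, s). c @ s) ` (?C \<beta> \<times> ?S \<beta>)) =
      (\<Sum>\<beta>\<in>Comp m. card ((\<lambda>(c, s). c @ s) ` (?C \<beta> \<times> ?S \<beta>)))"
  proof (rule card_disjoint_sum[OF finite_Comp fin])
    fix i j x assume x: "x \<in> (\<lambda>(c, s). c @ s) ` (?C i \<times> ?S i)" "x \<in> (\<lambda>(c, s). c @ s) ` (?C j \<times> ?S j)"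
    obtain c s where 1: "c \<in> ?C i" "x = c @ s" using x(1) by auto
    obtain c' s' where 2: "c' \<in> ?C j" "x = c' @ s'" using x(2) by auto
    have "length c = length c'" using 1(1) 2(1) len[of c] len[of c'] by simp
    then have "c = c'" using 1(2) 2(2) append_eq_append_conv by metis
    then show "i = j" using 1(1) 2(1) by simp
  qed
  moreover have "card ((\<lambda>(c, s). c @ s) ` (?C \<beta> \<times> ?S \<beta>)) = kostka \<beta> \<epsilon> * card (?S \<beta>)" for \<beta>
  proof -
    have "inj_on (\<lambda>(c, s). c @ s) (?C \<beta> \<times> ?S \<beta>)"
    proof (rule inj_onI)
      fix x y assume *: "x \<in> ?C \<beta> \<times> ?S \<beta>" "y \<in> ?C \<beta> \<times> ?S \<beta>" "(\<lambda>(c, s). c @ s) x = (\<lambda>(c, s). c @ s) y"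
      have "length (fst x) = m" "length (fst y) = m"
        by (rule len; use *(1,2) in \<open>simp add: mem_Times_iff\<close>)+
      moreover have "fst x @ snd x = fst y @ snd y" using *(3) by (simp add: case_prod_unfold)
      ultimately show "x = y" by (metis append_eq_append_conv prod_eqI)
    qed
    then show ?thesis by (simp add: card_image card_cartesian_product kostka_def)
  qed
  ultimately show ?thesis by simp
qed

text \<open>Both sides count the same lists of columns.\<close>

lemma lr_sum_cong:
  assumes "q \<in> Yam n" "q' \<in> Yam n" "walk [] q = walk [] q'" "\<epsilon> \<in> Comp m"
  shows "(\<Sum>\<beta>\<in>Comp m. kostka \<beta> \<epsilon> * lr \<beta> q \<alpha>) = (\<Sum>\<beta>\<in>Comp m. kostka \<beta> \<epsilon> * lr \<beta> q' \<alpha>)"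
proof -
  have \<epsilon>: "sum_list \<epsilon> = m" using assms(4) by (simp add: Comp_def)
  have *: "(\<Sum>\<beta>\<in>Comp m. kostka \<beta> \<epsilon> * lr \<beta> q \<alpha>) =
    card {js. length js = m \<and> outers_ok js (walk [] q) \<and> outers js (walk [] q) = \<alpha> \<and>
      blocks_ok \<epsilon> (\<lambda>i. js ! Suc i < js ! i)}" if "q \<in> Yam n" for q
  proof -
    have q: "admissible [] q" "length q = n" using that by (auto simp: Yam_def)
    have "(\<Sum>\<beta>\<in>Comp m. kostka \<beta> \<epsilon> * lr \<beta> q \<alpha>) =
      card {c \<in> Yam (m + n). walk [] c = \<alpha> \<and> block_increasing \<epsilon> (take m c) \<and> P_tableau (colword (drop m c)) = tab q}"
      unfolding lr_def q(2) by (rule card_split[OF \<epsilon>, symmetric])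
    also have "{c \<in> Yam (m + n). walk [] c = \<alpha> \<and> block_increasing \<epsilon> (take m c) \<and> P_tableau (colword (drop m c)) = tab q} =
      {c \<in> Yam (m + n). walk [] c = \<alpha> \<and> P_tableau (colword (drop m c)) = tab q \<and> blocks_ok \<epsilon> (\<lambda>i. c ! i < c ! Suc i)}"
      using block_increasing_take[OF _ \<epsilon>] by (auto simp: Yam_def)
    finally show ?thesis using card_rectifying_to[OF q \<epsilon>] by simp
  qed
  show ?thesis using *[OF assms(1)] *[OF assms(2)] assms(3) by simp
qed

section \<open>Triangularity of the Kostka numbers\<close>

text \<open>Cells are added to the highest possible row, so a last row that never grows does not influence
  the rest of the walk.\<close>

lemma bottom_row_mono:
  "admissible (\<delta> @ [a]) c \<Longrightarrow> \<exists>\<delta>' b. walk (\<delta> @ [a]) c = \<delta>' @ [b] \<and> a \<le> b \<and>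
    (a = b \<longrightarrow> admissible \<delta> c \<and> walk \<delta> c = \<delta>')"
proof (induction c arbitrary: \<delta> a)
  case (Cons j c)
  show ?case
  proof (cases "addable j \<delta>")
    case True
    then have "up j (\<delta> @ [a]) = up j \<delta> @ [a]" by (rule up_append)
    then show ?thesis using Cons.IH[of "up j \<delta>" a] Cons.prems True by auto
  next
    case False
    then have "j = a" "up j (\<delta> @ [a]) = \<delta> @ [Suc a]"
      using Cons.prems by (auto simp: addable_def up_def raise_append)
    then show ?thesis using Cons.IH[of \<delta> "Suc a"] Cons.prems by fastforce
  qed
qed simp

lemma walk_above_row:
  "admissible \<delta> c \<Longrightarrow> admissible (\<delta> @ [a]) c \<and> walk (\<delta> @ [a]) c = walk \<delta> c @ [a]"
  by (induction c arbitrary: \<delta>) (auto simp: up_append addable_def)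

text \<open>Nothing but the row \<open>0, 1, ..., a - 1\<close> can be a strictly increasing walk from the empty
  composition.\<close>

lemma first_block:
  assumes "0 < a"
  shows "admissible [] c \<and> block_increasing [a] c \<longleftrightarrow> c = [0..<a]"
    "walk [] [0..<a] = [a]" "admissible [] [0..<a]"
proof -
  have w: "admissible [] [0..<Suc n] \<and> walk [] [0..<Suc n] = [Suc n]" for n
  proof (induction n)
    case (Suc n)
    have e: "[0..<Suc (Suc n)] = [0..<Suc n] @ [Suc n]" by simp
    have "up (Suc n) [Suc n] = [Suc (Suc n)]" "addable (Suc n) [Suc n]"
      by (simp_all add: up_def addable_def)
    then show ?case using Suc unfolding e by (simp add: admissible_append del: upt_Suc)
  qed (simp add: addable_def up_def)
  show 1: "walk [] [0..<a] = [a]" and 2: "admissible [] [0..<a]"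
    using w[of "a - 1"] assms by simp_all
  show "admissible [] c \<and> block_increasing [a] c \<longleftrightarrow> c = [0..<a]"
  proof
    assume c: "admissible [] c \<and> block_increasing [a] c"
    then have len: "length c = a" and asc: "\<And>i. Suc i < a \<Longrightarrow> c ! i < c ! Suc i"
      by (auto simp: block_increasing_def)
    have "c ! i = i" if "i < a" for i
      using that
    proof (induction i)
      case 0
      then show ?case using c len by (cases c) (auto simp: admissible_Nil_Cons simp del: admissible.simps)
    next
      case (Suc i)
      have "admissible [] (take (Suc (Suc i)) c)"
        using c by (metis admissible_append append_take_drop_id)
      then have "c ! Suc i < Suc (Suc i)"
        using admissible_bound[of "take (Suc (Suc i)) c" "c ! Suc i"] Suc.prems len
        by (auto simp: take_Suc_conv_app_nth)
      then show ?case using asc[of i] Suc by simp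
    qed
    then show "c = [0..<a]" using len by (intro nth_equalityI) auto
  next
    assume "c = [0..<a]"
    then show "admissible [] c \<and> block_increasing [a] c" using 2 by (auto simp: block_increasing_def)
  qed
qed

text \<open>The last part of the content is used up first and creates the last row, whose length can only
  increase afterwards. If it does not increase, the rest of the word is an independent walk.\<close>

lemma kostka_last:
  assumes "0 < a"
  shows "b < a \<Longrightarrow> kostka (\<beta> @ [b]) (\<epsilon> @ [a]) = 0"
    "kostka (\<beta> @ [a]) (\<epsilon> @ [a]) = kostka \<beta> \<epsilon>"
    "kostka [] (\<epsilon> @ [a]) = 0"
proof -
  let ?S = "\<lambda>\<beta>. {c. admissible [] c \<and> walk [] c = \<beta> \<and> block_increasing (\<epsilon> @ [a]) c}"
  have iff: "admissible [] c \<and> block_increasing (\<epsilon> @ [a]) c \<longleftrightarrow>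
    (\<exists>d. c = [0..<a] @ d \<and> admissible [a] d \<and> block_increasing \<epsilon> d)" for c
  proof
    assume c: "admissible [] c \<and> block_increasing (\<epsilon> @ [a]) c"
    then have "admissible [] (take a c @ drop a c)" by simp
    then have adm: "admissible [] (take a c)" "admissible (walk [] (take a c)) (drop a c)"
      unfolding admissible_append by simp_all
    have inc: "block_increasing [a] (take a c)" "block_increasing \<epsilon> (drop a c)"
      using c by (simp_all add: block_increasing_append)
    have t: "take a c = [0..<a]" using adm(1) inc(1) first_block(1)[OF assms] by blast
    then have "admissible [a] (drop a c)" using adm(2) first_block(2)[OF assms] by simp
    moreover have "c = [0..<a] @ drop a c" using t append_take_drop_id[of a c] by simp
    ultimately show "\<exists>d. c = [0..<a] @ d \<and> admissible [a] d \<and> block_increasing \<epsilon> d"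
      using inc(2) by blast
  next
    assume "\<exists>d. c = [0..<a] @ d \<and> admissible [a] d \<and> block_increasing \<epsilon> d"
    then obtain d where d: "c = [0..<a] @ d" "admissible [a] d" "block_increasing \<epsilon> d" by blast
    have "block_increasing [a] [0..<a]" using first_block(1)[OF assms, of "[0..<a]"] by simp
    moreover have "length d = sum_list \<epsilon>" using d(3) by (simp add: block_increasing_def)
    ultimately show "admissible [] c \<and> block_increasing (\<epsilon> @ [a]) c"
      using d first_block(2,3)[OF assms] by (simp add: admissible_append block_increasing_append)
  qed
  have walk: "walk [] ([0..<a] @ d) = walk [a] d" for d
    using first_block(2)[OF assms] by simp
  have bot: "\<exists>\<delta>' b. walk [a] d = \<delta>' @ [b] \<and> a \<le> b \<and> (a = b \<longrightarrow> admissible [] d \<and> walk [] d = \<delta>')"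
    if "admissible [a] d" for d
    using bottom_row_mono[of "[]" a d] that by simp
  have ge: "\<exists>\<delta> b. \<gamma> = \<delta> @ [b] \<and> a \<le> b" if c: "c \<in> ?S \<gamma>" for c \<gamma>
  proof -
    obtain d where d: "c = [0..<a] @ d" "admissible [a] d" using c iff[of c] by blast
    have "\<gamma> = walk [] c" using c by simp
    also have "\<dots> = walk [a] d" unfolding d(1) by (rule walk)
    finally show ?thesis using bot[OF d(2)] by blast
  qed
  show "kostka (\<beta> @ [b]) (\<epsilon> @ [a]) = 0" if "b < a"
  proof -
    have "?S (\<beta> @ [b]) = {}" using ge[of _ "\<beta> @ [b]"] that by force
    then show ?thesis unfolding kostka_def by (simp only: card.empty)
  qed
  show "kostka [] (\<epsilon> @ [a]) = 0"
  proof -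
    have "?S [] = {}" using ge[of _ "[]"] by blast
    then show ?thesis unfolding kostka_def by (simp only: card.empty)
  qed
  have "?S (\<beta> @ [a]) = (\<lambda>d. [0..<a] @ d) ` {d. admissible [] d \<and> walk [] d = \<beta> \<and> block_increasing \<epsilon> d}"
  proof (intro equalityI subsetI)
    fix c assume "c \<in> ?S (\<beta> @ [a])"
    then have c: "admissible [] c \<and> block_increasing (\<epsilon> @ [a]) c" "walk [] c = \<beta> @ [a]" by simp_all
    then obtain d where d: "c = [0..<a] @ d" "admissible [a] d" "block_increasing \<epsilon> d"
      using iff[of c] by blast
    have "walk [a] d = \<beta> @ [a]" using c(2) walk[of d] unfolding d(1) by simp
    then have "d \<in> {d. admissible [] d \<and> walk [] d = \<beta> \<and> block_increasing \<epsilon> d}"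
      using bot[OF d(2)] d(3) by auto
    then show "c \<in> (\<lambda>d. [0..<a] @ d) ` {d. admissible [] d \<and> walk [] d = \<beta> \<and> block_increasing \<epsilon> d}"
      unfolding d(1) by (rule imageI)
  next
    fix c assume "c \<in> (\<lambda>d. [0..<a] @ d) ` {d. admissible [] d \<and> walk [] d = \<beta> \<and> block_increasing \<epsilon> d}"
    then obtain d where d: "c = [0..<a] @ d" "admissible [] d" "walk [] d = \<beta>" "block_increasing \<epsilon> d" by blast
    then have "admissible [] c \<and> block_increasing (\<epsilon> @ [a]) c"
      using walk_above_row[of "[]" d a] iff[of c] by simp
    moreover have "walk [] c = \<beta> @ [a]"
      using walk_above_row[of "[]" d a] walk[of d] d by simp
    ultimately show "c \<in> ?S (\<beta> @ [a])" by simp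
  qed
  then show "kostka (\<beta> @ [a]) (\<epsilon> @ [a]) = kostka \<beta> \<epsilon>"
    unfolding kostka_def by (simp add: card_image inj_on_def)
qed

lemma kostka_Nil: "kostka \<beta> [] = (if \<beta> = [] then 1 else 0)"
proof -
  have "{c. admissible [] c \<and> walk [] c = \<beta> \<and> block_increasing [] c} = (if \<beta> = [] then {[]} else {})"
    by (auto simp: block_increasing_def)
  then show ?thesis by (simp add: kostka_def)
qed

lemma kostka_same: "is_composition \<epsilon> \<Longrightarrow> kostka \<epsilon> \<epsilon> = 1"
  by (induction \<epsilon> rule: rev_induct) (auto simp: kostka_Nil is_composition_def kostka_last(2))

text \<open>The last parts are compared first, as they are the first to be used up (\<open>kostka_last\<close>).\<close>

definition revlex :: "(nat list \<times> nat list) set"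
  where "revlex = {(\<epsilon>, \<beta>). (rev \<epsilon>, rev \<beta>) \<in> lexord {(a, b). a < b}}"

lemma kostka_triangular:
  "is_composition \<epsilon> \<Longrightarrow> is_composition \<beta> \<Longrightarrow> kostka \<beta> \<epsilon> \<noteq> 0 \<Longrightarrow> \<epsilon> = \<beta> \<or> (\<epsilon>, \<beta>) \<in> revlex"
proof (induction \<epsilon> arbitrary: \<beta> rule: rev_induct)
  case Nil
  then show ?case by (auto simp: kostka_Nil split: if_splits)
next
  case (snoc a \<epsilon>)
  have a: "0 < a" using snoc.prems(1) by (auto simp: is_composition_def)
  obtain \<beta>' b where \<beta>: "\<beta> = \<beta>' @ [b]"
    using snoc.prems(3) kostka_last(3)[OF a] by (cases \<beta> rule: rev_cases) auto
  have "\<not> b < a" using snoc.prems(3) kostka_last(1)[OF a] \<beta> by auto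
  then consider "a < b" | "a = b" by linarith
  then show ?case
  proof cases
    case 1
    then show ?thesis by (simp add: revlex_def \<beta>)
  next
    case 2
    then have "kostka \<beta>' \<epsilon> \<noteq> 0" using snoc.prems(3) kostka_last(2)[OF a] \<beta> by simp
    then have "\<epsilon> = \<beta>' \<or> (\<epsilon>, \<beta>') \<in> revlex"
      using snoc.IH[of \<beta>'] snoc.prems(1,2) \<beta> by (auto simp: is_composition_def)
    then show ?thesis using 2 by (auto simp: revlex_def \<beta>)
  qed
qed

lemma kostka_size: "kostka \<beta> \<epsilon> \<noteq> 0 \<Longrightarrow> sum_list \<beta> = sum_list \<epsilon> \<and> is_composition \<beta>"
proof -
  assume "kostka \<beta> \<epsilon> \<noteq> 0"
  then have "{c. admissible [] c \<and> walk [] c = \<beta> \<and> block_increasing \<epsilon> c} \<noteq> {}" unfolding kostka_def by force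
  then show ?thesis using sum_list_walk[of "[]"] pos_walk[of "[]"]
    by (auto simp: block_increasing_def is_composition_def)
qed

lemma acyclic_revlex: "acyclic (revlex \<inter> (A \<times> A))"
proof -
  have "trans revlex"
    unfolding revlex_def trans_def
    by (auto intro: lexord_trans[where r = "{(a, b). a < b}"] simp: trans_def)
  moreover have "irrefl revlex"
    using lexord_irreflexive[of "{(a, b). a < (b::nat)}"] by (auto simp: revlex_def irrefl_def)
  ultimately have "acyclic revlex" by (simp add: acyclic_irrefl)
  then show ?thesis by (rule acyclic_subset) auto
qed

text \<open>Look at a composition that is maximal in the support of \<open>x\<close>: by triangularity its equation
  involves no other member of the support.\<close>

lemma kostka_injective:
  fixes x :: "nat list \<Rightarrow> rat"
  assumes "\<And>\<epsilon>. \<epsilon> \<in> Comp n \<Longrightarrow> (\<Sum>\<beta>\<in>Comp n. of_nat (kostka \<beta> \<epsilon>) * x \<beta>) = 0" "\<beta> \<in> Comp n"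
  shows "x \<beta> = 0"
proof -
  have w: "wf ((revlex \<inter> (Comp n \<times> Comp n))\<inverse>)"
    by (rule finite_acyclic_wf_converse) (auto intro: acyclic_revlex finite_subset[OF _ finite_cartesian_product[OF finite_Comp finite_Comp]])
  show ?thesis
    using assms(2)
  proof (induction \<beta> rule: wf_induct[OF w])
    case (1 \<beta>)
    have "of_nat (kostka \<gamma> \<beta>) * x \<gamma> = (if \<gamma> = \<beta> then x \<beta> else 0)" if "\<gamma> \<in> Comp n" for \<gamma>
    proof (cases "\<gamma> = \<beta>")
      case True
      then show ?thesis using kostka_same 1(2) by (simp add: Comp_def)
    next
      case False
      then have "kostka \<gamma> \<beta> = 0 \<or> (\<beta>, \<gamma>) \<in> revlex"
        using kostka_triangular[of \<beta> \<gamma>] that 1(2) by (auto simp: Comp_def)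
      then show ?thesis using 1 that False by auto
    qed
    then have "(\<Sum>\<gamma>\<in>Comp n. of_nat (kostka \<gamma> \<beta>) * x \<gamma>) = (\<Sum>\<gamma>\<in>Comp n. if \<gamma> = \<beta> then x \<beta> else 0)"
      by (intro sum.cong) auto
    also have "\<dots> = x \<beta>" using 1(2) finite_Comp by simp
    finally show ?case using assms(1)[OF 1(2)] by simp
  qed
qed

text \<open>By \<open>lr_sum_cong\<close> the vectors \<open>lr \<beta> q \<alpha>\<close> and \<open>lr \<beta> q' \<alpha>\<close>, indexed by \<open>\<beta>\<close>, have the same image under
  the Kostka matrix, which is injective.\<close>

lemma lr_cong:
  assumes "q \<in> Yam n" "q' \<in> Yam n" "walk [] q = walk [] q'" "\<beta> \<in> Comp m"
  shows "lr \<beta> q \<alpha> = lr \<beta> q' \<alpha>"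
proof -
  have "(of_nat (lr \<beta> q \<alpha>) - of_nat (lr \<beta> q' \<alpha>) :: rat) = 0"
  proof (rule kostka_injective[OF _ assms(4)])
    fix \<epsilon> assume "\<epsilon> \<in> Comp m"
    from lr_sum_cong[OF assms(1-3) this, of \<alpha>]
    have "(\<Sum>\<beta>\<in>Comp m. of_nat (kostka \<beta> \<epsilon>) * of_nat (lr \<beta> q \<alpha>) :: rat) =
      (\<Sum>\<beta>\<in>Comp m. of_nat (kostka \<beta> \<epsilon>) * of_nat (lr \<beta> q' \<alpha>))"
      by (metis (no_types, lifting) of_nat_mult of_nat_sum sum.cong)
    then show "(\<Sum>\<beta>\<in>Comp m. of_nat (kostka \<beta> \<epsilon>) * (of_nat (lr \<beta> q \<alpha>) - of_nat (lr \<beta> q' \<alpha>)) :: rat) = 0"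
      by (simp add: right_diff_distrib sum_subtractf)
  qed
  then show ?thesis by simp
qed

section \<open>Kostka numbers count composition tableaux\<close>

text \<open>The entries of a filling of content \<open>\<epsilon>\<close> in decreasing order: the value \<open>i + 1\<close> occurs \<open>\<epsilon> ! i\<close>
  times.\<close>

fun vals :: "nat list \<Rightarrow> nat list" where
  "vals [] = []"
| "vals (e # \<epsilon>) = map Suc (vals \<epsilon>) @ replicate e 1"

definition strict :: "nat list \<Rightarrow> nat list \<Rightarrow> bool"
  where "strict vs c \<longleftrightarrow> (\<forall>i. Suc i < length vs \<and> vs ! i = vs ! Suc i \<longrightarrow> c ! i < c ! Suc i)"

lemma length_vals: "length (vals \<epsilon>) = sum_list \<epsilon>"
  by (induction \<epsilon>) auto

lemma vals_pos: "0 \<notin> set (vals \<epsilon>)"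
  by (induction \<epsilon>) auto

lemma sorted_vals: "sorted_wrt (\<ge>) (vals \<epsilon>)"
proof -
  have "sorted_wrt (\<ge>) (replicate e (Suc 0))" for e by (induction e) auto
  then show ?thesis by (induction \<epsilon>) (auto simp: sorted_wrt_append sorted_wrt_map)
qed

lemma count_vals: "count_list (vals \<epsilon>) (Suc i) = (if i < length \<epsilon> then \<epsilon> ! i else 0)"
proof (induction \<epsilon> arbitrary: i)
  case (Cons e \<epsilon>)
  have 1: "count_list (map Suc xs) (Suc i) = count_list xs i" for xs i
    by (induction xs) auto
  have 2: "count_list (replicate e (Suc 0)) (Suc i) = (if i = 0 then e else 0)" for i
    by (induction e) auto
  have 3: "count_list (vals \<epsilon>) 0 = 0" using vals_pos by (simp add: count_list_0_iff)
  show ?case using Cons by (cases i) (auto simp: 1 2 3)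
qed simp

lemma blocks_ok_vals:
  "blocks_ok \<epsilon> A \<longleftrightarrow> (\<forall>i. Suc i < sum_list \<epsilon> \<and> vals \<epsilon> ! i = vals \<epsilon> ! Suc i \<longrightarrow> A i)"
proof (induction \<epsilon>)
  case (Cons e \<epsilon>)
  let ?n = "sum_list \<epsilon>"
  have v: "vals (e # \<epsilon>) ! i = (if i < ?n then Suc (vals \<epsilon> ! i) else 1)" if "i < ?n + e" for i
    using that by (auto simp: nth_append length_vals)
  have p: "vals \<epsilon> ! i \<noteq> 0" if "i < ?n" for i
    using vals_pos[of \<epsilon>] nth_mem[of i "vals \<epsilon>"] that by (metis length_vals)
  have "(Suc i < e + ?n \<and> vals (e # \<epsilon>) ! i = vals (e # \<epsilon>) ! Suc i) \<longleftrightarrow>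
    (Suc i < ?n \<and> vals \<epsilon> ! i = vals \<epsilon> ! Suc i) \<or> (?n \<le> i \<and> Suc i < ?n + e)" for i
    using v[of i] v[of "Suc i"] p[of i] by (cases "Suc i < ?n + e") (auto simp del: vals.simps)
  then show ?case using Cons by (simp del: vals.simps) blast
qed simp

lemma block_increasing_vals:
  "block_increasing \<epsilon> c \<longleftrightarrow> length c = length (vals \<epsilon>) \<and> strict (vals \<epsilon>) c"
  by (auto simp: block_increasing_def strict_def blocks_ok_vals length_vals)

text \<open>The triple condition for composition tableaux, for a row \<open>r\<close> above a row \<open>s\<close>.\<close>

definition triple_rule :: "nat list \<Rightarrow> nat list \<Rightarrow> bool"
  where "triple_rule r s \<longleftrightarrow> (\<forall>k. Suc k < length s \<and> k < length r \<and> s ! Suc k \<le> r ! k \<longrightarrow>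
    Suc k < length r \<and> s ! Suc k < r ! Suc k)"

definition row_ok :: "nat list \<Rightarrow> bool"
  where "row_ok r \<longleftrightarrow> r \<noteq> [] \<and> 0 \<notin> set r \<and> sorted_wrt (\<ge>) r"

definition rows_ok :: "nat list list \<Rightarrow> bool"
  where "rows_ok rows \<longleftrightarrow> (\<forall>r\<in>set rows. row_ok r) \<and> sorted_wrt (\<lambda>r s. hd r < hd s \<and> triple_rule r s) rows"

lemma place_decomp:
  "\<forall>q\<in>set R1. length q \<noteq> j \<Longrightarrow> length r = j \<Longrightarrow> v \<le> last r \<Longrightarrow>
    place j v (R1 @ r # R2) = R1 @ (r @ [v]) # R2"
  by (induction R1) auto

text \<open>The entry \<open>v\<close> may be added in column \<open>j\<close> as the last one in standardization order: \<open>v\<close> is minimal,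
  and equal entries are numbered from left to right.\<close>

definition fresh :: "nat \<Rightarrow> nat \<Rightarrow> nat list list \<Rightarrow> bool"
  where "fresh j v rows \<longleftrightarrow> rows_ok rows \<and> addable j (map length rows) \<and> 0 < v \<and>
    (\<forall>r\<in>set rows. \<forall>k<length r. v \<le> r ! k \<and> (r ! k = v \<longrightarrow> k < j))"

lemma add_cell_decomp:
  assumes "fresh j v rows" "0 < j"
  obtains R1 r R2 where "rows = R1 @ r # R2" "length r = j" "\<forall>q\<in>set R1. length q \<noteq> j"
    "add_cell j v rows = R1 @ (r @ [v]) # R2"
proof -
  have "j \<in> length ` set rows" using assms by (auto simp: fresh_def addable_def)
  then obtain R1 r R2 where R: "rows = R1 @ r # R2" "length r = j" "\<forall>q\<in>set R1. length q \<noteq> j"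
    using split_list_first_prop[of rows "\<lambda>r. length r = j"] by auto
  have "v \<le> last r" using assms R by (auto simp: fresh_def last_conv_nth)
  then show ?thesis using that[OF R] place_decomp[OF R(3,2)] assms(2) R(1) by (simp add: add_cell_def)
qed

text \<open>The triple rule with the new entry as the lower one says that no higher row has length \<open>j\<close>, and
  this is how \<open>place\<close> chooses the row. With the new entry as an upper one it is void, because no entry
  further to the right is as small as \<open>v\<close>.\<close>

lemma add_cell_ok:
  assumes "fresh j v rows"
  shows "rows_ok (add_cell j v rows)"
    "mset (concat (add_cell j v rows)) = add_mset v (mset (concat rows))"
    "\<forall>r\<in>set (add_cell j v rows). \<forall>k<length r. r ! k = v \<longrightarrow> k \<le> j"
    "\<exists>r\<in>set (add_cell j v rows). j < length r \<and> r ! j = v"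
    "map length (add_cell j v rows) = up j (map length rows)"
proof -
  have ok: "rows_ok rows" and v: "0 < v"
    and ge: "\<And>r k. r \<in> set rows \<Longrightarrow> k < length r \<Longrightarrow> v \<le> r ! k"
    and lt: "\<And>r k. r \<in> set rows \<Longrightarrow> k < length r \<Longrightarrow> r ! k = v \<Longrightarrow> k < j"
    using assms by (auto simp: fresh_def)
  have row: "row_ok r" if "r \<in> set rows" for r using ok that by (simp add: rows_ok_def)
  have "\<forall>a\<in>set (concat rows). v \<le> a"
  proof
    fix a assume "a \<in> set (concat rows)"
    then obtain r where r: "r \<in> set rows" "a \<in> set r" by auto
    then obtain k where "k < length r" "r ! k = a" by (auto simp: in_set_conv_nth)
    then show "v \<le> a" using ge[OF r(1)] by auto
  qed
  then show "map length (add_cell j v rows) = up j (map length rows)" by (rule length_add_cell)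
  have "rows_ok (add_cell j v rows) \<and>
      mset (concat (add_cell j v rows)) = add_mset v (mset (concat rows)) \<and>
      (\<forall>r\<in>set (add_cell j v rows). \<forall>k<length r. r ! k = v \<longrightarrow> k \<le> j) \<and>
      (\<exists>r\<in>set (add_cell j v rows). j < length r \<and> r ! j = v)"
  proof (cases "j = 0")
    case True
    have "v < hd s \<and> triple_rule [v] s" if s: "s \<in> set rows" for s
    proof
      have "s \<noteq> []" using row[OF s] by (simp add: row_ok_def)
      then show "v < hd s" using ge[OF s, of 0] lt[OF s, of 0] True by (auto simp: hd_conv_nth le_less)
      show "triple_rule [v] s" using ge[OF s] lt[OF s] True by (fastforce simp: triple_rule_def)
    qed
    then show ?thesis
      using ok lt True v by (auto simp: add_cell_def rows_ok_def row_ok_def)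
  next
    case False
    then obtain R1 r R2 where R: "rows = R1 @ r # R2" "length r = j" "\<forall>q\<in>set R1. length q \<noteq> j"
      "add_cell j v rows = R1 @ (r @ [v]) # R2"
      using add_cell_decomp[OF assms] by auto
    have r: "r \<in> set rows" "row_ok r" using R row by auto
    have "row_ok (r @ [v])"
      using r(2) v ge[OF r(1)] by (auto simp: row_ok_def sorted_wrt_append in_set_conv_nth)
    moreover have hd: "hd (r @ [v]) = hd r" using r(2) by (simp add: row_ok_def)
    moreover have "triple_rule q (r @ [v])" if q: "q \<in> set R1" for q
    proof -
      have tr: "triple_rule q r" using ok q R(1) by (auto simp: rows_ok_def sorted_wrt_append)
      show ?thesis
        unfolding triple_rule_def
      proof (intro allI impI)
        fix k assume k: "Suc k < length (r @ [v]) \<and> k < length q \<and> (r @ [v]) ! Suc k \<le> q ! k"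
        show "Suc k < length q \<and> (r @ [v]) ! Suc k < q ! Suc k"
        proof (cases "Suc k < length r")
          case True
          then show ?thesis using tr k by (auto simp: triple_rule_def nth_append)
        next
          case False
          then have kj: "Suc k = j" using k R(2) by simp
          have "length q \<noteq> j" using R(3) q by blast
          then have "Suc k < length q" using k kj by simp
          moreover have "v < q ! Suc k"
            using ge[of q "Suc k"] lt[of q "Suc k"] q R(1) calculation kj by (auto simp: le_less)
          ultimately show ?thesis using kj R(2) by (simp add: nth_append)
        qed
      qed
    qed
    moreover have "triple_rule (r @ [v]) s" if s: "s \<in> set R2" for s
    proof -
      have tr: "triple_rule r s" using ok s R(1) by (auto simp: rows_ok_def sorted_wrt_append)
      show ?thesis
        unfolding triple_rule_def
      proof (intro allI impI)
        fix k assume k: "Suc k < length s \<and> k < length (r @ [v]) \<and> s ! Suc k \<le> (r @ [v]) ! k"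
        show "Suc k < length (r @ [v]) \<and> s ! Suc k < (r @ [v]) ! Suc k"
        proof (cases "k < length r")
          case True
          then show ?thesis using tr k by (auto simp: triple_rule_def nth_append)
        next
          case False
          then have "k = j" using k R(2) by simp
          then have "s ! Suc k = v" using k R(2) ge[of s "Suc k"] s R(1) by (simp add: nth_append)
          then show ?thesis using lt[of s "Suc k"] s R(1) k \<open>k = j\<close> by simp
        qed
      qed
    qed
    ultimately have 1: "rows_ok (add_cell j v rows)"
      using ok R by (auto simp: rows_ok_def sorted_wrt_append)
    have 3: "\<forall>r\<in>set (add_cell j v rows). \<forall>k<length r. r ! k = v \<longrightarrow> k \<le> j"
    proof (intro ballI allI impI)
      fix q k assume q: "q \<in> set (add_cell j v rows)" "k < length q" "q ! k = v"
      then consider "q = r @ [v]" | "q \<in> set rows" using R by auto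
      then show "k \<le> j"
      proof cases
        case 1
        have "length q = Suc j" by (simp add: 1 R(2))
        then show ?thesis using q(2) by simp
      next
        case 2
        then show ?thesis using lt[OF 2 q(2,3)] by simp
      qed
    qed
    have "mset (concat (add_cell j v rows)) = add_mset v (mset (concat rows))"
      unfolding R(4) unfolding R(1) by simp
    moreover have "\<exists>r\<in>set (add_cell j v rows). j < length r \<and> r ! j = v"
      by (rule bexI[of _ "r @ [v]"]) (simp_all add: R(2,4) nth_append)
    ultimately show ?thesis
      using 1 3 by blast
  qed
  then show "rows_ok (add_cell j v rows)"
    "mset (concat (add_cell j v rows)) = add_mset v (mset (concat rows))"
    "\<forall>r\<in>set (add_cell j v rows). \<forall>k<length r. r ! k = v \<longrightarrow> k \<le> j"
    "\<exists>r\<in>set (add_cell j v rows). j < length r \<and> r ! j = v"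
    by blast+
qed

text \<open>The last entry in standardization order is the rightmost occurrence of the minimum, so \<open>j\<close>
  and the row that was extended can be read off.\<close>

lemma add_cell_inj:
  assumes "fresh j v R" "fresh j' v R'" "add_cell j v R = add_cell j' v R'"
  shows "j = j'" "R = R'"
proof -
  show j: "j = j'"
    using add_cell_ok(3,4)[OF assms(1)] add_cell_ok(3,4)[OF assms(2)] assms(3)
    by (metis order_antisym)
  show "R = R'"
  proof (cases "j = 0")
    case True
    then show ?thesis using assms(3) j by (simp add: add_cell_def)
  next
    case False
    obtain R1 r R2 where R: "R = R1 @ r # R2" "length r = j" "add_cell j v R = R1 @ (r @ [v]) # R2"
      using add_cell_decomp[OF assms(1)] False by (metis gr0I)
    obtain R1' r' R2' where R': "R' = R1' @ r' # R2'" "length r' = j" "add_cell j v R' = R1' @ (r' @ [v]) # R2'"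
      using add_cell_decomp[OF assms(2)] False j by (metis gr0I)
    have eq: "R1 @ (r @ [v]) # R2 = R1' @ (r' @ [v]) # R2'" using R R' assms(3) j by simp
    have no: "\<not> (j < length q \<and> q ! j = v)" if "q \<in> set R \<union> set R'" for q
      using assms(1,2) that j by (auto simp: fresh_def)
    have "length R1 = length R1'"
    proof (rule ccontr)
      assume "length R1 \<noteq> length R1'"
      then consider "length R1 < length R1'" | "length R1' < length R1" by linarith
      then show False
      proof cases
        case 1
        then have "r @ [v] = R1' ! length R1"
          using arg_cong[OF eq, of "\<lambda>x. x ! length R1"] by (simp add: nth_append)
        then have "r @ [v] \<in> set R'" using 1 R'(1) by simp
        then show False using no[of "r @ [v]"] R(2) by (simp add: nth_append)
      next
        case 2
        then have "r' @ [v] = R1 ! length R1'"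
          using arg_cong[OF eq, of "\<lambda>x. x ! length R1'"] by (simp add: nth_append)
        then have "r' @ [v] \<in> set R" using 2 R(1) by simp
        then show False using no[of "r' @ [v]"] R'(2) by (simp add: nth_append)
      qed
    qed
    then show ?thesis using eq R R' by simp
  qed
qed

text \<open>Remove the rightmost occurrence of the minimum \<open>v\<close>. It ends its row, and by the triple rule no
  higher row ends just before its column; so adding the cell again puts it into the same row.\<close>

lemma add_cell_surj:
  assumes ok: "rows_ok rows" and v: "v \<in> set (concat rows)" "\<forall>a\<in>set (concat rows). v \<le> a"
  obtains j rows' where "fresh j v rows'" "rows = add_cell j v rows'"
proof -
  let ?K = "{k. \<exists>r\<in>set rows. k < length r \<and> r ! k = v}"
  have ge: "v \<le> r ! k" if "r \<in> set rows" "k < length r" for r k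
    using v(2) that nth_mem[of k r] by auto
  have "?K = (\<Union>r\<in>set rows. {k. k < length r \<and> r ! k = v})" by auto
  then have fin: "finite ?K" by simp
  have ne: "?K \<noteq> {}" using v(1) by (auto simp: in_set_conv_nth)
  \<comment> \<open>The cell to be removed is the rightmost one with entry \<open>v\<close>.\<close>
  define j where "j = Max ?K"
  have "j \<in> ?K" unfolding j_def using fin ne by (rule Max_in)
  then obtain s where s: "s \<in> set rows" "j < length s" "s ! j = v" by blast
  have max: "k \<le> j" if "r \<in> set rows" "k < length r" "r ! k = v" for r k
    unfolding j_def by (rule Max_ge[OF fin]) (use that in blast)
  have row: "row_ok r" if "r \<in> set rows" for r using ok that by (simp add: rows_ok_def)
  have vpos: "0 < v" using row[OF s(1)] s nth_mem[OF s(2)] by (metis gr0I row_ok_def)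
  have len: "length s = Suc j"
  proof (rule ccontr)
    assume "length s \<noteq> Suc j"
    then have l: "Suc j < length s" using s by simp
    then have "s ! Suc j \<le> v"
      using row[OF s(1)] s(3) sorted_wrt_nth_less[of "(\<ge>)" s j "Suc j"] by (simp add: row_ok_def)
    then have "s ! Suc j = v" using ge[OF s(1) l] by simp
    then show False using max[OF s(1) l] by simp
  qed
  then obtain r where r: "s = r @ [v]" "length r = j"
    using s(3) by (metis append_butlast_last_id last_conv_nth length_butlast diff_Suc_1 length_0_conv nat.distinct(1))
  obtain R1 R2 where R: "rows = R1 @ (r @ [v]) # R2" using split_list[OF s(1)] r by auto
  have rel: "hd q < hd (r @ [v]) \<and> triple_rule q (r @ [v])" if "q \<in> set R1" for q
    using ok that R by (auto simp: rows_ok_def sorted_wrt_append)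
  have rel': "hd (r @ [v]) < hd q \<and> triple_rule (r @ [v]) q" if "q \<in> set R2" for q
    using ok that R by (auto simp: rows_ok_def sorted_wrt_append)
  show ?thesis
  proof (cases "j = 0")
    case True
    have "R1 = []"
    proof (rule ccontr)
      assume "R1 \<noteq> []"
      then have q: "hd R1 \<in> set rows" "hd (hd R1) < v" using R rel[of "hd R1"] r True by auto
      then show False using ge[OF q(1), of 0] row[OF q(1)] by (auto simp: row_ok_def hd_conv_nth)
    qed
    then have e: "rows = [v] # R2" using R r True by simp
    have "rows_ok R2" using ok e by (simp add: rows_ok_def)
    moreover have "\<not> r ! k = v" if "r \<in> set R2" "k < length r" for r k
    proof
      assume "r ! k = v"
      then have "k = 0" using max[of r k] that e True by simp
      moreover have "v < hd r" using rel'[OF that(1)] \<open>R1 = []\<close> True r by simp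
      ultimately show False using \<open>r ! k = v\<close> that by (simp add: hd_conv_nth)
    qed
    ultimately have "fresh 0 v R2" using vpos ge e by (auto simp: fresh_def addable_def)
    then show ?thesis using that[of 0 R2] e by (simp add: add_cell_def)
  next
    case False
    let ?rows = "R1 @ r # R2"
    have rne: "r \<noteq> []" using r(2) False by auto
    have sub: "\<exists>q'\<in>set rows. length q \<le> length q' \<and> (\<forall>k<length q. q' ! k = q ! k)" if "q \<in> set ?rows" for q
      using that R by (auto simp: nth_append intro: bexI[of _ "r @ [v]"])
    have ge': "v \<le> q ! k" if "q \<in> set ?rows" "k < length q" for q k
      using sub[OF that(1)] ge that(2) by (metis order_less_le_trans)
    have R1j: "length q \<noteq> j" if q: "q \<in> set R1" for q
    proof
      assume l: "length q = j"
      have "triple_rule q (r @ [v])" using rel[OF q] by simp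
      moreover have "v \<le> q ! (j - 1)" using ge'[of q "j - 1"] q l False by simp
      ultimately show False
        using l r(2) False unfolding triple_rule_def by (auto dest!: spec[of _ "j - 1"] simp: nth_append)
    qed
    have lt: "k < j" if q: "q \<in> set ?rows" "k < length q" "q ! k = v" for q k
    proof -
      obtain q' where q': "q' \<in> set rows" "length q \<le> length q'" "q' ! k = v" using sub[OF q(1)] q by auto
      have "k \<le> j" using max[OF q'(1) _ q'(3)] q' q by simp
      moreover have "k \<noteq> j"
      proof
        assume k: "k = j"
        have "j - 1 < length q" using q k by simp
        consider "q \<in> set R1" | "q = r" | "q \<in> set R2" using q(1) by auto
        then show False
        proof cases
          case 1
          have "triple_rule q (r @ [v])" using rel[OF 1] by simp
          moreover have "v \<le> q ! (j - 1)" using ge'[OF q(1) \<open>j - 1 < length q\<close>] .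
          ultimately have "v < q ! j"
            using r(2) False \<open>j - 1 < length q\<close> unfolding triple_rule_def
            by (auto dest!: spec[of _ "j - 1"] simp: nth_append)
          then show False using q k by simp
        next
          case 2
          then show False using q k r by simp
        next
          case 3
          have "triple_rule (r @ [v]) q" using rel'[OF 3] by simp
          moreover have "v \<le> (r @ [v]) ! (j - 1)" using ge[of "r @ [v]" "j - 1"] R r by simp
          ultimately have "v < (r @ [v]) ! j"
            using r(2) False q k unfolding triple_rule_def by (auto dest!: spec[of _ "j - 1"])
          then show False using r(2) by (simp add: nth_append)
        qed
      qed
      ultimately show ?thesis by simp
    qed
    have "row_ok r" using row[of "r @ [v]"] R rne by (auto simp: row_ok_def sorted_wrt_append)
    moreover have "triple_rule q r" if "q \<in> set R1" for q
      unfolding triple_rule_def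
    proof (intro allI impI)
      fix k assume "Suc k < length r \<and> k < length q \<and> r ! Suc k \<le> q ! k"
      then show "Suc k < length q \<and> r ! Suc k < q ! Suc k"
        using rel[OF that] unfolding triple_rule_def by (auto dest!: spec[of _ k] simp: nth_append)
    qed
    moreover have "triple_rule r q" if q: "q \<in> set R2" for q
      unfolding triple_rule_def
    proof (intro allI impI)
      fix k assume k: "Suc k < length q \<and> k < length r \<and> q ! Suc k \<le> r ! k"
      have t: "Suc k < length (r @ [v]) \<and> q ! Suc k < (r @ [v]) ! Suc k"
        using rel'[OF q] k unfolding triple_rule_def by (auto dest!: spec[of _ k] simp: nth_append)
      show "Suc k < length r \<and> q ! Suc k < r ! Suc k"
      proof (cases "Suc k < length r")
        case True
        then show ?thesis using t by (simp add: nth_append)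
      next
        case False
        then have "q ! Suc k < v" using t k by (simp add: nth_append)
        then show ?thesis using ge'[of q "Suc k"] q k by simp
      qed
    qed
    moreover have "hd (r @ [v]) = hd r" using rne by simp
    ultimately have "rows_ok ?rows"
      using ok R rel rel' by (auto simp: rows_ok_def sorted_wrt_append)
    moreover have "addable j (map length ?rows)" using r(2) by (simp add: addable_def)
    ultimately have "fresh j v ?rows" unfolding fresh_def using vpos ge' lt by blast
    moreover have "rows = add_cell j v ?rows"
      using place_decomp[of R1 j r v R2] R1j r(2) False ge'[of r "length r - 1"] rne R
      by (simp add: add_cell_def last_conv_nth)
    ultimately show ?thesis by (rule that)
  qed
qed

definition build :: "nat list \<Rightarrow> nat list \<Rightarrow> nat list list"
  where "build vs c = fold (\<lambda>(j, v). add_cell j v) (zip c vs) []"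

definition build_words :: "nat list \<Rightarrow> nat list set"
  where "build_words vs = {c. length c = length vs \<and> strict vs c \<and> admissible [] c}"

definition built_rows :: "nat list \<Rightarrow> nat list list set"
  where "built_rows vs = {rows. rows_ok rows \<and> mset (concat rows) = mset vs}"

lemma build_snoc: "length c = length vs \<Longrightarrow> build (vs @ [v]) (c @ [j]) = add_cell j v (build vs c)"
  by (simp add: build_def)

lemma strict_snoc:
  "length c = length vs \<Longrightarrow> strict (vs @ [v]) (c @ [j]) \<longleftrightarrow>
    strict vs c \<and> (vs \<noteq> [] \<and> last vs = v \<longrightarrow> last c < j)"
proof -
  assume len: "length c = length vs"
  have "(\<forall>i. Suc i < Suc (length vs) \<and> P i \<longrightarrow> Q i) \<longleftrightarrow>
    (\<forall>i. Suc i < length vs \<and> P i \<longrightarrow> Q i) \<and> (vs \<noteq> [] \<and> P (length vs - 1) \<longrightarrow> Q (length vs - 1))" for P Q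
    by (cases vs) (auto simp: less_Suc_eq)
  note * = this[of "\<lambda>i. (vs @ [v]) ! i = (vs @ [v]) ! Suc i" "\<lambda>i. (c @ [j]) ! i < (c @ [j]) ! Suc i"]
  have "strict (vs @ [v]) (c @ [j]) \<longleftrightarrow>
    (\<forall>i. Suc i < length vs \<and> (vs @ [v]) ! i = (vs @ [v]) ! Suc i \<longrightarrow> (c @ [j]) ! i < (c @ [j]) ! Suc i) \<and>
    (vs \<noteq> [] \<and> (vs @ [v]) ! (length vs - 1) = (vs @ [v]) ! Suc (length vs - 1) \<longrightarrow>
      (c @ [j]) ! (length vs - 1) < (c @ [j]) ! Suc (length vs - 1))"
    unfolding strict_def using * by simp
  also have "\<dots> \<longleftrightarrow> strict vs c \<and> (vs \<noteq> [] \<and> last vs = v \<longrightarrow> last c < j)"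
    using len by (cases "vs = []"; cases "c = []") (auto simp: strict_def nth_append last_conv_nth)
  finally show ?thesis .
qed

text \<open>The last clause locates the entries equal to the most recent one, as the next step needs to know
  that a further equal entry goes to a column to the right of them.\<close>

definition well_built :: "nat list \<Rightarrow> nat list \<Rightarrow> nat list list \<Rightarrow> bool"
  where "well_built vs c rows \<longleftrightarrow> rows \<in> built_rows vs \<and> map length rows = walk [] c \<and>
    (vs \<noteq> [] \<longrightarrow> (\<forall>r\<in>set rows. \<forall>k<length r. r ! k = last vs \<longrightarrow> k \<le> last c) \<and>
      (\<exists>r\<in>set rows. last c < length r \<and> r ! last c = last vs))"

lemma build_correct:
  "sorted_wrt (\<ge>) vs \<Longrightarrow> 0 \<notin> set vs \<Longrightarrow> c \<in> build_words vs \<Longrightarrow>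
    well_built vs c (build vs c)"
  "sorted_wrt (\<ge>) (vs @ [v]) \<Longrightarrow> 0 \<notin> set (vs @ [v]) \<Longrightarrow> c @ [j] \<in> build_words (vs @ [v]) \<Longrightarrow>
    c \<in> build_words vs \<and> fresh j v (build vs c)"
proof -
  have step: "c \<in> build_words vs \<and> fresh j v (build vs c)"
    if IH: "\<And>c. c \<in> build_words vs \<Longrightarrow> well_built vs c (build vs c)"
      and srt: "sorted_wrt (\<ge>) (vs @ [v])" "0 \<notin> set (vs @ [v])" and c: "c @ [j] \<in> build_words (vs @ [v])" for vs v c j
  proof -
    have len: "length c = length vs" using c by (simp add: build_words_def)
    have cw: "c \<in> build_words vs" and add: "addable j (walk [] c)"
      and last: "vs \<noteq> [] \<and> last vs = v \<longrightarrow> last c < j"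
      using c len by (auto simp: build_words_def strict_snoc admissible_append)
    note I = IH[OF cw, unfolded well_built_def]
    have sv: "set (concat (build vs c)) = set vs"
      using I unfolding built_rows_def by (metis (mono_tags, lifting) mem_Collect_eq set_mset_mset)
    have "v \<le> r ! k \<and> (r ! k = v \<longrightarrow> k < j)" if r: "r \<in> set (build vs c)" "k < length r" for r k
    proof -
      have "r ! k \<in> set (concat (build vs c))" using r nth_mem by auto
      then have mem: "r ! k \<in> set vs" unfolding sv .
      then have ge: "v \<le> r ! k" using srt(1) by (auto simp: sorted_wrt_append)
      have "k < j" if "r ! k = v"
      proof -
        have ne: "vs \<noteq> []" using mem by auto
        have "last vs \<le> v"
        proof -
          have "sorted_wrt (\<ge>) (butlast vs @ [last vs])" using srt(1) ne by (simp add: sorted_wrt_append)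
          moreover have "v \<in> set (butlast vs @ [last vs])" using mem that ne by simp
          ultimately show ?thesis by (auto simp: sorted_wrt_append)
        qed
        moreover have "v \<le> last vs" using srt(1) ne by (simp add: sorted_wrt_append)
        ultimately have "last vs = v" by simp
        then show ?thesis using I ne r that last by fastforce
      qed
      then show ?thesis using ge by blast
    qed
    moreover have "rows_ok (build vs c)" using I by (simp add: built_rows_def)
    ultimately have "fresh j v (build vs c)"
      using I add srt(2) by (auto simp: fresh_def)
    then show ?thesis using cw by blast
  qed
  show 1: "well_built vs c (build vs c)"
    if "sorted_wrt (\<ge>) vs" "0 \<notin> set vs" "c \<in> build_words vs" for vs c
    using that
  proof (induction vs arbitrary: c rule: rev_induct)
    case Nil
    then show ?case by (simp add: well_built_def build_words_def build_def built_rows_def rows_ok_def)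
  next
    case (snoc v vs)
    obtain d j where c: "c = d @ [j]" using snoc.prems(3) by (cases c rule: rev_cases) (auto simp: build_words_def)
    have len: "length d = length vs" using snoc.prems(3) by (simp add: build_words_def c)
    have IH: "\<And>c. c \<in> build_words vs \<Longrightarrow> well_built vs c (build vs c)"
      using snoc.IH snoc.prems(1,2) by (simp add: sorted_wrt_append)
    note s = step[OF IH snoc.prems(1,2) snoc.prems(3)[unfolded c]]
    note ok = add_cell_ok[of j v "build vs d"]
    show ?case
      unfolding c build_snoc[OF len]
      using IH[of d] s ok by (simp add: well_built_def built_rows_def)
  qed
  show "c \<in> build_words vs \<and> fresh j v (build vs c)"
    if "sorted_wrt (\<ge>) (vs @ [v])" "0 \<notin> set (vs @ [v])" "c @ [j] \<in> build_words (vs @ [v])"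
    by (rule step[OF 1 that]) (use that in \<open>auto simp: sorted_wrt_append\<close>)
qed

lemma build_inj: "sorted_wrt (\<ge>) vs \<Longrightarrow> 0 \<notin> set vs \<Longrightarrow> inj_on (build vs) (build_words vs)"
proof (induction vs rule: rev_induct)
  case Nil
  then show ?case by (simp add: build_words_def inj_on_def)
next
  case (snoc v vs)
  have IH: "inj_on (build vs) (build_words vs)" using snoc by (simp add: sorted_wrt_append)
  show ?case
  proof (rule inj_onI)
    fix c c' assume *: "c \<in> build_words (vs @ [v])" "c' \<in> build_words (vs @ [v])" "build (vs @ [v]) c = build (vs @ [v]) c'"
    obtain d j where c: "c = d @ [j]" using *(1) by (cases c rule: rev_cases) (auto simp: build_words_def)
    obtain d' j' where c': "c' = d' @ [j']" using *(2) by (cases c' rule: rev_cases) (auto simp: build_words_def)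
    have len: "length d = length vs" "length d' = length vs" using *(1,2) by (simp_all add: build_words_def c c')
    note s = build_correct(2)[OF snoc.prems *(1)[unfolded c]]
    note s' = build_correct(2)[OF snoc.prems *(2)[unfolded c']]
    have "add_cell j v (build vs d) = add_cell j' v (build vs d')"
      using *(3) unfolding c c' build_snoc[OF len(1)] build_snoc[OF len(2)] .
    then have "j = j'" "build vs d = build vs d'" using add_cell_inj s s' by blast+
    then show "c = c'" using IH s s' c c' by (auto dest: inj_onD)
  qed
qed

lemma build_surj: "sorted_wrt (\<ge>) vs \<Longrightarrow> 0 \<notin> set vs \<Longrightarrow> rows \<in> built_rows vs \<Longrightarrow> \<exists>c\<in>build_words vs. build vs c = rows"
proof (induction vs arbitrary: rows rule: rev_induct)
  case Nil
  then have "rows = []" by (auto simp: built_rows_def rows_ok_def row_ok_def)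
  then show ?case by (auto simp: build_words_def build_def strict_def)
next
  case (snoc v vs)
  have ok: "rows_ok rows" and m: "mset (concat rows) = mset (vs @ [v])"
    using snoc.prems(3) by (auto simp: built_rows_def)
  have s: "set (concat rows) = insert v (set vs)" using arg_cong[OF m, of set_mset] by (simp del: set_concat)
  have v: "v \<in> set (concat rows)" "\<forall>a\<in>set (concat rows). v \<le> a"
    unfolding s using snoc.prems(1) by (auto simp: sorted_wrt_append)
  obtain j rows' where f: "fresh j v rows'" "rows = add_cell j v rows'"
    using add_cell_surj[OF ok v] by blast
  have "rows' \<in> built_rows vs"
    using f m add_cell_ok(2)[OF f(1)] by (auto simp: built_rows_def fresh_def)
  then obtain c where c: "c \<in> build_words vs" "build vs c = rows'"
    using snoc.IH snoc.prems(1,2) by (auto simp: sorted_wrt_append)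
  have b: "map length rows' = walk [] c" "vs \<noteq> [] \<longrightarrow> (\<exists>r\<in>set rows'. last c < length r \<and> r ! last c = last vs)"
    using build_correct(1)[of vs c] c snoc.prems(1,2) by (auto simp: sorted_wrt_append well_built_def)
  have len: "length c = length vs" using c(1) by (simp add: build_words_def)
  have "addable j (walk [] c)" using f(1) b(1) by (simp add: fresh_def)
  moreover have "vs \<noteq> [] \<and> last vs = v \<longrightarrow> last c < j"
    using b(2) f(1) by (auto simp: fresh_def)
  ultimately have "c @ [j] \<in> build_words (vs @ [v])"
    using c(1) len by (simp add: build_words_def strict_snoc admissible_append)
  moreover have "build (vs @ [v]) (c @ [j]) = rows" using build_snoc[OF len] c(2) f(2) by simp
  ultimately show ?case by blast
qed


lemma filling_of_rows_iff:
  "filling_of_rows rows (i, j) = Some a \<longleftrightarrow> i < length rows \<and> j < length (rows ! i) \<and> rows ! i ! j = a"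
  by (auto simp: filling_of_rows_def)

lemma dom_filling_of_rows: "dom (filling_of_rows rows) = diagram (map length rows)"
  by (auto simp: filling_of_rows_def diagram_def split: if_splits)

definition rows_of_filling :: "nat list \<Rightarrow> filling \<Rightarrow> nat list list"
  where "rows_of_filling \<alpha> T = map (\<lambda>i. map (\<lambda>j. the (T (i, j))) [0..<\<alpha> ! i]) [0..<length \<alpha>]"

lemma rows_of_filling_of_rows: "rows_of_filling (map length rows) (filling_of_rows rows) = rows"
  unfolding rows_of_filling_def
  by (rule nth_equalityI) (auto simp: filling_of_rows_def intro!: nth_equalityI)

lemma SSCT_filling_of_rows:
  assumes "0 \<notin> set (map length rows)"
  shows "SSCT (map length rows) (filling_of_rows rows) \<longleftrightarrow> rows_ok rows"
proof -
  note I = filling_of_rows_iff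
  have ne: "rows ! i \<noteq> []" if "i < length rows" for i
    using assms nth_mem[OF that] by (metis image_eqI length_0_conv set_map)
  have 1: "(0 \<notin> ran (filling_of_rows rows)) \<longleftrightarrow> (\<forall>r\<in>set rows. 0 \<notin> set r)"
  proof -
    have "0 \<in> ran (filling_of_rows rows) \<longleftrightarrow> (\<exists>i j. i < length rows \<and> j < length (rows ! i) \<and> rows ! i ! j = 0)"
      by (simp add: ran_def I)
    also have "\<dots> \<longleftrightarrow> (\<exists>r\<in>set rows. 0 \<in> set r)"
      unfolding in_set_conv_nth by (metis in_set_conv_nth)
    finally show ?thesis by blast
  qed
  let ?T = "filling_of_rows rows"
  have 2: "(\<forall>i j j' a b. ?T (i, j) = Some a \<and> ?T (i, j') = Some b \<and> j < j' \<longrightarrow> b \<le> a) \<longleftrightarrow>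
    (\<forall>r\<in>set rows. sorted_wrt (\<ge>) r)" (is "?L \<longleftrightarrow> ?R")
  proof
    assume L: ?L
    have "rows ! i ! k \<le> rows ! i ! j" if "i < length rows" "j < k" "k < length (rows ! i)" for i j k
      using L[rule_format, of i j "rows ! i ! j" k "rows ! i ! k"] that by (simp add: I)
    then show ?R unfolding all_set_conv_all_nth sorted_wrt_iff_nth_less by blast
  next
    assume R: ?R
    then have "rows ! i ! k \<le> rows ! i ! j" if "i < length rows" "j < k" "k < length (rows ! i)" for i j k
      using that unfolding all_set_conv_all_nth sorted_wrt_iff_nth_less by blast
    then show ?L unfolding I by blast
  qed
  have 3: "(\<forall>i i' a b. ?T (i, 0) = Some a \<and> ?T (i', 0) = Some b \<and> i < i' \<longrightarrow> a < b) \<longleftrightarrow>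
    sorted_wrt (\<lambda>r s. hd r < hd s) rows" (is "?L \<longleftrightarrow> ?R")
  proof -
    have hd: "?T (i, 0) = Some a \<longleftrightarrow> i < length rows \<and> hd (rows ! i) = a" for i a
      using ne[of i] by (auto simp: I hd_conv_nth)
    show ?thesis
    proof
      assume L: ?L
      have "hd (rows ! i) < hd (rows ! k)" if "i < k" "k < length rows" for i k
        using L[rule_format, of i "hd (rows ! i)" k "hd (rows ! k)"] that by (simp add: hd)
      then show ?R unfolding sorted_wrt_iff_nth_less by blast
    next
      assume R: ?R
      then show ?L unfolding hd sorted_wrt_iff_nth_less by blast
    qed
  qed
  have 4: "(\<forall>i j k a b. i < j \<and> ?T (i, k) = Some a \<and> ?T (j, Suc k) = Some b \<and> b \<le> a \<longrightarrow>
      (\<exists>c. ?T (i, Suc k) = Some c \<and> b < c)) \<longleftrightarrow> sorted_wrt triple_rule rows" (is "?L \<longleftrightarrow> ?R")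
  proof
    assume L: ?L
    have "triple_rule (rows ! i) (rows ! j)" if "i < j" "j < length rows" for i j
      unfolding triple_rule_def
    proof (intro allI impI)
      fix k assume "Suc k < length (rows ! j) \<and> k < length (rows ! i) \<and> rows ! j ! Suc k \<le> rows ! i ! k"
      then have "\<exists>c. ?T (i, Suc k) = Some c \<and> rows ! j ! Suc k < c"
        using L[rule_format, of i j k "rows ! i ! k" "rows ! j ! Suc k"] that by (simp add: I)
      then show "Suc k < length (rows ! i) \<and> rows ! j ! Suc k < rows ! i ! Suc k"
        unfolding I by blast
    qed
    then show ?R unfolding sorted_wrt_iff_nth_less by blast
  next
    assume R: ?R
    show ?L
    proof (intro allI impI)
      fix i j k a b
      assume *: "i < j \<and> ?T (i, k) = Some a \<and> ?T (j, Suc k) = Some b \<and> b \<le> a"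
      then have "triple_rule (rows ! i) (rows ! j)" using R by (simp add: I sorted_wrt_iff_nth_less)
      then show "\<exists>c. ?T (i, Suc k) = Some c \<and> b < c"
        using * unfolding I triple_rule_def by blast
    qed
  qed
  have 5: "rows_ok rows \<longleftrightarrow> (\<forall>r\<in>set rows. 0 \<notin> set r) \<and> (\<forall>r\<in>set rows. sorted_wrt (\<ge>) r) \<and>
      sorted_wrt (\<lambda>r s. hd r < hd s) rows \<and> sorted_wrt triple_rule rows"
    using assms unfolding rows_ok_def row_ok_def sorted_wrt_iff_nth_less by auto
  show ?thesis
    unfolding SSCT_def 1 2 3 4 5 dom_filling_of_rows by blast
qed

lemma card_entries:
  "card {x. filling_of_rows rows x = Some a} = count_list (concat rows) a"
proof -
  have "{x. filling_of_rows rows x = Some a} = (SIGMA i:{..<length rows}. {j. j < length (rows ! i) \<and> rows ! i ! j = a})"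
    by (auto simp: filling_of_rows_iff)
  then have "card {x. filling_of_rows rows x = Some a} =
      (\<Sum>i<length rows. card {j. j < length (rows ! i) \<and> rows ! i ! j = a})"
    by (simp add: card_SigmaI)
  also have "\<dots> = (\<Sum>i<length rows. count_list (rows ! i) a)"
    by (intro sum.cong refl) (simp add: count_list_eq_length_filter length_filter_conv_card eq_commute)
  also have "\<dots> = (\<Sum>r\<leftarrow>rows. count_list r a)"
    by (simp add: sum_list_sum_nth atLeast0LessThan)
  also have "\<dots> = count_list (concat rows) a"
    by (induction rows) auto
  finally show ?thesis .
qed

text \<open>Standardization: removing the entries of a semistandard composition tableau in increasing order,
  equal ones from right to left, records a word, and each tableau is rebuilt from its word by
  \<open>build\<close>.\<close>

lemma kostka_eq_card:
  assumes \<beta>: "is_composition \<beta>"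
  shows "card (SSCT_with_content \<beta> m) = kostka \<beta> (exponents m)"
proof -
  let ?\<epsilon> = "exponents m"
  let ?m = "Poly_Mapping.nth ?\<epsilon>"
  let ?vs = "vals ?\<epsilon>"
  let ?W = "{c \<in> build_words ?vs. walk [] c = \<beta>}"
  let ?R = "{rows \<in> built_rows ?vs. map length rows = \<beta>}"
  note srt = sorted_vals[of ?\<epsilon>] vals_pos[of ?\<epsilon>]
  have "bij_betw (build ?vs) ?W ?R"
    unfolding bij_betw_def
  proof
    show "inj_on (build ?vs) ?W" by (rule inj_on_subset[OF build_inj[OF srt]]) auto
    show "build ?vs ` ?W = ?R"
    proof (intro equalityI subsetI)
      fix rows assume "rows \<in> build ?vs ` ?W"
      then obtain c where c: "c \<in> build_words ?vs" "walk [] c = \<beta>" "rows = build ?vs c" by blast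
      then show "rows \<in> ?R" using build_correct(1)[OF srt c(1)] by (simp add: well_built_def)
    next
      fix rows assume rows: "rows \<in> ?R"
      then obtain c where c: "c \<in> build_words ?vs" "build ?vs c = rows" using build_surj[OF srt, of rows] by blast
      then have "c \<in> ?W" using build_correct(1)[OF srt c(1)] rows by (simp add: well_built_def)
      then show "rows \<in> build ?vs ` ?W" using c(2) by blast
    qed
  qed
  then have card1: "card ?W = card ?R" by (rule bij_betw_same_card)
  have "bij_betw filling_of_rows ?R (SSCT_with_content \<beta> ?m)"
    unfolding bij_betw_def
  proof
    show "inj_on filling_of_rows ?R"
    proof (rule inj_onI)
      fix R R' assume "R \<in> ?R" "R' \<in> ?R" "filling_of_rows R = filling_of_rows R'"
      then show "R = R'"
        using rows_of_filling_of_rows[of R] rows_of_filling_of_rows[of R'] by simp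
    qed
    have content: "has_content (filling_of_rows rows) ?m \<longleftrightarrow> mset (concat rows) = mset ?vs"
      if "rows_ok rows" for rows
    proof -
      have z: "count_list (concat rows) 0 = 0"
        using that by (auto simp: count_list_0_iff rows_ok_def row_ok_def)
      have z': "count_list ?vs 0 = 0" using vals_pos by (simp add: count_list_0_iff)
      have "has_content (filling_of_rows rows) ?m \<longleftrightarrow> (\<forall>i. count_list (concat rows) (Suc i) = count_list ?vs (Suc i))"
        unfolding has_content_def card_entries count_vals by (simp add: nth_default_def)
      also have "\<dots> \<longleftrightarrow> (\<forall>a. count_list (concat rows) a = count_list ?vs a)"
      proof (intro iffI allI)
        fix a assume *: "\<forall>i. count_list (concat rows) (Suc i) = count_list ?vs (Suc i)"
        show "count_list (concat rows) a = count_list ?vs a"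
          using * z z' by (cases a) simp_all
      qed simp
      also have "\<dots> \<longleftrightarrow> mset (concat rows) = mset ?vs"
        unfolding multiset_eq_iff by (simp add: count_mset)
      finally show ?thesis .
    qed
    have \<beta>0: "0 \<notin> set \<beta>" using \<beta> by (simp add: is_composition_def)
    show "filling_of_rows ` ?R = SSCT_with_content \<beta> ?m"
    proof (intro equalityI subsetI)
      fix T assume "T \<in> filling_of_rows ` ?R"
      then obtain rows where r: "T = filling_of_rows rows" "rows \<in> built_rows ?vs" "map length rows = \<beta>" by auto
      then show "T \<in> SSCT_with_content \<beta> ?m"
        using SSCT_filling_of_rows[of rows] content[of rows] \<beta>0 by (simp add: SSCT_with_content_def built_rows_def)
    next
      fix T assume T: "T \<in> SSCT_with_content \<beta> ?m"
      then have S: "SSCT \<beta> T" "has_content T ?m" by (simp_all add: SSCT_with_content_def)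
      have d: "dom T = diagram \<beta>" using S(1) by (simp add: SSCT_def)
      define rows where "rows = rows_of_filling \<beta> T"
      have len: "map length rows = \<beta>" unfolding rows_def rows_of_filling_def by (rule nth_equalityI) auto
      have eq: "filling_of_rows rows = T"
      proof (rule ext, clarify)
        fix i j
        have "(i, j) \<in> dom T \<longleftrightarrow> i < length \<beta> \<and> j < \<beta> ! i"
          unfolding d by (simp add: diagram_def)
        then show "filling_of_rows rows (i, j) = T (i, j)"
          by (auto simp: filling_of_rows_def rows_def rows_of_filling_def)
      qed
      have "rows_ok rows" using S(1) SSCT_filling_of_rows[of rows] \<beta>0 by (simp add: len eq)
      then have "rows \<in> ?R" using content[of rows] S(2) by (simp add: built_rows_def eq len)
      then show "T \<in> filling_of_rows ` ?R" using eq by blast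
    qed
  qed
  then have "card ?R = card (SSCT_with_content \<beta> ?m)" by (rule bij_betw_same_card)
  with card1 have W: "card ?W = card (SSCT_with_content \<beta> ?m)" by (rule trans)
  have "{c. admissible [] c \<and> walk [] c = \<beta> \<and> block_increasing ?\<epsilon> c} = ?W"
    by (rule set_eqI) (simp only: build_words_def block_increasing_vals mem_Collect_eq conj_ac)
  then have "kostka \<beta> ?\<epsilon> = card ?W"
    unfolding kostka_def by (rule arg_cong)
  then show ?thesis
    unfolding W by (simp only: card_SSCT_with_content)
qed

lemma coeff_qschur: "is_composition \<beta> \<Longrightarrow> coeff (qschur \<beta>) m = of_nat (kostka \<beta> (exponents m))"
  by (simp add: qschur.rep_eq kostka_eq_card)

section \<open>The dual basis\<close>

lemma coeff_monomial: "coeff (monomial_qsym \<alpha>) m = (if exponents m = \<alpha> then 1 else 0)"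
  by (simp add: monomial_qsym.rep_eq)

lemma qschur_monomials:
  assumes "\<beta> \<in> Comp n"
  shows "qschur \<beta> = (\<Sum>\<delta>\<in>Comp n. qscale (of_nat (kostka \<beta> \<delta>)) (monomial_qsym \<delta>))"
proof -
  have "coeff (qschur \<beta>) m = coeff (\<Sum>\<delta>\<in>Comp n. qscale (of_nat (kostka \<beta> \<delta>)) (monomial_qsym \<delta>)) m" for m
  proof -
    have "coeff (\<Sum>\<delta>\<in>Comp n. qscale (of_nat (kostka \<beta> \<delta>)) (monomial_qsym \<delta>)) m =
        (\<Sum>\<delta>\<in>Comp n. if \<delta> = exponents m then of_nat (kostka \<beta> \<delta>) else 0)"
      unfolding coeff_sum qscale.rep_eq coeff_monomial by (intro sum.cong) auto
    also have "\<dots> = of_nat (kostka \<beta> (exponents m))"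
    proof (cases "exponents m \<in> Comp n")
      case True
      then show ?thesis by (simp add: finite_Comp)
    next
      case False
      then have "kostka \<beta> (exponents m) = 0"
        using kostka_size[of \<beta> "exponents m"] assms is_composition_exponents[of m] by (auto simp: Comp_def)
      then show ?thesis using False by (simp add: finite_Comp)
    qed
    finally show ?thesis using assms coeff_qschur[of \<beta> m] by (simp add: Comp_def)
  qed
  then show ?thesis by (simp add: coeff_inject[symmetric] fun_eq_iff)
qed

lemma pairing_linear: "Vector_Spaces.linear qscale (*) (pairing x)"
  using pairing[of x] by simp

lemma pairing_scale: "pairing x (qscale c F) = c * pairing x F"
  using pairing_linear[of x] by (simp add: Vector_Spaces.linear_iff)

lemma pairing_sum: "pairing x (\<Sum>i\<in>A. f i) = (\<Sum>i\<in>A. pairing x (f i))"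
  by (rule linear_sum_rat[OF pairing_linear])

lemma pairing_qschur:
  assumes "\<beta> \<in> Comp n"
  shows "pairing x (qschur \<beta>) = (\<Sum>\<delta>\<in>Comp n. of_nat (kostka \<beta> \<delta>) * pairing x (monomial_qsym \<delta>))"
  unfolding qschur_monomials[OF assms] pairing_sum pairing_scale ..

lemma wf_revlex: "wf (revlex \<inter> (Comp n \<times> Comp n))"
  by (rule finite_acyclic_wf)
    (auto intro: acyclic_revlex finite_subset[OF _ finite_cartesian_product[OF finite_Comp finite_Comp]])

text \<open>The equation for \<open>\<beta>\<close> determines \<open>g \<beta>\<close> from the values at smaller compositions.\<close>

lemma kostka_row_sum:
  fixes g :: "nat list \<Rightarrow> rat"
  assumes "\<beta> \<in> Comp n"
  shows "(\<Sum>\<delta>\<in>Comp n. of_nat (kostka \<beta> \<delta>) * g \<delta>) =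
    g \<beta> + (\<Sum>\<delta>\<in>{\<delta> \<in> Comp n. (\<delta>, \<beta>) \<in> revlex}. of_nat (kostka \<beta> \<delta>) * g \<delta>)"
proof -
  have irr: "(\<beta>, \<beta>) \<notin> revlex"
    using acyclic_revlex[of UNIV] by (auto simp: acyclic_def)
  have "(\<Sum>\<delta>\<in>Comp n. of_nat (kostka \<beta> \<delta>) * g \<delta>) =
      (\<Sum>\<delta>\<in>insert \<beta> {\<delta> \<in> Comp n. (\<delta>, \<beta>) \<in> revlex}. of_nat (kostka \<beta> \<delta>) * g \<delta>)"
  proof (rule sum.mono_neutral_right[OF finite_Comp])
    show "insert \<beta> {\<delta> \<in> Comp n. (\<delta>, \<beta>) \<in> revlex} \<subseteq> Comp n" using assms by auto
    show "\<forall>\<delta>\<in>Comp n - insert \<beta> {\<delta> \<in> Comp n. (\<delta>, \<beta>) \<in> revlex}. of_nat (kostka \<beta> \<delta>) * g \<delta> = 0"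
      using kostka_triangular[of _ \<beta>] assms by (auto simp: Comp_def)
  qed
  also have "\<dots> = of_nat (kostka \<beta> \<beta>) * g \<beta> +
      (\<Sum>\<delta>\<in>{\<delta> \<in> Comp n. (\<delta>, \<beta>) \<in> revlex}. of_nat (kostka \<beta> \<delta>) * g \<delta>)"
    using irr finite_Comp by simp
  finally show ?thesis using kostka_same assms by (simp add: Comp_def)
qed

text \<open>The functions \<open>qschur \<beta>\<close> span: by triangularity the values on them determine the values on
  the monomial functions recursively.\<close>

lemma nsym_eqI:
  assumes "\<And>\<beta>. is_composition \<beta> \<Longrightarrow> pairing x (qschur \<beta>) = pairing y (qschur \<beta>)"
  shows "x = y"
proof -
  have mon: "pairing x (monomial_qsym \<epsilon>) = pairing y (monomial_qsym \<epsilon>)" if "\<epsilon> \<in> Comp n" for \<epsilon> n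
    using that
  proof (induction \<epsilon> rule: wf_induct[OF wf_revlex[of n]])
    case (1 \<epsilon>)
    have "(\<Sum>\<delta>\<in>{\<delta> \<in> Comp n. (\<delta>, \<epsilon>) \<in> revlex}. of_nat (kostka \<epsilon> \<delta>) * pairing x (monomial_qsym \<delta>)) =
      (\<Sum>\<delta>\<in>{\<delta> \<in> Comp n. (\<delta>, \<epsilon>) \<in> revlex}. of_nat (kostka \<epsilon> \<delta>) * pairing y (monomial_qsym \<delta>))"
      using 1 by (intro sum.cong refl) auto
    moreover have "pairing x (qschur \<epsilon>) = pairing y (qschur \<epsilon>)"
      using assms 1(2) by (simp add: Comp_def)
    ultimately show ?case
      unfolding pairing_qschur[OF 1(2)] kostka_row_sum[OF 1(2)] by simp
  qed
  have "pairing x F = pairing y F" for F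
  proof -
    have "pairing z F = (\<Sum>\<alpha>\<in>Poly_Mapping.keys (monomial_coords F).
        Poly_Mapping.lookup (monomial_coords F) \<alpha> * pairing z (monomial_qsym \<alpha>))" for z
    proof -
      have "pairing z F = pairing z (linear_extension qscale monomial_qsym (monomial_coords F))"
        by (simp add: monomial_expansion)
      then show ?thesis by (simp add: linear_extension_def pairing_sum pairing_scale)
    qed
    moreover have "pairing x (monomial_qsym \<alpha>) = pairing y (monomial_qsym \<alpha>)"
      if "\<alpha> \<in> Poly_Mapping.keys (monomial_coords F)" for \<alpha>
    proof -
      have "is_composition \<alpha>" using that by (auto simp: in_keys_iff monomial_coords.rep_eq split: if_splits)
      then show ?thesis by (intro mon[of \<alpha> "sum_list \<alpha>"]) (simp add: Comp_def)
    qed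
    ultimately show ?thesis by simp
  qed
  then show ?thesis by (simp add: pairing_inject[symmetric] fun_eq_iff)
qed

lemma mdegree_nth: "is_composition \<delta> \<Longrightarrow> mdegree (Poly_Mapping.nth \<delta>) = sum_list \<delta>"
  by (simp add: mdegree_eq_sum_exponents exponents_nth)

text \<open>The values \<open>f\<close> of the dual vector on the monomial functions of degree \<open>n\<close> are defined by recursion
  along the triangular system; on all other degrees the vector is zero.\<close>

lemma qschur_dual_exists:
  assumes "\<alpha> \<in> Comp n"
  shows "\<exists>x. (\<forall>\<beta>. is_composition \<beta> \<longrightarrow> pairing x (qschur \<beta>) = (if \<beta> = \<alpha> then 1 else 0)) \<and>
    (\<forall>\<delta>. is_composition \<delta> \<and> \<delta> \<notin> Comp n \<longrightarrow> pairing x (monomial_qsym \<delta>) = 0)"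
proof -
  let ?r = "revlex \<inter> (Comp n \<times> Comp n)"
  define H :: "(nat list \<Rightarrow> rat) \<Rightarrow> nat list \<Rightarrow> rat" where "H f \<epsilon> = (if \<epsilon> = \<alpha> then 1 else 0) -
    (\<Sum>\<delta>\<in>{\<delta> \<in> Comp n. (\<delta>, \<epsilon>) \<in> revlex}. of_nat (kostka \<epsilon> \<delta>) * f \<delta>)" for f \<epsilon>
  define f where "f = wfrec ?r H"
  have f: "f \<epsilon> = (if \<epsilon> = \<alpha> then 1 else 0) -
    (\<Sum>\<delta>\<in>{\<delta> \<in> Comp n. (\<delta>, \<epsilon>) \<in> revlex}. of_nat (kostka \<epsilon> \<delta>) * f \<delta>)" if "\<epsilon> \<in> Comp n" for \<epsilon>
  proof -
    have "f \<epsilon> = H (cut f ?r \<epsilon>) \<epsilon>" unfolding f_def by (rule wfrec[OF wf_revlex])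
    also have "\<dots> = H f \<epsilon>"
      unfolding H_def by (intro arg_cong2[of _ _ _ _ "(-)"] sum.cong refl) (use that in \<open>auto simp: cut_apply\<close>)
    finally show ?thesis unfolding H_def .
  qed
  define g where "g F = (\<Sum>\<delta>\<in>Comp n. coeff F (Poly_Mapping.nth \<delta>) * f \<delta>)" for F
  have lin: "Vector_Spaces.linear qscale (*) g"
    by (auto simp: Vector_Spaces.linear_iff vector_space_qscale vector_space_rat g_def
        plus_qsym.rep_eq qscale.rep_eq algebra_simps sum.distrib sum_distrib_left)
  have hom: "g F = 0" if "homogeneous d F" "d \<noteq> n" for d F
  proof -
    have "coeff F (Poly_Mapping.nth \<delta>) = 0" if "\<delta> \<in> Comp n" for \<delta>
      using that \<open>homogeneous d F\<close> \<open>d \<noteq> n\<close> mdegree_nth[of \<delta>] by (auto simp: homogeneous_def Comp_def)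
    then show ?thesis by (simp add: g_def)
  qed
  have bd: "\<exists>N. \<forall>d F. N \<le> d \<longrightarrow> homogeneous d F \<longrightarrow> g F = 0"
    using hom by (intro exI[of _ "Suc n"]) (auto simp: Suc_le_eq)
  define x where "x = Abs_nsym g"
  have x: "pairing x = g" unfolding x_def by (rule Abs_nsym_inverse) (use lin bd in simp)
  have "pairing x (qschur \<beta>) = (if \<beta> = \<alpha> then 1 else 0)" if \<beta>: "is_composition \<beta>" for \<beta>
  proof -
    have "g (qschur \<beta>) = (\<Sum>\<delta>\<in>Comp n. of_nat (kostka \<beta> \<delta>) * f \<delta>)"
      unfolding g_def by (intro sum.cong refl) (simp add: coeff_qschur[OF \<beta>] exponents_nth Comp_def)
    also have "\<dots> = (if \<beta> = \<alpha> then 1 else 0)"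
    proof (cases "\<beta> \<in> Comp n")
      case True
      then show ?thesis unfolding kostka_row_sum[OF True] using f[OF True] by simp
    next
      case False
      then have "kostka \<beta> \<delta> = 0" if "\<delta> \<in> Comp n" for \<delta>
        using kostka_size[of \<beta> \<delta>] that \<beta> by (auto simp: Comp_def)
      then show ?thesis using False assms by auto
    qed
    finally show ?thesis by (simp add: x)
  qed
  moreover have "pairing x (monomial_qsym \<delta>) = 0" if "is_composition \<delta>" "\<delta> \<notin> Comp n" for \<delta>
    unfolding x using hom[OF homogeneous_monomial, of \<delta>] that by (simp add: Comp_def)
  ultimately show ?thesis by blast
qed

lemma qschur_dual_pairing:
  assumes "is_composition \<alpha>"
  shows "is_composition \<beta> \<Longrightarrow> pairing (qschur_dual \<alpha>) (qschur \<beta>) = (if \<beta> = \<alpha> then 1 else 0)"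
    "is_composition \<delta> \<Longrightarrow> sum_list \<delta> \<noteq> sum_list \<alpha> \<Longrightarrow> pairing (qschur_dual \<alpha>) (monomial_qsym \<delta>) = 0"
proof -
  obtain x where x: "\<forall>\<beta>. is_composition \<beta> \<longrightarrow> pairing x (qschur \<beta>) = (if \<beta> = \<alpha> then 1 else 0)"
    "\<forall>\<delta>. is_composition \<delta> \<and> \<delta> \<notin> Comp (sum_list \<alpha>) \<longrightarrow> pairing x (monomial_qsym \<delta>) = 0"
    using qschur_dual_exists[of \<alpha> "sum_list \<alpha>"] assms by (auto simp: Comp_def)
  have "qschur_dual \<alpha> = x"
    unfolding qschur_dual_def
  proof (rule the_equality)
    show "\<forall>\<beta>. is_composition \<beta> \<longrightarrow> pairing x (qschur \<beta>) = (if \<beta> = \<alpha> then 1 else 0)" by (rule x(1))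
    fix y assume "\<forall>\<beta>. is_composition \<beta> \<longrightarrow> pairing y (qschur \<beta>) = (if \<beta> = \<alpha> then 1 else 0)"
    then show "y = x" using x(1) by (intro nsym_eqI) simp
  qed
  then show "is_composition \<beta> \<Longrightarrow> pairing (qschur_dual \<alpha>) (qschur \<beta>) = (if \<beta> = \<alpha> then 1 else 0)"
    "is_composition \<delta> \<Longrightarrow> sum_list \<delta> \<noteq> sum_list \<alpha> \<Longrightarrow> pairing (qschur_dual \<alpha>) (monomial_qsym \<delta>) = 0"
    using x by (auto simp: Comp_def)
qed

lemma qschur_dual_orthogonal:
  assumes "\<alpha> \<in> Comp n" "\<beta> \<in> Comp n"
  shows "(\<Sum>\<delta>\<in>Comp n. of_nat (kostka \<beta> \<delta>) * pairing (qschur_dual \<alpha>) (monomial_qsym \<delta>)) = (if \<beta> = \<alpha> then 1 else 0)"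
  using qschur_dual_pairing(1)[of \<alpha> \<beta>] assms pairing_qschur[OF assms(2), of "qschur_dual \<alpha>"]
  by (simp add: Comp_def)

section \<open>The coproduct of quasisymmetric Schur functions\<close>

lemma finite_splits: "finite {(\<beta>, \<gamma>). \<beta> @ \<gamma> = (\<alpha> :: nat list)}"
proof (rule finite_subset)
  show "{(\<beta>, \<gamma>). \<beta> @ \<gamma> = \<alpha>} \<subseteq> (\<lambda>k. (take k \<alpha>, drop k \<alpha>)) ` {..length \<alpha>}"
  proof clarify
    fix \<beta> \<gamma> :: "nat list"
    show "(\<beta>, \<gamma>) \<in> (\<lambda>k. (take k (\<beta> @ \<gamma>), drop k (\<beta> @ \<gamma>))) ` {..length (\<beta> @ \<gamma>)}"
      by (intro image_eqI[of _ _ "length \<beta>"]) auto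
  qed
qed simp

lemma pairing_times:
  "pairing (x * y) F = (\<Sum>\<alpha>\<in>Poly_Mapping.keys (monomial_coords F).
    Poly_Mapping.lookup (monomial_coords F) \<alpha> *
    (\<Sum>(\<beta>, \<gamma>) | \<beta> @ \<gamma> = \<alpha>. pairing x (monomial_qsym \<beta>) * pairing y (monomial_qsym \<gamma>)))"
proof -
  interpret t: Vector_Spaces.linear free_scale "(*)" "tensor_eval (pairing x) (pairing y)"
    by (rule linear_tensor_eval)
  show ?thesis
    unfolding times_nsym.rep_eq coproduct_def linear_extension_def[of free_scale] t.sum t.scale
    by (intro sum.cong refl arg_cong2[of _ _ _ _ "(*)"])
      (auto simp: tensor_eval_def linear_extension_basis[OF vector_space_rat])
qed

lemma lookup_monomial_coords:
  "is_composition \<epsilon> \<Longrightarrow> is_composition \<alpha> \<Longrightarrow> Poly_Mapping.lookup (monomial_coords (qschur \<alpha>)) \<epsilon> = of_nat (kostka \<alpha> \<epsilon>)"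
  by (simp add: monomial_coords.rep_eq coeff_qschur exponents_nth)

text \<open>The sum over all ways to cut the compositions in the support of \<open>qschur \<alpha>\<close> may be taken over
  \<open>Comp n \<times> Comp m\<close> instead, because the dual vectors vanish on all other degrees and \<open>kostka\<close> vanishes
  on pairs whose sizes do not fit.\<close>

lemma pairing_dual_times_dual:
  assumes \<alpha>: "is_composition \<alpha>" and \<gamma>: "\<gamma> \<in> Comp n" and \<beta>: "\<beta> \<in> Comp m"
  shows "pairing (qschur_dual \<gamma> * qschur_dual \<beta>) (qschur \<alpha>) =
    (\<Sum>\<delta>1\<in>Comp n. \<Sum>\<delta>2\<in>Comp m. of_nat (kostka \<alpha> (\<delta>1 @ \<delta>2)) *
      (pairing (qschur_dual \<gamma>) (monomial_qsym \<delta>1) * pairing (qschur_dual \<beta>) (monomial_qsym \<delta>2)))"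
proof -
  let ?C = "monomial_coords (qschur \<alpha>)"
  let ?g = "\<lambda>\<delta>. pairing (qschur_dual \<gamma>) (monomial_qsym \<delta>)" and ?h = "\<lambda>\<delta>. pairing (qschur_dual \<beta>) (monomial_qsym \<delta>)"
  let ?f = "\<lambda>(\<delta>1, \<delta>2). of_nat (kostka \<alpha> (\<delta>1 @ \<delta>2)) * (?g \<delta>1 * ?h \<delta>2)"
  let ?D = "SIGMA \<epsilon>:Poly_Mapping.keys ?C. {(\<delta>1, \<delta>2). \<delta>1 @ \<delta>2 = \<epsilon>}"
  have key: "is_composition \<epsilon>" if "\<epsilon> \<in> Poly_Mapping.keys ?C" for \<epsilon>
    using that by (auto simp: in_keys_iff monomial_coords.rep_eq split: if_splits)
  have comp: "is_composition (\<delta>1 @ \<delta>2) \<longleftrightarrow> is_composition \<delta>1 \<and> is_composition \<delta>2" for \<delta>1 \<delta>2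
    by (auto simp: is_composition_def)
  have "pairing (qschur_dual \<gamma> * qschur_dual \<beta>) (qschur \<alpha>) =
      (\<Sum>\<epsilon>\<in>Poly_Mapping.keys ?C. \<Sum>p\<in>{(\<delta>1, \<delta>2). \<delta>1 @ \<delta>2 = \<epsilon>}. ?f p)"
    unfolding pairing_times
  proof (intro sum.cong refl)
    fix \<epsilon> assume "\<epsilon> \<in> Poly_Mapping.keys ?C"
    then have "Poly_Mapping.lookup ?C \<epsilon> = of_nat (kostka \<alpha> \<epsilon>)"
      using key lookup_monomial_coords \<alpha> by blast
    then show "Poly_Mapping.lookup ?C \<epsilon> * (\<Sum>(\<delta>1, \<delta>2) | \<delta>1 @ \<delta>2 = \<epsilon>. ?g \<delta>1 * ?h \<delta>2) =
        (\<Sum>p\<in>{(\<delta>1, \<delta>2). \<delta>1 @ \<delta>2 = \<epsilon>}. ?f p)"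
      by (auto simp: sum_distrib_left intro!: sum.cong)
  qed
  also have "\<dots> = (\<Sum>p\<in>snd ` ?D. ?f p)"
  proof -
    have "(\<Sum>\<epsilon>\<in>Poly_Mapping.keys ?C. \<Sum>p\<in>{(\<delta>1, \<delta>2). \<delta>1 @ \<delta>2 = \<epsilon>}. ?f p) = (\<Sum>(\<epsilon>, p)\<in>?D. ?f p)"
      by (rule sum.Sigma) (auto intro: finite_splits)
    also have "\<dots> = (\<Sum>p\<in>snd ` ?D. ?f p)"
      by (rule sum.reindex_cong[symmetric, of snd]) (auto simp: inj_on_def)
    finally show ?thesis .
  qed
  also have "\<dots> = (\<Sum>p\<in>Comp n \<times> Comp m. ?f p)"
  proof (rule sum.mono_neutral_cong)
    show "finite (snd ` ?D)" by (intro finite_imageI finite_SigmaI) (auto intro: finite_splits)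
    show "finite (Comp n \<times> Comp m)" by (intro finite_cartesian_product finite_Comp)
    show "?f p = 0" if p: "p \<in> Comp n \<times> Comp m - snd ` ?D" for p
    proof -
      obtain \<delta>1 \<delta>2 where d: "p = (\<delta>1, \<delta>2)" "\<delta>1 \<in> Comp n" "\<delta>2 \<in> Comp m" using p by auto
      then have "is_composition (\<delta>1 @ \<delta>2)" by (simp add: Comp_def comp)
      moreover have "\<delta>1 @ \<delta>2 \<notin> Poly_Mapping.keys ?C"
      proof
        assume "\<delta>1 @ \<delta>2 \<in> Poly_Mapping.keys ?C"
        then have "(\<delta>1 @ \<delta>2, p) \<in> ?D" using d(1) by simp
        then show False using p by force
      qed
      ultimately have "kostka \<alpha> (\<delta>1 @ \<delta>2) = 0"
        using lookup_monomial_coords \<alpha> by (simp add: in_keys_iff)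
      then show ?thesis by (simp add: d(1))
    qed
    show "?f p = 0" if p: "p \<in> snd ` ?D - Comp n \<times> Comp m" for p
    proof -
      obtain \<delta>1 \<delta>2 where d: "p = (\<delta>1, \<delta>2)" "\<delta>1 @ \<delta>2 \<in> Poly_Mapping.keys ?C" using p by auto
      then have "is_composition \<delta>1" "is_composition \<delta>2" using key comp by blast+
      then have "?g \<delta>1 = 0 \<or> ?h \<delta>2 = 0"
        using p d(1) qschur_dual_pairing(2)[of \<gamma> \<delta>1] qschur_dual_pairing(2)[of \<beta> \<delta>2] \<beta> \<gamma>
        by (auto simp: Comp_def)
      then show ?thesis by (auto simp: d(1))
    qed
  qed simp
  also have "\<dots> = (\<Sum>\<delta>1\<in>Comp n. \<Sum>\<delta>2\<in>Comp m. of_nat (kostka \<alpha> (\<delta>1 @ \<delta>2)) * (?g \<delta>1 * ?h \<delta>2))"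
    by (simp add: sum.cartesian_product case_prod_unfold)
  finally show ?thesis .
qed

text \<open>Any word with end point \<open>\<gamma>\<close> would do: by \<open>lr_cong\<close> the choice does not affect \<open>lr\<close>.\<close>

definition some_word :: "nat list \<Rightarrow> nat list"
  where "some_word \<gamma> = (SOME q. q \<in> Yam (sum_list \<gamma>) \<and> walk [] q = \<gamma>)"

lemma word_exists: "is_composition \<gamma> \<Longrightarrow> \<exists>q. q \<in> Yam (sum_list \<gamma>) \<and> walk [] q = \<gamma>"
proof -
  assume "is_composition \<gamma>"
  then have "kostka \<gamma> \<gamma> \<noteq> 0" by (simp add: kostka_same)
  then have "{c. admissible [] c \<and> walk [] c = \<gamma> \<and> block_increasing \<gamma> c} \<noteq> {}"
    unfolding kostka_def by force
  then show ?thesis by (auto simp: Yam_def block_increasing_def)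
qed

lemma some_word: "\<gamma> \<in> Comp n \<Longrightarrow> some_word \<gamma> \<in> Yam n \<and> walk [] (some_word \<gamma>) = \<gamma>"
  using someI_ex[OF word_exists[of \<gamma>]] by (simp add: some_word_def Comp_def)

text \<open>To rectify a skew word, precede it by a word that leads to \<open>\<beta>\<close> and remove the letters of that
  word by slides.\<close>

lemma rectify_word:
  assumes "\<beta> \<in> Comp m" "s \<in> words_to \<beta> n \<alpha>"
  shows "\<exists>q\<in>Yam n. P_tableau (colword s) = tab q \<and> (\<forall>\<delta>. block_increasing \<delta> s \<longleftrightarrow> block_increasing \<delta> q)"
proof -
  obtain c where c: "c \<in> Yam m" "walk [] c = \<beta>"
    using word_exists[of \<beta>] assms(1) by (auto simp: Comp_def)
  have s: "length s = n" "admissible \<beta> s" using assms(2) by (simp_all add: words_to_def)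
  have cs: "admissible [] (c @ s)" "length (c @ s) = m + n" "drop m (c @ s) = s"
    using c s by (simp_all add: Yam_def admissible_append)
  obtain q js where r: "rectify m (c @ s) = (q, js)" by fastforce
  note F = rectify_correct[OF cs(1,2) r]
  have q: "admissible [] q" "length q = n" and k: "colword s \<approx> colword q"
    using F cs(3) by simp_all
  have "P_tableau (colword s) = tab q"
    using P_tableau_rectify[OF cs(1,2) r q(1)] cs(3) by simp
  moreover have "block_increasing \<delta> s \<longleftrightarrow> block_increasing \<delta> q" for \<delta>
  proof (cases "sum_list \<delta> = n")
    case True
    \<comment> \<open>Descents are invariants of the Knuth class.\<close>
    have "blocks_ok \<delta> (\<lambda>i. s ! i < s ! Suc i) = blocks_ok \<delta> (\<lambda>i. q ! i < q ! Suc i)"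
      by (rule blocks_ok_cong) (use knuth_colword_ascents[OF k] s(1) q(2) True in simp)
    then show ?thesis using s(1) q(2) by (simp add: block_increasing_def)
  next
    case False
    then show ?thesis using s(1) q(2) by (simp add: block_increasing_def)
  qed
  ultimately show ?thesis using q by (auto simp: Yam_def)
qed

lemma finite_words_to: 
  assumes "\<beta> \<in> Comp m"
  shows "finite (words_to \<beta> n \<alpha>)"
proof -
  obtain c where c: "c \<in> Yam m" "walk [] c = \<beta>"
    using word_exists[of \<beta>] assms(1) by (auto simp: Comp_def)
  have "(@) c ` words_to \<beta> n \<alpha> \<subseteq> Yam (m + n)"
    using c by (auto simp: words_to_def Yam_def admissible_append)
  then have "finite ((@) c ` words_to \<beta> n \<alpha>)" using finite_Yam finite_subset by blast
  then show ?thesis by (rule finite_imageD) (simp add: inj_on_def)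
qed

text \<open>The skew words are sorted by their rectification \<open>q\<close>, which has the same descents, and then
  by the C-shape of \<open>q\<close>.\<close>

lemma card_block_increasing_words:
  assumes \<beta>: "\<beta> \<in> Comp m" and \<delta>: "sum_list \<delta> = n"
  shows "card {s \<in> words_to \<beta> n \<alpha>. block_increasing \<delta> s} =
    (\<Sum>\<gamma>\<in>Comp n. kostka \<gamma> \<delta> * lr \<beta> (some_word \<gamma>) \<alpha>)"
proof -
  let ?S = "\<lambda>q. {s \<in> words_to \<beta> (length q) \<alpha>. P_tableau (colword s) = tab q}"
  let ?Q = "\<lambda>\<gamma>. {q. admissible [] q \<and> walk [] q = \<gamma> \<and> block_increasing \<delta> q}"
  let ?I = "{q \<in> Yam n. block_increasing \<delta> q}"
  have len: "length q = n" if "block_increasing \<delta> q" for q using that \<delta> by (simp add: block_increasing_def)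
  have uniq: "q = q'" if "q \<in> Yam n" "q' \<in> Yam n" "tab q = tab q'" for q q'
  proof -
    have "admissible [] q" "admissible [] q'" using that(1,2) by (simp_all add: Yam_def)
    then have "word (tab q) = q" "word (tab q') = q'" by (simp_all add: word_tab)
    then show ?thesis unfolding that(3) by (rule box_equals[OF refl])
  qed
  have "{s \<in> words_to \<beta> n \<alpha>. block_increasing \<delta> s} = (\<Union>q\<in>?I. ?S q)"
  proof (intro equalityI subsetI)
    fix s assume s: "s \<in> {s \<in> words_to \<beta> n \<alpha>. block_increasing \<delta> s}"
    then have s': "s \<in> words_to \<beta> n \<alpha>" "block_increasing \<delta> s" by simp_all
    from rectify_word[OF \<beta> s'(1)] obtain q where q: "q \<in> Yam n" "P_tableau (colword s) = tab q"
      "\<forall>\<delta>. block_increasing \<delta> s \<longleftrightarrow> block_increasing \<delta> q" by (elim bexE conjE)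
    have "q \<in> ?I" using q(1,3) s'(2) by simp
    moreover have "s \<in> ?S q" using q(1,2) s'(1) by (simp add: Yam_def)
    ultimately show "s \<in> (\<Union>q\<in>?I. ?S q)" by blast
  next
    fix s assume "s \<in> (\<Union>q\<in>?I. ?S q)"
    then obtain q where q: "q \<in> Yam n" "block_increasing \<delta> q" "s \<in> words_to \<beta> n \<alpha>" "P_tableau (colword s) = tab q"
      by (auto simp: Yam_def)
    from rectify_word[OF \<beta> q(3)] obtain q' where q': "q' \<in> Yam n" "P_tableau (colword s) = tab q'"
      "\<forall>\<delta>. block_increasing \<delta> s \<longleftrightarrow> block_increasing \<delta> q'" by (elim bexE conjE)
    have "q = q'" by (rule uniq[OF q(1) q'(1)]) (use q(4) q'(2) in simp)
    then show "s \<in> {s \<in> words_to \<beta> n \<alpha>. block_increasing \<delta> s}" using q q' by simp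
  qed
  then have "card {s \<in> words_to \<beta> n \<alpha>. block_increasing \<delta> s} = card (\<Union>q\<in>?I. ?S q)" by (rule arg_cong)
  also have "\<dots> = (\<Sum>q\<in>?I. card (?S q))"
  proof (rule card_disjoint_sum)
    show "finite ?I" using finite_Yam by simp
    show "finite (?S q)" for q using finite_words_to[OF \<beta>] by simp
    show "q = q'" if "q \<in> ?I" "q' \<in> ?I" "s \<in> ?S q" "s \<in> ?S q'" for q q' s
    proof (rule uniq)
      show "q \<in> Yam n" "q' \<in> Yam n" using that(1,2) by blast+
      have "P_tableau (colword s) = tab q" "P_tableau (colword s) = tab q'" using that(3,4) by blast+
      then show "tab q = tab q'" by (rule trans[OF sym])
    qed
  qed
  also have "\<dots> = (\<Sum>q\<in>?I. lr \<beta> q \<alpha>)" unfolding lr_def ..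
  also have "\<dots> = (\<Sum>q\<in>(\<Union>\<gamma>\<in>Comp n. ?Q \<gamma>). lr \<beta> q \<alpha>)"
  proof -
    have "?I = (\<Union>\<gamma>\<in>Comp n. ?Q \<gamma>)"
    proof (intro equalityI subsetI)
      fix q assume "q \<in> ?I"
      then show "q \<in> (\<Union>\<gamma>\<in>Comp n. ?Q \<gamma>)" using walk_Comp[of q n] by (auto simp: Yam_def)
    next
      fix q assume "q \<in> (\<Union>\<gamma>\<in>Comp n. ?Q \<gamma>)"
      then have "admissible [] q" "block_increasing \<delta> q" by blast+
      then show "q \<in> ?I" using len[of q] by (simp add: Yam_def)
    qed
    then show ?thesis by (simp only:)
  qed
  also have "\<dots> = (\<Sum>\<gamma>\<in>Comp n. \<Sum>q\<in>?Q \<gamma>. lr \<beta> q \<alpha>)"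
  proof (rule sum.UNION_disjoint[OF finite_Comp])
    have "?Q \<gamma> \<subseteq> Yam n" for \<gamma>
    proof
      fix q assume "q \<in> ?Q \<gamma>"
      then have "admissible [] q" "block_increasing \<delta> q" by blast+
      then show "q \<in> Yam n" using len[of q] by (simp add: Yam_def)
    qed
    then show "\<forall>\<gamma>\<in>Comp n. finite (?Q \<gamma>)" using finite_Yam finite_subset by blast
  qed auto
  also have "\<dots> = (\<Sum>\<gamma>\<in>Comp n. kostka \<gamma> \<delta> * lr \<beta> (some_word \<gamma>) \<alpha>)"
  proof (intro sum.cong refl)
    fix \<gamma> assume \<gamma>: "\<gamma> \<in> Comp n"
    have "lr \<beta> q \<alpha> = lr \<beta> (some_word \<gamma>) \<alpha>" if "q \<in> ?Q \<gamma>" for q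
    proof (rule lr_cong[OF _ _ _ \<beta>, of _ n])
      have q: "admissible [] q" "block_increasing \<delta> q" "walk [] q = \<gamma>" using that by blast+
      show "q \<in> Yam n" using q(1) len[OF q(2)] by (simp add: Yam_def)
      show "some_word \<gamma> \<in> Yam n" "walk [] q = walk [] (some_word \<gamma>)" using some_word[OF \<gamma>] q(3) by simp_all
    qed
    then show "(\<Sum>q\<in>?Q \<gamma>. lr \<beta> q \<alpha>) = kostka \<gamma> \<delta> * lr \<beta> (some_word \<gamma>) \<alpha>"
      unfolding kostka_def by simp
  qed
  finally show ?thesis .
qed

text \<open>The coproduct of quasisymmetric Schur functions in coordinates. A block increasing word for
  \<open>\<delta>1 @ \<delta>2\<close> is cut into a word for \<open>\<delta>2\<close>, which comes first, and a skew word for \<open>\<delta>1\<close>.\<close>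

lemma kostka_append:
  assumes "sum_list \<delta>1 = n" "sum_list \<delta>2 = m"
  shows "kostka \<alpha> (\<delta>1 @ \<delta>2) =
    (\<Sum>\<beta>\<in>Comp m. kostka \<beta> \<delta>2 * (\<Sum>\<gamma>\<in>Comp n. kostka \<gamma> \<delta>1 * lr \<beta> (some_word \<gamma>) \<alpha>))"
proof -
  have "{c. admissible [] c \<and> walk [] c = \<alpha> \<and> block_increasing (\<delta>1 @ \<delta>2) c} =
    {c \<in> Yam (m + n). walk [] c = \<alpha> \<and> block_increasing \<delta>2 (take m c) \<and> block_increasing \<delta>1 (drop m c)}"
    using assms by (auto simp: block_increasing_append Yam_def)
  then have "kostka \<alpha> (\<delta>1 @ \<delta>2) = (\<Sum>\<beta>\<in>Comp m. kostka \<beta> \<delta>2 * card {s \<in> words_to \<beta> n \<alpha>. block_increasing \<delta>1 s})"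
    unfolding kostka_def[of \<alpha>] using card_split[OF assms(2)] by simp
  also have "\<dots> = (\<Sum>\<beta>\<in>Comp m. kostka \<beta> \<delta>2 * (\<Sum>\<gamma>\<in>Comp n. kostka \<gamma> \<delta>1 * lr \<beta> (some_word \<gamma>) \<alpha>))"
    by (intro sum.cong refl) (simp add: card_block_increasing_words assms(1))
  finally show ?thesis .
qed

text \<open>By \<open>kostka_append\<close> the coproduct of \<open>qschur \<alpha>\<close> is the sum of \<open>lr \<beta> q \<alpha>\<close> times
  \<open>qschur \<gamma> \<otimes> qschur \<beta>\<close>, where \<open>q\<close> has C-shape \<open>\<gamma>\<close>, and the dual vectors single out one
  coefficient.\<close>

lemma pairing_dual_times_dual_lr:
  assumes \<alpha>: "is_composition \<alpha>" and \<gamma>: "\<gamma> \<in> Comp n" and \<beta>: "\<beta> \<in> Comp m"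
  shows "pairing (qschur_dual \<gamma> * qschur_dual \<beta>) (qschur \<alpha>) = of_nat (lr \<beta> (some_word \<gamma>) \<alpha>)"
proof -
  let ?g = "\<lambda>\<delta>. pairing (qschur_dual \<gamma>) (monomial_qsym \<delta>)" and ?h = "\<lambda>\<delta>. pairing (qschur_dual \<beta>) (monomial_qsym \<delta>)"
  let ?l = "\<lambda>\<beta>' \<gamma>'. of_nat (lr \<beta>' (some_word \<gamma>') \<alpha>) :: rat"
  let ?k = "\<lambda>\<beta>' \<delta>. of_nat (kostka \<beta>' \<delta>) :: rat"
  have "pairing (qschur_dual \<gamma> * qschur_dual \<beta>) (qschur \<alpha>) =
      (\<Sum>\<delta>1\<in>Comp n. \<Sum>\<delta>2\<in>Comp m. of_nat (kostka \<alpha> (\<delta>1 @ \<delta>2)) * (?g \<delta>1 * ?h \<delta>2))"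
    by (rule pairing_dual_times_dual[OF assms])
  also have "\<dots> = (\<Sum>\<delta>1\<in>Comp n. \<Sum>\<delta>2\<in>Comp m. \<Sum>\<beta>'\<in>Comp m. \<Sum>\<gamma>'\<in>Comp n.
      ?l \<beta>' \<gamma>' * ((?k \<gamma>' \<delta>1 * ?g \<delta>1) * (?k \<beta>' \<delta>2 * ?h \<delta>2)))"
  proof (intro sum.cong refl)
    fix \<delta>1 \<delta>2 assume d: "\<delta>1 \<in> Comp n" "\<delta>2 \<in> Comp m"
    have k: "of_nat (kostka \<alpha> (\<delta>1 @ \<delta>2)) = (\<Sum>\<beta>'\<in>Comp m. ?k \<beta>' \<delta>2 * (\<Sum>\<gamma>'\<in>Comp n. ?k \<gamma>' \<delta>1 * ?l \<beta>' \<gamma>'))"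
      using kostka_append[of \<delta>1 n \<delta>2 m \<alpha>] d by (simp add: Comp_def)
    show "of_nat (kostka \<alpha> (\<delta>1 @ \<delta>2)) * (?g \<delta>1 * ?h \<delta>2) = (\<Sum>\<beta>'\<in>Comp m. \<Sum>\<gamma>'\<in>Comp n.
      ?l \<beta>' \<gamma>' * ((?k \<gamma>' \<delta>1 * ?g \<delta>1) * (?k \<beta>' \<delta>2 * ?h \<delta>2)))"
      unfolding k sum_distrib_left sum_distrib_right by (intro sum.cong refl) (simp add: algebra_simps)
  qed
  also have "\<dots> = (\<Sum>\<beta>'\<in>Comp m. \<Sum>\<gamma>'\<in>Comp n. \<Sum>\<delta>1\<in>Comp n. \<Sum>\<delta>2\<in>Comp m.
      ?l \<beta>' \<gamma>' * ((?k \<gamma>' \<delta>1 * ?g \<delta>1) * (?k \<beta>' \<delta>2 * ?h \<delta>2)))"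
  proof -
    have swap: "(\<Sum>a\<in>A. \<Sum>b\<in>B. \<Sum>c\<in>C. \<Sum>d\<in>D. F a b c d) = (\<Sum>c\<in>C. \<Sum>d\<in>D. \<Sum>a\<in>A. \<Sum>b\<in>B. F a b c d)"
      for A D :: "'x set" and B C :: "'y set" and F :: "'x \<Rightarrow> 'y \<Rightarrow> 'y \<Rightarrow> 'x \<Rightarrow> rat"
    proof -
      have "(\<Sum>a\<in>A. \<Sum>b\<in>B. \<Sum>c\<in>C. \<Sum>d\<in>D. F a b c d) = (\<Sum>a\<in>A. \<Sum>c\<in>C. \<Sum>b\<in>B. \<Sum>d\<in>D. F a b c d)"
        by (rule sum.cong[OF refl], rule sum.swap)
      also have "\<dots> = (\<Sum>c\<in>C. \<Sum>a\<in>A. \<Sum>b\<in>B. \<Sum>d\<in>D. F a b c d)"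
        by (rule sum.swap)
      also have "\<dots> = (\<Sum>c\<in>C. \<Sum>a\<in>A. \<Sum>d\<in>D. \<Sum>b\<in>B. F a b c d)"
        by (rule sum.cong[OF refl], rule sum.cong[OF refl], rule sum.swap)
      also have "\<dots> = (\<Sum>c\<in>C. \<Sum>d\<in>D. \<Sum>a\<in>A. \<Sum>b\<in>B. F a b c d)"
        by (rule sum.cong[OF refl], rule sum.swap)
      finally show ?thesis .
    qed
    show ?thesis by (rule swap)
  qed
  also have "\<dots> = (\<Sum>\<beta>'\<in>Comp m. \<Sum>\<gamma>'\<in>Comp n. ?l \<beta>' \<gamma>' *
      ((\<Sum>\<delta>1\<in>Comp n. ?k \<gamma>' \<delta>1 * ?g \<delta>1) * (\<Sum>\<delta>2\<in>Comp m. ?k \<beta>' \<delta>2 * ?h \<delta>2)))"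
    unfolding sum_product unfolding sum_distrib_left ..
  also have "\<dots> = (\<Sum>\<beta>'\<in>Comp m. \<Sum>\<gamma>'\<in>Comp n. if \<gamma>' = \<gamma> then (if \<beta>' = \<beta> then ?l \<beta>' \<gamma> else 0) else 0)"
    by (intro sum.cong refl) (simp add: qschur_dual_orthogonal[OF \<gamma>] qschur_dual_orthogonal[OF \<beta>])
  also have "\<dots> = ?l \<beta> \<gamma>"
    using \<beta> \<gamma> by (simp add: finite_Comp)
  finally show ?thesis .
qed

section \<open>The anti-morphism\<close>

lemma C_shape_Comp: "C_shape T \<in> Comp (length (srt_word T))"
  unfolding C_shape_walk by (rule walk_Comp) (simp add: Yam_def)

lemma finite_PR_product_set: "finite (PR_product_set T1 T2)"
proof (rule finite_imageD)
  show "inj_on srt_word (PR_product_set T1 T2)" using srt_word_inj by (auto simp: inj_on_def)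
  have "srt_word ` PR_product_set T1 T2 \<subseteq> Yam (length (srt_word T1) + length (srt_word T2))"
    by (auto simp: PR_product_set_iff Yam_def admissible_srt_word[simplified])
  then show "finite (srt_word ` PR_product_set T1 T2)" using finite_Yam finite_subset by blast
qed

lemma card_PR_product_set:
  "card {T \<in> PR_product_set T1 T2. C_shape T = \<alpha>} = lr (C_shape T1) (srt_word T2) \<alpha>"
proof -
  let ?S = "{s \<in> words_to (C_shape T1) (length (srt_word T2)) \<alpha>. P_tableau (colword s) = tab (srt_word T2)}"
  have "bij_betw (\<lambda>T. drop (length (srt_word T1)) (srt_word T)) {T \<in> PR_product_set T1 T2. C_shape T = \<alpha>} ?S"
    unfolding bij_betw_def
  proof
    show "inj_on (\<lambda>T. drop (length (srt_word T1)) (srt_word T)) {T \<in> PR_product_set T1 T2. C_shape T = \<alpha>}"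
    proof (rule inj_onI)
      fix T T' assume *: "T \<in> {T \<in> PR_product_set T1 T2. C_shape T = \<alpha>}" "T' \<in> {T \<in> PR_product_set T1 T2. C_shape T = \<alpha>}"
        "drop (length (srt_word T1)) (srt_word T) = drop (length (srt_word T1)) (srt_word T')"
      then obtain s s' where s: "srt_word T = srt_word T1 @ s" "srt_word T' = srt_word T1 @ s'" by (auto simp: PR_product_set_iff)
      then have "srt_word T = srt_word T'" using *(3) by simp
      then show "T = T'" by (rule srt_word_inj)
    qed
    show "(\<lambda>T. drop (length (srt_word T1)) (srt_word T)) ` {T \<in> PR_product_set T1 T2. C_shape T = \<alpha>} = ?S"
    proof (intro equalityI subsetI)
      fix s assume "s \<in> (\<lambda>T. drop (length (srt_word T1)) (srt_word T)) ` {T \<in> PR_product_set T1 T2. C_shape T = \<alpha>}"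
      then obtain T where T: "T \<in> PR_product_set T1 T2" "C_shape T = \<alpha>" "s = drop (length (srt_word T1)) (srt_word T)" by blast
      then obtain s' where s': "srt_word T = srt_word T1 @ s'" "length s' = length (srt_word T2)" "P_tableau (colword s') = tab (srt_word T2)"
        unfolding PR_product_set_iff by blast
      have "s = s'" using T(3) s'(1) by simp
      moreover have "admissible [] (srt_word T1 @ s')" using admissible_srt_word[of T] unfolding s'(1) .
      then have "admissible (C_shape T1) s'" by (simp add: admissible_append C_shape_walk)
      moreover have "walk (C_shape T1) s' = \<alpha>"
        using T(2) unfolding C_shape_walk s'(1) by simp
      ultimately show "s \<in> ?S" using s' by (simp add: words_to_def)
    next
      fix s assume s: "s \<in> ?S"
      then have "admissible [] (srt_word T1 @ s)" by (simp add: admissible_append words_to_def C_shape_walk)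
      then obtain T where T: "srt_word T = srt_word T1 @ s" using srt_word_surj by blast
      have "T \<in> PR_product_set T1 T2" unfolding PR_product_set_iff
        using s T by (intro exI[of _ s]) (simp add: words_to_def)
      moreover have "C_shape T = \<alpha>" using s unfolding C_shape_walk T by (simp add: words_to_def C_shape_walk)
      moreover have "s = drop (length (srt_word T1)) (srt_word T)" by (simp add: T)
      ultimately show "s \<in> (\<lambda>T. drop (length (srt_word T1)) (srt_word T)) ` {T \<in> PR_product_set T1 T2. C_shape T = \<alpha>}"
        by blast
    qed
  qed
  then show ?thesis unfolding lr_def by (rule bij_betw_same_card)
qed

lemma pairing_nsym_sum: "pairing (\<Sum>i\<in>A. x i) F = (\<Sum>i\<in>A. pairing (x i) F)"
  by (induction A rule: infinite_finite_induct) (simp_all add: zero_nsym.rep_eq plus_nsym.rep_eq)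

text \<open>Both sides pair with \<open>qschur \<alpha>\<close> to the number of tableaux of C-shape \<open>\<alpha>\<close> in the product. For
  the right-hand side this needs that the word of \<open>T2\<close> may be replaced by another one with the same
  C-shape.\<close>

lemma phi_product_basis:
  "(\<Sum>T\<in>PR_product_set T1 T2. qschur_dual (C_shape T)) = qschur_dual (C_shape T2) * qschur_dual (C_shape T1)"
proof (rule nsym_eqI)
  fix \<alpha> assume \<alpha>: "is_composition \<alpha>"
  have "pairing (\<Sum>T\<in>PR_product_set T1 T2. qschur_dual (C_shape T)) (qschur \<alpha>) =
      (\<Sum>T\<in>PR_product_set T1 T2. if C_shape T = \<alpha> then 1 else 0)"
    unfolding pairing_nsym_sum
    using qschur_dual_pairing(1)[OF _ \<alpha>] C_shape_Comp by (intro sum.cong refl) (auto simp: Comp_def)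
  also have "\<dots> = of_nat (card {T \<in> PR_product_set T1 T2. C_shape T = \<alpha>})"
    using finite_PR_product_set by (simp add: sum.If_cases Int_def)
  also have "\<dots> = of_nat (lr (C_shape T1) (srt_word T2) \<alpha>)" by (simp add: card_PR_product_set)
  also have "lr (C_shape T1) (srt_word T2) \<alpha> = lr (C_shape T1) (some_word (C_shape T2)) \<alpha>"
    by (rule lr_cong[OF _ _ _ C_shape_Comp, of _ "length (srt_word T2)"])
      (use some_word[OF C_shape_Comp[of T2]] in \<open>auto simp: Yam_def C_shape_walk\<close>)
  also have "of_nat \<dots> = pairing (qschur_dual (C_shape T2) * qschur_dual (C_shape T1)) (qschur \<alpha>)"
    by (rule pairing_dual_times_dual_lr[OF \<alpha> C_shape_Comp C_shape_Comp, symmetric])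
  finally show "pairing (\<Sum>T\<in>PR_product_set T1 T2. qschur_dual (C_shape T)) (qschur \<alpha>) =
      pairing (qschur_dual (C_shape T2) * qschur_dual (C_shape T1)) (qschur \<alpha>)" .
qed

lemma nsym_times_sum:
  "(\<Sum>i\<in>A. nscale (r i) (x i)) * y = (\<Sum>i\<in>A. nscale (r i) (x i * y))"
  "y * (\<Sum>i\<in>A. nscale (r i) (x i)) = (\<Sum>i\<in>A. nscale (r i) (y * x i))"
proof -
  have *: "pairing (a * b) F = (\<Sum>p\<in>Poly_Mapping.keys (coproduct F). Poly_Mapping.lookup (coproduct F) p *
      (pairing a (monomial_qsym (fst p)) * pairing b (monomial_qsym (snd p))))" for a b F
    by (simp add: times_nsym.rep_eq tensor_eval_def linear_extension_def case_prod_unfold)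
  show "(\<Sum>i\<in>A. nscale (r i) (x i)) * y = (\<Sum>i\<in>A. nscale (r i) (x i * y))"
    "y * (\<Sum>i\<in>A. nscale (r i) (x i)) = (\<Sum>i\<in>A. nscale (r i) (y * x i))"
    unfolding pairing_inject[symmetric] fun_eq_iff * pairing_nsym_sum nscale.rep_eq
      sum_distrib_left sum_distrib_right
    by (subst sum.swap, simp add: mult_ac)+
qed

lemma phi_linear: "Vector_Spaces.linear free_scale nscale phi"
  unfolding phi_def by (rule linear_linear_extension[OF vector_space_nscale])

lemma phi_basis: "phi (basis T) = qschur_dual (C_shape T)"
  unfolding phi_def by (rule linear_extension_basis[OF vector_space_nscale])

lemma phi_mult: "phi (x \<star> y) = phi y * phi x"
proof -
  interpret p: Vector_Spaces.linear free_scale nscale phi by (rule phi_linear)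
  let ?x = "Poly_Mapping.lookup x" and ?y = "Poly_Mapping.lookup y"
  have "phi (x \<star> y) = (\<Sum>T1\<in>Poly_Mapping.keys x. nscale (?x T1) (\<Sum>T2\<in>Poly_Mapping.keys y. nscale (?y T2)
      (\<Sum>T\<in>PR_product_set T1 T2. qschur_dual (C_shape T))))"
    unfolding PR_mult_def linear_extension_def p.sum p.scale phi_basis ..
  also have "\<dots> = (\<Sum>T1\<in>Poly_Mapping.keys x. nscale (?x T1) (\<Sum>T2\<in>Poly_Mapping.keys y. nscale (?y T2)
      (qschur_dual (C_shape T2) * qschur_dual (C_shape T1))))"
    by (simp only: phi_product_basis)
  also have "\<dots> = phi y * phi x"
    unfolding phi_def linear_extension_def nsym_times_sum ..
  finally show ?thesis .
qed

lemma srt_word_empty: "srt_word empty_srt = []"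
proof -
  obtain T where T: "srt_word T = []" using srt_word_surj[of "[]"] by auto
  have "Rep_srt T = tab []" using tab_srt_word[of T] by (simp add: T)
  also have "\<dots> = Map.empty" by (auto simp: tab_def)
  finally have "T = empty_srt" unfolding empty_srt_def by (metis Rep_srt_inverse)
  then show ?thesis using T by simp
qed

lemma phi_empty: "phi (basis empty_srt) = 1"
proof -
  have "qschur_dual [] = 1"
  proof (rule nsym_eqI)
    fix \<beta> assume \<beta>: "is_composition \<beta>"
    have "exponents 0 = []" by (simp add: exponents_def)
    then have "pairing 1 (qschur \<beta>) = of_nat (kostka \<beta> [])"
      by (simp add: one_nsym.rep_eq coeff_qschur[OF \<beta>])
    then show "pairing (qschur_dual []) (qschur \<beta>) = pairing 1 (qschur \<beta>)"
      using qschur_dual_pairing(1)[of "[]" \<beta>] \<beta> by (simp add: kostka_Nil is_composition_def)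
  qed
  then show ?thesis by (simp add: phi_basis C_shape_walk srt_word_empty)
qed

lemma homogeneous_qschur: "is_composition \<alpha> \<Longrightarrow> homogeneous (sum_list \<alpha>) (qschur \<alpha>)"
  using kostka_size[of \<alpha>] by (auto simp: homogeneous_def coeff_qschur mdegree_eq_sum_exponents)

text \<open>Every composition is a C-shape, and a linear form that vanishes in high degrees is a finite
  combination of dual basis vectors.\<close>

lemma phi_surj: "surj phi"
proof (rule surjI)
  interpret p: Vector_Spaces.linear free_scale nscale phi by (rule phi_linear)
  have "\<exists>x. phi x = y" for y
  proof -
    obtain N where N: "\<And>d F. N \<le> d \<Longrightarrow> homogeneous d F \<Longrightarrow> pairing y F = 0"
      using pairing[of y] by auto
    define A where "A = {\<alpha>. is_composition \<alpha> \<and> sum_list \<alpha> \<le> N}"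
    have fin: "finite A" unfolding A_def by (rule finite_compositions_le)
    have "\<exists>T. C_shape T = \<alpha>" if "is_composition \<alpha>" for \<alpha>
      using word_exists[OF that] srt_word_surj unfolding C_shape_walk Yam_def by (metis (mono_tags, lifting) mem_Collect_eq)
    then obtain t where t: "\<And>\<alpha>. is_composition \<alpha> \<Longrightarrow> C_shape (t \<alpha>) = \<alpha>" by metis
    let ?x = "\<Sum>\<alpha>\<in>A. free_scale (pairing y (qschur \<alpha>)) (basis (t \<alpha>))"
    have "phi ?x = (\<Sum>\<alpha>\<in>A. nscale (pairing y (qschur \<alpha>)) (qschur_dual \<alpha>))"
      unfolding p.sum p.scale phi_basis by (intro sum.cong refl) (simp add: t A_def)
    also have "\<dots> = y"
    proof (rule nsym_eqI)
      fix \<beta> assume \<beta>: "is_composition \<beta>"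
      have "pairing (\<Sum>\<alpha>\<in>A. nscale (pairing y (qschur \<alpha>)) (qschur_dual \<alpha>)) (qschur \<beta>) =
          (\<Sum>\<alpha>\<in>A. if \<alpha> = \<beta> then pairing y (qschur \<beta>) else 0)"
        unfolding pairing_nsym_sum nscale.rep_eq
        by (intro sum.cong refl) (use qschur_dual_pairing(1)[OF _ \<beta>] in \<open>auto simp: A_def\<close>)
      also have "\<dots> = (if \<beta> \<in> A then pairing y (qschur \<beta>) else 0)" using fin by simp
      also have "\<dots> = pairing y (qschur \<beta>)"
        using N[OF _ homogeneous_qschur[OF \<beta>]] \<beta> by (auto simp: A_def)
      finally show "pairing (\<Sum>\<alpha>\<in>A. nscale (pairing y (qschur \<alpha>)) (qschur_dual \<alpha>)) (qschur \<beta>) = pairing y (qschur \<beta>)" .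
    qed
    finally show ?thesis by blast
  qed
  then show "phi (SOME x. phi x = y) = y" for y by (rule someI_ex)
qed

theorem theorem5p4:
  shows "Vector_Spaces.linear free_scale nscale phi \<and>
    (\<forall>T. phi (basis T) = qschur_dual (C_shape T)) \<and>
    surj phi \<and>
    phi (basis empty_srt) = 1 \<and>
    (\<forall>x y. phi (x \<star> y) = phi y * phi x)"
  using phi_linear phi_basis phi_surj phi_empty phi_mult by blast


end
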